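(* The map $\Phi:(\widehat{\mathcal{H}},\sqcup,\Delta)\to(\mathfrak{l}^\infty,\mu,\delta)$ is an isomorphism of bialgebras.
   Context: $\mathbb{K}$ is a field of characteristic zero. Graphs: a graph $\Gamma$ is a finite set of half-edges with a partition $E(\Gamma)$ into 2-element sets (edges), a partition $V(\Gamma)$ (vertices), and a subset $V_{\mathrm{ext}}(\Gamma)$ of the 1-valent vertices (external vertices); the others are internal. Isomorphisms preserve all data; $\mathrm{Aut}(\Gamma)$. $\mathcal{H}$ has basis the isomorphism classes of graphs, $\mathcal{H}_n$ is spanned by graphs with $n$ edges, $\widehat{\mathcal{H}}=\prod_n\mathcal{H}_n$ with commutative product $\sqcup$ (disjoint union, extended continuously). With $\langle\Gamma_1,\Gamma_2\rangle=1$ if $\Gamma_1\cong\Gamma_2$ and $0$ otherwise, $I:\widehat{\mathcal{H}}\to\mathcal{H}^*$, $I(\Gamma)=|\mathrm{Aut}(\Gamma)|\langle\Gamma,-\rangle$, and $\Delta:\widehat{\mathcal{H}}\to\widehat{\mathcal{H}}\hat\otimes\widehat{\mathcal{H}}$ is defined by $(I\hat\otimes I)\circ\Delta=\sqcup^*\circ I$ (equivalently, $\Delta$ is the cocommutative coproduct of $\widehat{\mathcal{H}}\cong\widehat{S}(\widehat{\mathcal{H}}_c)$ for which connected graphs are primitive). Tensors: for $n\ge1$, $V_n=\mathbb{K}^n$ with basis $x_1,\dots,x_n$ and form $\langle x_i,x_j\rangle=\delta_{ij}$; $O(n)$ its orthogonal group; $x_1^*,\dots,x_n^*$ the dual basis,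 and the inverse form on $V_n^*$ is $\langle x_i^*,x_j^*\rangle^{-1}=\delta_{ij}$. For such $V$, $\widehat{\mathfrak{h}}[V]=\prod_{d\ge0}S^d(V^* )$ (formal power series), $\widehat{\mathfrak{h}}_{\ge1}[V]=\prod_{d\ge1}S^d(V^* )$, $\mathfrak{h}[V]=S(V^* )$, $\widehat{S}(W)=\prod_dW^{\hat\otimes d}/\mathbb{S}_d$, and $\mathfrak{l}[V]=\big[\widehat{S}(\widehat{\mathfrak{h}}_{\ge1}[V])\hat\otimes\widehat{\mathfrak{h}}[V]\big]^{O(V)}$. Put $\mathfrak{l}^n=\mathfrak{l}[V_n]$; restriction along $V_n\to V_{n+1}$, $x_i\mapsto x_i$ (i.e. $V_{n+1}^*\to V_n^*$, $x_i^*\mapsto x_i^*$ for $i\le n$, $x_{n+1}^*\mapsto0$) gives maps $\mathfrak{l}^{n+1}\to\mathfrak{l}^n$, and $\mathfrak{l}^\infty=\varprojlim_n\mathfrak{l}^n$. $\mathfrak{l}_{Nk}$ denotes the part of tensor degree $2N$ in $V^*$ and degree $k$ in the factor $\widehat{\mathfrak{h}}[V]$. Product $\mu$: the tensor product of the products of $\widehat{S}(\widehat{\mathfrak{h}}_{\ge1}[V])$ and $\widehat{\mathfrak{h}}[V]$, restricted to invariants, assembled over $n$. Coproduct $\delta$: let $\delta_1$ be the cocommutative coproduct of $\widehat{S}(\widehat{\mathfrak{h}}_{\ge1}[V])$ with $\widehat{\mathfrak{h}}_{\ge1}[V]$ primitive and $\delta_2$ that of $\widehat{\mathfrak{h}}[V]=\widehat{S}(V^*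 )$ with $V^*$ primitive, and $\delta=\delta_1\hat\otimes\delta_2$ (tensor product coalgebra). For $m,n\ge1$ let $\pi_m,\pi_n$ be the restrictions along $V_m\to V_{m+n}$, $x_i\mapsto x_i$, and $V_n\to V_{m+n}$, $x_i\mapsto x_{m+i}$ (so $\pi_m(x_i^* )=x_i^*$, $\pi_m(x_{m+i}^* )=0$, $\pi_n(x_i^* )=0$, $\pi_n(x_{m+i}^* )=x_i^*$). The composites $\mathfrak{l}^\infty\to\mathfrak{l}^{m+n}\xrightarrow{(\pi_m\hat\otimes\pi_n)\circ\delta}\mathfrak{l}^m\hat\otimes\mathfrak{l}^n$ are compatible and define $\delta:\mathfrak{l}^\infty\to\mathfrak{l}^\infty\hat\otimes\mathfrak{l}^\infty=\varprojlim_{m,n}\mathfrak{l}^m\hat\otimes\mathfrak{l}^n$. The map $\Phi$: for a graph $\Gamma$ with internal vertices $v_1,\dots,v_m$ and external vertices $u_1,\dots,u_{k_0}$, and for $n\ge1$, set \[ \Phi^n(\Gamma)=\sum_{\ell:E(\Gamma)\to\{1,\dots,n\}}\Big(\prod_{j=1}^m\prod_{h\in v_j}x^*_{\ell(h)}\Big)\otimes\Big(\prod_{r=1}^{k_0}x^*_{\ell(u_r)}\Big)\in\big[S^m(\mathfrak{h}_{\ge1}[V_n])\otimes\mathfrak{h}[V_n]\big]^{O(n)}\subset\mathfrak{l}^n, \] where $\ell(h)$ is the label of the edge containing $h$, $\ell(u_r)$ the label of the edge containing the half-edge of $u_r$, each inner product $\prod_{h\in v_j}x^*_{\ell(h)}$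 is a monomial in $\mathfrak{h}_{\ge1}[V_n]$, and the outer product over $j$ is taken in $S^m(\mathfrak{h}_{\ge1}[V_n])$ (equivalently, each edge is decorated by $\sum_ix_i^*\otimes x_i^*$). Extending linearly and continuously, the maps $\Phi^n:\widehat{\mathcal{H}}\to\mathfrak{l}^n$ are compatible with the projections and define $\Phi:\widehat{\mathcal{H}}\to\mathfrak{l}^\infty$; a graph with $N$ edges and $k$ external vertices maps into $\mathfrak{l}^\infty_{Nk}$. *)

theory Defs
  imports Main "HOL-Library.Multiset" "HOL-Library.FuncSet"
begin

text \<open>A graph: half-edges are 0..<hn; eg is the fixed-point-free involution giving the
edges; two half-edges lie at the same vertex iff they have the same vg-label; exg is
the set of half-edges forming external (necessarily 1-valent) vertices.\<close>

record graph =
  hn :: nat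
  eg :: "nat \<Rightarrow> nat"
  vg :: "nat \<Rightarrow> nat"
  exg :: "nat set"

definition wf_graph :: "graph \<Rightarrow> bool" where
  "wf_graph G \<longleftrightarrow>
     (\<forall>x<hn G. eg G x < hn G \<and> eg G (eg G x) = x \<and> eg G x \<noteq> x) \<and>
     exg G \<subseteq> {0..<hn G} \<and>
     (\<forall>x\<in>exg G. \<forall>y<hn G. vg G y = vg G x \<longrightarrow> y = x)"

definition iso_by :: "graph \<Rightarrow> graph \<Rightarrow> (nat \<Rightarrow> nat) \<Rightarrow> bool" where
  "iso_by G G' s \<longleftrightarrow> hn G = hn G' \<and> bij_betw s {0..<hn G} {0..<hn G'} \<and>
     (\<forall>x<hn G. s (eg G x) = eg G' (s x)) \<and>
     (\<forall>x<hn G. \<forall>y<hn G. vg G x = vg G y \<longleftrightarrow> vg G' (s x) = vg G' (s y)) \<and>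
     s ` exg G = exg G'"

definition giso :: "graph \<Rightarrow> graph \<Rightarrow> bool" where
  "giso G G' \<longleftrightarrow> (\<exists>s. iso_by G G' s)"

definition Aut :: "graph \<Rightarrow> (nat \<Rightarrow> nat) set" where
  "Aut G = {s \<in> {0..<hn G} \<rightarrow>\<^sub>E {0..<hn G}. iso_by G G s}"

definition gunion :: "graph \<Rightarrow> graph \<Rightarrow> graph" where
  "gunion G1 G2 =
    \<lparr>hn = hn G1 + hn G2,
     eg = (\<lambda>x. if x < hn G1 then eg G1 x else eg G2 (x - hn G1) + hn G1),
     vg = (\<lambda>x. if x < hn G1 then 2 * vg G1 x else 2 * vg G2 (x - hn G1) + 1),
     exg = exg G1 \<union> (\<lambda>x. x + hn G1) ` exg G2\<rparr>"

definition empty_graph :: graph where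
  "empty_graph = \<lparr>hn = 0, eg = id, vg = id, exg = {}\<rparr>"

definition gclass :: "graph \<Rightarrow> graph set" where
  "gclass G = {G'. wf_graph G' \<and> giso G G'}"

definition gclasses :: "nat \<Rightarrow> graph set set" where
  "gclasses N = gclass ` {G. wf_graph G \<and> hn G = 2 * N}"

definition gclasses_upto :: "nat \<Rightarrow> graph set set" where
  "gclasses_upto H = gclass ` {G. wf_graph G \<and> hn G \<le> H}"

definition rep :: "graph set \<Rightarrow> graph" where
  "rep C = (SOME G. G \<in> C)"

text \<open>An element of H-hat = prod_n H_n is its coefficient function on isomorphism classes,
represented as an isomorphism-invariant function on (well-formed) graphs.\<close>

definition Hhat :: "(graph \<Rightarrow> 'k::zero) set" where
  "Hhat = {a. (\<forall>G. \<not> wf_graph G \<longrightarrow> a G = 0) \<and>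
              (\<forall>G G'. wf_graph G \<longrightarrow> wf_graph G' \<longrightarrow> giso G G' \<longrightarrow> a G = a G')}"

text \<open>Completed tensor square H-hat (x) H-hat: coefficient functions on pairs of classes.\<close>

definition HH :: "(graph \<times> graph \<Rightarrow> 'k::zero) set" where
  "HH = {F. (\<forall>G1 G2. \<not> (wf_graph G1 \<and> wf_graph G2) \<longrightarrow> F (G1, G2) = 0) \<and>
            (\<forall>G1 G2 G1' G2'. wf_graph G1 \<longrightarrow> wf_graph G2 \<longrightarrow> wf_graph G1' \<longrightarrow> wf_graph G2' \<longrightarrow>
               giso G1 G1' \<longrightarrow> giso G2 G2' \<longrightarrow> F (G1, G2) = F (G1', G2'))}"

definition hunion :: "(graph \<Rightarrow> 'k::comm_ring_1) \<Rightarrow> (graph \<Rightarrow> 'k) \<Rightarrow> graph \<Rightarrow> 'k" where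
  "hunion a b G = (if wf_graph G then
     (\<Sum>C1\<in>gclasses_upto (hn G). \<Sum>C2\<in>gclasses_upto (hn G).
        if giso (gunion (rep C1) (rep C2)) G then a (rep C1) * b (rep C2) else 0)
     else 0)"

definition H_unit :: "graph \<Rightarrow> 'k::comm_ring_1" where
  "H_unit G = (if wf_graph G \<and> hn G = 0 then 1 else 0)"

definition H_counit :: "(graph \<Rightarrow> 'k::comm_ring_1) \<Rightarrow> 'k" where
  "H_counit a = a empty_graph"

text \<open>I : H-hat -> H^*, functionals on H represented by their values on (classes of) graphs.\<close>

definition Iop :: "(graph \<Rightarrow> 'k::comm_ring_1) \<Rightarrow> graph \<Rightarrow> 'k" where
  "Iop a G = of_nat (card (Aut G)) * a G"

definition IIop :: "(graph \<times> graph \<Rightarrow> 'k::comm_ring_1) \<Rightarrow> graph \<times> graph \<Rightarrow> 'k" where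
  "IIop F = (\<lambda>(G1, G2). of_nat (card (Aut G1)) * of_nat (card (Aut G2)) * F (G1, G2))"

definition union_dual :: "(graph \<Rightarrow> 'k) \<Rightarrow> graph \<times> graph \<Rightarrow> 'k" where
  "union_dual phi = (\<lambda>(G1, G2). phi (gunion G1 G2))"

definition Delta :: "(graph \<Rightarrow> 'k::comm_ring_1) \<Rightarrow> graph \<times> graph \<Rightarrow> 'k" where
  "Delta a = (THE F. F \<in> HH \<and>
     (\<forall>G1 G2. wf_graph G1 \<longrightarrow> wf_graph G2 \<longrightarrow> IIop F (G1, G2) = union_dual (Iop a) (G1, G2)))"

text \<open>A key (P, q) indexes the basis element y_{m_1}...y_{m_d} (x) x^q of
S(h_{>=1}[V]) (x) h[V], where P = {#m_1,...,m_d#} is a multiset of non-constant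
monomials and monomials in x_1^*,...,x_n^* are multisets of indices in {1..n}.
Elements of the completed space are arbitrary coefficient functions on keys.\<close>

type_synonym key = "nat multiset multiset \<times> nat multiset"

definition valid_key :: "nat \<Rightarrow> key \<Rightarrow> bool" where
  "valid_key n k \<longleftrightarrow> (\<forall>m\<in>#fst k. m \<noteq> {#} \<and> set_mset m \<subseteq> {1..n}) \<and> set_mset (snd k) \<subseteq> {1..n}"

definition amb :: "nat \<Rightarrow> (key \<Rightarrow> 'k::zero) set" where
  "amb n = {f. \<forall>k. \<not> valid_key n k \<longrightarrow> f k = 0}"

definition kdeg :: "key \<Rightarrow> nat" where
  "kdeg k = sum_mset (image_mset size (fst k)) + size (snd k)"

text \<open>Orthogonal group O(n) as matrices M (entries M i j, i,j in {1..n}) with M^T M = 1;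
M acts on V^* by x_i^* |-> sum_j M j i x_j^*.\<close>

definition orth :: "nat \<Rightarrow> (nat \<Rightarrow> nat \<Rightarrow> 'k::comm_ring_1) \<Rightarrow> bool" where
  "orth n M \<longleftrightarrow> (\<forall>i\<in>{1..n}. \<forall>j\<in>{1..n}. (\<Sum>l=1..n. M l i * M l j) = (if i = j then 1 else 0))"

text \<open>Coefficient of x^r in M . x^m = prod_{i in m} (sum_j M j i x_j).\<close>

definition substc :: "nat \<Rightarrow> (nat \<Rightarrow> nat \<Rightarrow> 'k::comm_ring_1) \<Rightarrow> nat multiset \<Rightarrow> nat multiset \<Rightarrow> 'k" where
  "substc n M m r = (\<Sum>s\<in>{s \<in> {0..<size m} \<rightarrow>\<^sub>E {1..n}. mset (map s [0..<size m]) = r}.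
       \<Prod>k<size m. M (s k) (sorted_list_of_multiset m ! k))"

definition monoms :: "nat \<Rightarrow> nat \<Rightarrow> nat multiset set" where
  "monoms n d = {r. set_mset r \<subseteq> {1..n} \<and> size r = d}"

definition lst :: "'a multiset \<Rightarrow> 'a list" where
  "lst P = (SOME xs. mset xs = P)"

text \<open>Coefficient of the basis element k' in M . (basis element k).\<close>

definition keycoef :: "nat \<Rightarrow> (nat \<Rightarrow> nat \<Rightarrow> 'k::comm_ring_1) \<Rightarrow> key \<Rightarrow> key \<Rightarrow> 'k" where
  "keycoef n M k k' = substc n M (snd k) (snd k') *
     (\<Sum>rho\<in>{rho \<in> Pi\<^sub>E {0..<size (fst k)} (\<lambda>i. monoms n (size (lst (fst k) ! i))).
              mset (map rho [0..<size (fst k)]) = fst k'}.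
        \<Prod>i<size (fst k). substc n M (lst (fst k) ! i) (rho i))"

definition samedeg :: "nat \<Rightarrow> key \<Rightarrow> key set" where
  "samedeg n k' = {k. valid_key n k \<and> image_mset size (fst k) = image_mset size (fst k')
                       \<and> size (snd k) = size (snd k')}"

definition act :: "nat \<Rightarrow> (nat \<Rightarrow> nat \<Rightarrow> 'k::comm_ring_1) \<Rightarrow> (key \<Rightarrow> 'k) \<Rightarrow> key \<Rightarrow> 'k" where
  "act n M f k' = (\<Sum>k\<in>samedeg n k'. f k * keycoef n M k k')"

definition lsp :: "nat \<Rightarrow> (key \<Rightarrow> 'k::comm_ring_1) set" where
  "lsp n = {f \<in> amb n. \<forall>M. orth n M \<longrightarrow> act n M f = f}"

text \<open>Restriction l^{n+1} -> l^n (x_{n+1}^* |-> 0).\<close>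

definition restr :: "nat \<Rightarrow> (key \<Rightarrow> 'k::zero) \<Rightarrow> key \<Rightarrow> 'k" where
  "restr n f k = (if valid_key n k then f k else 0)"

text \<open>l^infinity = inverse limit: compatible families (f_n)_{n>=1}; the unused index 0
is normalised to 0.\<close>

definition linf :: "(nat \<Rightarrow> key \<Rightarrow> 'k::comm_ring_1) set" where
  "linf = {F. F 0 = (\<lambda>k. 0) \<and> (\<forall>n\<ge>1. F n \<in> lsp n \<and> restr n (F (Suc n)) = F n)}"

definition mult_amb :: "(key \<Rightarrow> 'k::comm_ring_1) \<Rightarrow> (key \<Rightarrow> 'k) \<Rightarrow> key \<Rightarrow> 'k" where
  "mult_amb f g k = (\<Sum>P1\<in>{P1. P1 \<subseteq># fst k}. \<Sum>q1\<in>{q1. q1 \<subseteq># snd k}.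
      f (P1, q1) * g (fst k - P1, snd k - q1))"

definition mu :: "(nat \<Rightarrow> key \<Rightarrow> 'k::comm_ring_1) \<Rightarrow> (nat \<Rightarrow> key \<Rightarrow> 'k) \<Rightarrow> nat \<Rightarrow> key \<Rightarrow> 'k" where
  "mu F G n = mult_amb (F n) (G n)"

definition l_unit :: "nat \<Rightarrow> key \<Rightarrow> 'k::comm_ring_1" where
  "l_unit n k = (if n \<ge> 1 \<and> k = ({#}, {#}) then 1 else 0)"

definition l_counit :: "(nat \<Rightarrow> key \<Rightarrow> 'k::comm_ring_1) \<Rightarrow> 'k" where
  "l_counit F = F 1 ({#}, {#})"

definition mbinom :: "'a multiset \<Rightarrow> 'a multiset \<Rightarrow> nat" where
  "mbinom A B = (\<Prod>x\<in>set_mset (A + B). count (A + B) x choose count A x)"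

definition delta_amb :: "(key \<Rightarrow> 'k::comm_ring_1) \<Rightarrow> key \<times> key \<Rightarrow> 'k" where
  "delta_amb f = (\<lambda>(k1, k2). f (fst k1 + fst k2, snd k1 + snd k2) *
      of_nat (mbinom (fst k1) (fst k2)) * of_nat (mbinom (snd k1) (snd k2)))"

definition shiftk :: "nat \<Rightarrow> key \<Rightarrow> key" where
  "shiftk m k = (image_mset (image_mset (\<lambda>i. i + m)) (fst k), image_mset (\<lambda>i. i + m) (snd k))"

text \<open>Elements of l^infinity (x)-hat l^infinity = lim_{m,n} l^m (x)-hat l^n: families indexed
by (m,n) of coefficient functions on pairs of keys. (pi_m (x) pi_n) o delta on level m+n.\<close>

definition delta :: "(nat \<Rightarrow> key \<Rightarrow> 'k::comm_ring_1) \<Rightarrow> nat \<times> nat \<Rightarrow> key \<times> key \<Rightarrow> 'k" where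
  "delta F = (\<lambda>(m, n) (k1, k2).
     if m \<ge> 1 \<and> n \<ge> 1 \<and> valid_key m k1 \<and> valid_key n k2
     then delta_amb (F (m + n)) (k1, shiftk m k2) else 0)"

definition labelings :: "nat \<Rightarrow> graph \<Rightarrow> (nat \<Rightarrow> nat) set" where
  "labelings n G = {l \<in> {0..<hn G} \<rightarrow>\<^sub>E {1..n}. \<forall>x<hn G. l (eg G x) = l x}"

definition gkey :: "graph \<Rightarrow> (nat \<Rightarrow> nat) \<Rightarrow> key" where
  "gkey G l =
    (image_mset (\<lambda>w. image_mset l (mset_set {x \<in> {0..<hn G}. vg G x = w}))
        (mset_set (vg G ` ({0..<hn G} - exg G))),
     image_mset l (mset_set (exg G)))"

definition Phin :: "nat \<Rightarrow> graph \<Rightarrow> key \<Rightarrow> 'k::comm_ring_1" where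
  "Phin n G k = of_nat (card {l \<in> labelings n G. gkey G l = k})"

definition Phi :: "(graph \<Rightarrow> 'k::comm_ring_1) \<Rightarrow> nat \<Rightarrow> key \<Rightarrow> 'k" where
  "Phi a n k = (if n \<ge> 1 then (\<Sum>C\<in>gclasses (kdeg k div 2). a (rep C) * Phin n (rep C) k) else 0)"

definition PhiPhi :: "(graph \<times> graph \<Rightarrow> 'k::comm_ring_1) \<Rightarrow> nat \<times> nat \<Rightarrow> key \<times> key \<Rightarrow> 'k" where
  "PhiPhi F = (\<lambda>(m, n) (k1, k2).
     if m \<ge> 1 \<and> n \<ge> 1 then
       (\<Sum>C1\<in>gclasses (kdeg k1 div 2). \<Sum>C2\<in>gclasses (kdeg k2 div 2).
          F (rep C1, rep C2) * Phin m (rep C1) k1 * Phin n (rep C2) k2)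
     else 0)"

end

theory Submission
  imports Defs "HOL-Computational_Algebra.Polynomial" "Jordan_Normal_Form.Determinant"
begin

text \<open>The key of a labelled half-edge structure \<open>(S, t)\<close> (a graph without its edges) satisfies the Wick formula
\<open>|Stab(S, t)| \<cdot> \<Phi>(a)(key) = \<Sum>\<^sub>e |Aut(S, e)| \<cdot> a(S, e)\<close>, where \<open>e\<close> runs over the label-preserving pairings
of the half-edges: both sides count structure isomorphisms from \<open>S\<close> to graphs.
If every label occurs exactly twice, there is exactly one such pairing, so \<open>a\<close> can be read off from the values of
\<open>\<Phi>(a)\<close> at these keys. Conversely an element of \<open>l\<^sup>\<infinity>\<close> is determined by its values at these keys:
invariance under rotations in the plane of a label \<open>i\<close> and an unused label \<open>j\<close>, to second order, expresses
the value at a key through values at keys with more labels, until every label occurs exactly twice (or the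
value vanishes). Together these give bijectivity. For two structures with disjoint labels both the stabilizer and the set
of pairings factor, which is the compatibility with the coproducts.\<close>

subsection \<open>Half-edge structures and keys\<close>

text \<open>In a multiset of multisets equal factors cannot be told apart, so the symmetries of a
  key are invisible. Numbered half-edges turn the factorials of repeated indices and repeated
  factors into the order of a permutation group, and turn labelings, pairings and matrix
  coefficients into functions on one finite set. The Wick formula carries the stabilizer as a
  factor; characteristic zero serves to cancel |Stab|, |Aut|, the multiplicity of a label and 2, and
  to provide infinitely many rational rotations.

  No classification of orthogonal invariants is assumed. Both are available at a higher level, and
  this is where the inverse limit is used. Over an arbitrary field infinitesimal rotations are
  replaced by infinitely many rational points of the circle: the invariance becomes a polynomial
  identity, and its quadratic coefficient does the work of a second derivative.\<close>

lemma image_mset_eq_imp_bij: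
  assumes "finite A" "finite B" "image_mset f (mset_set A) = image_mset g (mset_set B)"
  shows "\<exists>s. bij_betw s A B \<and> (\<forall>x\<in>A. g (s x) = f x)"
  using assms
proof (induction A arbitrary: B rule: finite_induct)
  case empty
  then show ?case by (auto simp: mset_set_empty_iff bij_betw_def)
next
  case (insert a A)
  have "f a \<in># image_mset g (mset_set B)"
    using insert.prems(2)[symmetric] insert.hyps by simp
  then obtain b where b: "b \<in> B" "g b = f a" using insert.prems(1) by auto
  have "mset_set B = add_mset b (mset_set (B - {b}))"
    using b insert.prems(1) by (simp add: mset_set.remove)
  then have "image_mset f (mset_set A) = image_mset g (mset_set (B - {b}))"
    using insert.prems(2) insert.hyps b by simp
  then obtain s where s: "bij_betw s A (B - {b})" "\<forall>x\<in>A. g (s x) = f x"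
    using insert.IH[of "B - {b}"] insert.prems(1) by auto
  have "bij_betw (s(a := b)) A (B - {b})"
    using s(1) insert.hyps(2) by (subst bij_betw_cong[of A _ s]) auto
  then have "bij_betw (s(a := b)) (A \<union> {a}) ((B - {b}) \<union> {b})"
    by (intro bij_betw_combine) auto
  then have "bij_betw (s(a := b)) (insert a A) B"
    using b by (simp add: insert_absorb)
  moreover have "\<forall>x\<in>insert a A. g ((s(a := b)) x) = f x" using s(2) b insert.hyps by auto
  ultimately show ?case by blast
qed

definition kmap :: "(nat \<Rightarrow> nat) \<Rightarrow> key \<Rightarrow> key" where
  "kmap f k = (image_mset (image_mset f) (fst k), image_mset f (snd k))"

text \<open>The monomial obtained by multiplying all factors together. It forgets the vertices and
  keeps how often each index occurs, which is all that the rotation argument counts.\<close>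

definition kflat :: "key \<Rightarrow> nat multiset" where
  "kflat k = \<Sum>\<^sub># (fst k) + snd k"

definition kadd :: "key \<Rightarrow> key \<Rightarrow> key" where
  "kadd k k' = (fst k + fst k', snd k + snd k')"

definition halves :: "graph \<Rightarrow> nat set" where
  "halves G = {0..<hn G}"

definition verts :: "graph \<Rightarrow> nat set" where
  "verts G = vg G ` (halves G - exg G)"

definition fib :: "graph \<Rightarrow> nat \<Rightarrow> nat set" where
  "fib G w = {x \<in> halves G. vg G x = w}"

text \<open>\<open>swf\<close> and \<open>siso\<close> are \<open>wf_graph\<close> and \<open>iso_by\<close> without the conditions on \<open>eg\<close>.\<close>

definition swf :: "graph \<Rightarrow> bool" where
  "swf G \<longleftrightarrow> exg G \<subseteq> halves G \<and> (\<forall>x\<in>exg G. \<forall>y\<in>halves G. vg G y = vg G x \<longrightarrow> y = x)"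

definition siso :: "graph \<Rightarrow> graph \<Rightarrow> (nat \<Rightarrow> nat) \<Rightarrow> bool" where
  "siso G G' s \<longleftrightarrow> bij_betw s (halves G) (halves G') \<and>
     (\<forall>x\<in>halves G. \<forall>y\<in>halves G. vg G x = vg G y \<longleftrightarrow> vg G' (s x) = vg G' (s y)) \<and>
     s ` exg G = exg G'"

definition pairing :: "graph \<Rightarrow> (nat \<Rightarrow> nat) \<Rightarrow> bool" where
  "pairing G e \<longleftrightarrow> (\<forall>x\<in>halves G. e x \<in> halves G \<and> e (e x) = x \<and> e x \<noteq> x)"

lemma finite_halves [simp]: "finite (halves G)"
  by (simp add: halves_def)

lemma card_halves [simp]: "card (halves G) = hn G"
  by (simp add: halves_def)

lemma finite_fib [simp]: "finite (fib G w)"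
  by (simp add: fib_def)

lemma finite_verts [simp]: "finite (verts G)"
  by (simp add: verts_def)

lemma finite_exg [simp]: "swf G \<Longrightarrow> finite (exg G)"
  unfolding swf_def using finite_subset[OF _ finite_halves] by blast

lemma exg_halves: "swf G \<Longrightarrow> x \<in> exg G \<Longrightarrow> x \<in> halves G"
  by (auto simp: swf_def)

lemma wf_graph_iff: "wf_graph G \<longleftrightarrow> swf G \<and> pairing G (eg G)"
  by (auto simp: wf_graph_def swf_def pairing_def halves_def)

lemma siso_hn: "siso G G' s \<Longrightarrow> hn G = hn G'"
  unfolding siso_def using bij_betw_same_card[of s "halves G" "halves G'"] by auto

lemma iso_by_iff: "iso_by G G' s \<longleftrightarrow> siso G G' s \<and> (\<forall>x\<in>halves G. s (eg G x) = eg G' (s x))"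
  using siso_hn[of G G' s] by (auto simp: iso_by_def siso_def halves_def)

lemma gkey_alt:
  "gkey G l = (image_mset (\<lambda>w. image_mset l (mset_set (fib G w))) (mset_set (verts G)),
     image_mset l (mset_set (exg G)))"
  by (simp add: gkey_def fib_def verts_def halves_def)

lemma fib_verts_disj: "swf G \<Longrightarrow> w \<in> verts G \<Longrightarrow> x \<in> fib G w \<Longrightarrow> x \<notin> exg G"
  unfolding fib_def verts_def swf_def by force

lemma fib_nonempty: "w \<in> verts G \<Longrightarrow> fib G w \<noteq> {}"
  unfolding fib_def verts_def by force

lemma halves_decomp: "swf G \<Longrightarrow> halves G = (\<Union>w\<in>verts G. fib G w) \<union> exg G"
  unfolding fib_def verts_def swf_def by blast

lemma siso_id: "siso G G (\<lambda>x. x)"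
  by (auto simp: siso_def bij_betw_def)

lemma siso_comp:
  assumes "siso G G' s" "siso G' G'' s'"
  shows "siso G G'' (\<lambda>x. s' (s x))"
proof -
  have "bij_betw (\<lambda>x. s' (s x)) (halves G) (halves G'')"
    using bij_betw_trans[of s _ _ s'] assms by (auto simp: siso_def o_def)
  moreover have "s x \<in> halves G'" if "x \<in> halves G" for x
    using assms(1) that by (auto simp: siso_def bij_betw_def)
  ultimately show ?thesis using assms by (auto simp: siso_def image_image[symmetric])
qed

lemma siso_mem: "siso G G' s \<Longrightarrow> x \<in> halves G \<Longrightarrow> s x \<in> halves G'"
  by (auto simp: siso_def bij_betw_def)

lemma siso_inv:
  assumes "siso G G' s" "swf G"
  shows "siso G' G (inv_into (halves G) s)"
proof -
  let ?i = "inv_into (halves G) s"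
  have b: "bij_betw s (halves G) (halves G')" using assms by (simp add: siso_def)
  have r: "s (?i y) = y" "?i y \<in> halves G" if "y \<in> halves G'" for y
    using b that by (auto simp: bij_betw_def f_inv_into_f inv_into_into)
  have "?i ` exg G' = exg G"
  proof -
    have "?i ` s ` exg G = exg G"
      using b assms(2) by (auto simp: bij_betw_def swf_def image_inv_into_cancel image_image
          inv_into_f_f intro!: image_eqI)
    then show ?thesis using assms(1) by (simp add: siso_def)
  qed
  then show ?thesis using assms(1) r bij_betw_inv_into[OF b] by (auto simp: siso_def)
qed

lemma siso_cong:
  assumes "siso G G' s" "\<And>x. x \<in> halves G \<Longrightarrow> s x = s' x" "swf G"
  shows "siso G G' s'"
proof -
  have "bij_betw s' (halves G) (halves G')" using assms(1,2) bij_betw_cong[of "halves G" s s']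
    by (simp add: siso_def)
  moreover have "s' ` exg G = s ` exg G" using assms(2,3) by (intro image_cong) (auto simp: swf_def)
  ultimately show ?thesis using assms(1,2) unfolding siso_def by auto
qed

lemma image_mset_mset_set_cong:
  "finite A \<Longrightarrow> (\<And>x. x \<in> A \<Longrightarrow> f x = g x) \<Longrightarrow> image_mset f (mset_set A) = image_mset g (mset_set A)"
  by (rule image_mset_cong) simp

lemma gkey_cong:
  assumes "swf G" "\<And>x. x \<in> halves G \<Longrightarrow> l x = l' x"
  shows "gkey G l = gkey G l'"
proof -
  have "image_mset l (mset_set A) = image_mset l' (mset_set A)" if "A \<subseteq> halves G" for A
    using assms(2) that finite_subset[OF that] by (intro image_mset_mset_set_cong) auto
  moreover have "fib G w \<subseteq> halves G" for w by (auto simp: fib_def)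
  ultimately show ?thesis using assms(1) by (simp add: gkey_alt swf_def)
qed

lemma siso_imp_gkey_eq:
  assumes s: "siso G G' s" and l: "\<And>x. x \<in> halves G \<Longrightarrow> l' (s x) = l x" and "swf G"
  shows "gkey G l = gkey G' l'"
proof -
  have b: "bij_betw s (halves G) (halves G')" and inj: "inj_on s (halves G)"
    and im: "s ` halves G = halves G'"
    and v: "\<And>x y. x \<in> halves G \<Longrightarrow> y \<in> halves G \<Longrightarrow> vg G x = vg G y \<longleftrightarrow> vg G' (s x) = vg G' (s y)"
    and e: "s ` exg G = exg G'"
    using s by (auto simp: siso_def bij_betw_def)
  have sub: "exg G \<subseteq> halves G" using assms(3) by (simp add: swf_def)
  \<comment> \<open>\<open>siso\<close> speaks of half-edges, not of vertex names, so the induced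
    map of names is read off from an arbitrary half-edge at the vertex.\<close>
  define bt where "bt w = vg G' (s (SOME x. x \<in> fib G w))" for w
  have btv: "bt (vg G x) = vg G' (s x)" if "x \<in> halves G" for x
  proof -
    have "x \<in> fib G (vg G x)" using that by (simp add: fib_def)
    then have "(SOME y. y \<in> fib G (vg G x)) \<in> fib G (vg G x)" by (rule someI)
    then show ?thesis using that v unfolding bt_def fib_def by auto
  qed
  have V': "verts G' = bt ` verts G"
  proof -
    have "halves G' - exg G' = s ` (halves G - exg G)"
      using im e inj sub by (metis inj_on_image_set_diff Diff_subset)
    then show ?thesis using btv by (auto simp: verts_def image_image)
  qed
  have "inj_on bt (verts G)"
    using btv v by (auto simp: inj_on_def verts_def)
  then have "mset_set (verts G') = image_mset bt (mset_set (verts G))"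
    by (simp add: V' image_mset_mset_set)
  moreover have "image_mset l' (mset_set (fib G' (bt w))) = image_mset l (mset_set (fib G w))"
    if w: "w \<in> verts G" for w
  proof -
    obtain x where x: "x \<in> halves G" "w = vg G x" using w by (auto simp: verts_def)
    have "fib G' (bt w) = s ` fib G w"
      using x btv v by (auto simp: fib_def im[symmetric])
    moreover have "inj_on s (fib G w)" using inj by (rule inj_on_subset) (auto simp: fib_def)
    ultimately have "mset_set (fib G' (bt w)) = image_mset s (mset_set (fib G w))"
      by (simp add: image_mset_mset_set)
    moreover have "image_mset (l' \<circ> s) (mset_set (fib G w)) = image_mset l (mset_set (fib G w))"
      using l by (intro image_mset_mset_set_cong) (auto simp: fib_def)
    ultimately show ?thesis by (simp add: multiset.map_comp)
  qed
  moreover have "image_mset l' (mset_set (exg G')) = image_mset l (mset_set (exg G))"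
  proof -
    have "inj_on s (exg G)" using inj sub by (rule inj_on_subset)
    then have "mset_set (exg G') = image_mset s (mset_set (exg G))"
      by (simp add: e[symmetric] image_mset_mset_set)
    moreover have "image_mset (l' \<circ> s) (mset_set (exg G)) = image_mset l (mset_set (exg G))"
      using l sub assms(3) by (intro image_mset_mset_set_cong) auto
    ultimately show ?thesis by (simp add: multiset.map_comp)
  qed
  ultimately show ?thesis
    by (auto simp: gkey_alt multiset.map_comp o_def intro!: image_mset_mset_set_cong)
qed

text \<open>Equality of multisets is lifted to bijections three times: between vertices carrying the
  same monomial, inside each matched pair of vertices, and between the external half-edges. Patching
  these gives the isomorphism. With \<open>siso_imp_gkey_eq\<close>, labelled structures have the
  same key exactly when they are isomorphic.\<close>

lemma gkey_eq_imp_siso: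
  assumes "swf G" "swf G'" "gkey G l = gkey G' l'"
  shows "\<exists>s. siso G G' s \<and> (\<forall>x\<in>halves G. l' (s x) = l x)"
proof -
  have "image_mset (\<lambda>w. image_mset l (mset_set (fib G w))) (mset_set (verts G)) =
     image_mset (\<lambda>w. image_mset l' (mset_set (fib G' w))) (mset_set (verts G'))"
    using assms(3) by (simp add: gkey_alt)
  from image_mset_eq_imp_bij[OF _ _ this] obtain bt where bt: "bij_betw bt (verts G) (verts G')"
    and btl: "\<And>w. w \<in> verts G \<Longrightarrow>
      image_mset l (mset_set (fib G w)) = image_mset l' (mset_set (fib G' (bt w)))"
    by auto
  have "\<forall>w\<in>verts G. \<exists>s. bij_betw s (fib G w) (fib G' (bt w)) \<and> (\<forall>x\<in>fib G w. l' (s x) = l x)"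
    using image_mset_eq_imp_bij[OF _ _ btl] by auto
  then obtain sg where sg: "\<And>w. w \<in> verts G \<Longrightarrow> bij_betw (sg w) (fib G w) (fib G' (bt w))"
    and sgl: "\<And>w x. w \<in> verts G \<Longrightarrow> x \<in> fib G w \<Longrightarrow> l' (sg w x) = l x"
    by metis
  have "image_mset l (mset_set (exg G)) = image_mset l' (mset_set (exg G'))"
    using assms(3) by (simp add: gkey_alt)
  from image_mset_eq_imp_bij[OF _ _ this] assms obtain se where
    se: "bij_betw se (exg G) (exg G')" and sel: "\<And>x. x \<in> exg G \<Longrightarrow> l' (se x) = l x"
    by auto
  define s where "s x = (if x \<in> exg G then se x else sg (vg G x) x)" for x
  have cases: "x \<in> exg G \<or> (x \<notin> exg G \<and> vg G x \<in> verts G \<and> x \<in> fib G (vg G x))"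
    if "x \<in> halves G" for x
    using that by (auto simp: verts_def fib_def)
  have se_in: "s x \<in> exg G'" if "x \<in> exg G" for x
    using that se by (auto simp: s_def bij_betw_def)
  have sv_in: "s x \<in> fib G' (bt (vg G x))" "bt (vg G x) \<in> verts G'"
    if "x \<in> halves G" "x \<notin> exg G" for x
    using that sg[of "vg G x"] cases[of x] bt by (auto simp: s_def bij_betw_def)
  have sv: "s x \<in> halves G'" "vg G' (s x) = bt (vg G x)" "s x \<notin> exg G'"
    if "x \<in> halves G" "x \<notin> exg G" for x
    using sv_in[OF that] fib_verts_disj[OF assms(2)] by (auto simp: fib_def)
  have mem: "s x \<in> halves G'" if "x \<in> halves G" for x
    using that se_in sv assms(2) by (cases "x \<in> exg G") (auto simp: exg_halves)
  have inj: "x = y" if "x \<in> halves G" "y \<in> halves G" "s x = s y" for x y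
  proof (cases "x \<in> exg G")
    case True
    then have "y \<in> exg G" using that se_in sv(3) by metis
    then show ?thesis using True that(3) se by (auto simp: s_def bij_betw_def inj_on_def)
  next
    case False
    then have y: "y \<notin> exg G" using that se_in sv(3) by metis
    have "bt (vg G x) = bt (vg G y)" using sv(2) that False y by metis
    then have e: "vg G x = vg G y"
      using bt cases[OF that(1)] cases[OF that(2)] False y by (auto simp: bij_betw_def inj_on_def)
    have "inj_on (sg (vg G x)) (fib G (vg G x))" "x \<in> fib G (vg G x)" "y \<in> fib G (vg G x)"
      using sg[of "vg G x"] cases[OF that(1)] cases[OF that(2)] that False y e
      by (auto simp: bij_betw_def fib_def)
    then show ?thesis using that(3) False y e by (auto simp: s_def inj_on_def)
  qed
  have surj: "\<exists>x\<in>halves G. s x = y" if "y \<in> halves G'" for y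
  proof (cases "y \<in> exg G'")
    case True
    then obtain x where "x \<in> exg G" "se x = y" 
      using bij_betw_imp_surj_on[OF se] by (metis imageE)
    then show ?thesis using assms(1) by (auto simp: s_def exg_halves)
  next
    case False
    then have "vg G' y \<in> verts G'" "y \<in> fib G' (vg G' y)" using that
      by (auto simp: verts_def fib_def)
    then obtain w where w: "w \<in> verts G" "bt w = vg G' y" 
      using bij_betw_imp_surj_on[OF bt] by (metis imageE)
    then obtain x where x: "x \<in> fib G w" "sg w x = y"
      using bij_betw_imp_surj_on[OF sg[OF w(1)]] \<open>y \<in> fib G' (vg G' y)\<close> by (metis imageE)
    then have "x \<notin> exg G" "vg G x = w" "x \<in> halves G"
      using fib_verts_disj[OF assms(1) w(1)] by (auto simp: fib_def)
    then show ?thesis using x by (auto simp: s_def)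
  qed
  have "bij_betw s (halves G) (halves G')"
    using inj mem surj unfolding bij_betw_def inj_on_def by blast
  moreover have "vg G x = vg G y \<longleftrightarrow> vg G' (s x) = vg G' (s y)"
    if xy: "x \<in> halves G" "y \<in> halves G" for x y
  proof (cases "x \<in> exg G \<or> y \<in> exg G")
    case True
    then have "(vg G x = vg G y) = (x = y)" using xy assms(1) unfolding swf_def by metis
    moreover have "(vg G' (s x) = vg G' (s y)) = (s x = s y)"
      using True se_in mem[OF xy(1)] mem[OF xy(2)] assms(2) unfolding swf_def by metis
    ultimately show ?thesis using inj xy by auto
  next
    case False
    then show ?thesis using sv xy cases[OF xy(1)] cases[OF xy(2)] bt
      by (auto simp: bij_betw_def inj_on_def)
  qed
  moreover have "s ` exg G = exg G'"
  proof -
    have "s ` exg G = se ` exg G" by (intro image_cong) (auto simp: s_def)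
    then show ?thesis using se by (simp add: bij_betw_def)
  qed
  moreover have "\<forall>x\<in>halves G. l' (s x) = l x"
    using cases sel sgl by (fastforce simp: s_def)
  ultimately show ?thesis unfolding siso_def by blast
qed

section \<open>Degrees and admissible indices of keys\<close>

lemma size_sum_mset: "size (\<Sum>\<^sub># (P :: 'a multiset multiset)) = sum_mset (image_mset size P)"
  by (induction P) auto

lemma kdeg_kflat: "kdeg k = size (kflat k)"
  by (simp add: kdeg_def kflat_def size_sum_mset)

lemma valid_key_iff:
  "valid_key n k \<longleftrightarrow> {#} \<notin># fst k \<and> set_mset (kflat k) \<subseteq> {1..n}"
  by (fastforce simp: valid_key_def kflat_def set_mset_Union_mset)

lemma sum_mset_image_mset_set_disjoint:
  assumes "finite W" "\<And>w. w \<in> W \<Longrightarrow> finite (B w)"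
    "\<And>w w'. w \<in> W \<Longrightarrow> w' \<in> W \<Longrightarrow> w \<noteq> w' \<Longrightarrow> B w \<inter> B w' = {}"
  shows "\<Sum>\<^sub># (image_mset (\<lambda>w. image_mset l (mset_set (B w))) (mset_set W))
    = image_mset l (mset_set (\<Union>w\<in>W. B w))"
  using assms
proof (induction W rule: finite_induct)
  case (insert w W)
  have "mset_set (B w \<union> (\<Union>w\<in>W. B w)) = mset_set (B w) + mset_set (\<Union>w\<in>W. B w)"
    using insert by (intro mset_set_Union) auto
  then show ?case using insert by simp
qed simp

lemma kflat_gkey:
  assumes "swf G" shows "kflat (gkey G l) = image_mset l (mset_set (halves G))"
proof -
  have "\<Sum>\<^sub># (fst (gkey G l)) = image_mset l (mset_set (\<Union>w\<in>verts G. fib G w))"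
    unfolding gkey_alt fst_conv
    by (rule sum_mset_image_mset_set_disjoint) (auto simp: fib_def)
  moreover have "mset_set ((\<Union>w\<in>verts G. fib G w) \<union> exg G)
      = mset_set (\<Union>w\<in>verts G. fib G w) + mset_set (exg G)"
    using assms fib_verts_disj[OF assms] by (intro mset_set_Union) auto
  ultimately show ?thesis
    using halves_decomp[OF assms] by (simp add: kflat_def gkey_alt)
qed

lemma kdeg_gkey: "swf G \<Longrightarrow> kdeg (gkey G l) = hn G"
  by (simp add: kdeg_kflat kflat_gkey)

lemma kmap_gkey: "kmap f (gkey G l) = gkey G (\<lambda>x. f (l x))"
  by (simp add: kmap_def gkey_alt multiset.map_comp o_def)

lemma empty_notin_gkey: "{#} \<notin># fst (gkey G l)"
  using fib_nonempty by (fastforce simp: gkey_alt mset_set_empty_iff)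

lemma valid_key_gkey: "swf G \<Longrightarrow> valid_key n (gkey G l) \<longleftrightarrow> (\<forall>x\<in>halves G. l x \<in> {1..n})"
  by (auto simp: valid_key_iff kflat_gkey empty_notin_gkey)

lemma swf_eg_update [simp]: "swf (G\<lparr>eg := e\<rparr>) = swf G"
  by (simp add: swf_def halves_def)

lemma halves_eg_update [simp]: "halves (G\<lparr>eg := e\<rparr>) = halves G"
  by (simp add: halves_def)

lemma gkey_eg_update [simp]: "gkey (G\<lparr>eg := e\<rparr>) l = gkey G l"
  by (simp add: gkey_def)

lemma siso_eg_update [simp]:
  "siso (G\<lparr>eg := e\<rparr>) G' s = siso G G' s" "siso G (G'\<lparr>eg := e\<rparr>) s = siso G G' s"
  by (auto simp: siso_def)

lemma pairing_eg_update [simp]: "pairing (G\<lparr>eg := e\<rparr>) e' = pairing G e'"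
  by (simp add: pairing_def)

section \<open>Disjoint unions of structures and realisation of keys\<close>

lemma halves_gunion:
  "halves (gunion G1 G2) = halves G1 \<union> (\<lambda>x. x + hn G1) ` halves G2"
proof -
  have "x \<in> (\<lambda>x. x + hn G1) ` halves G2" if "hn G1 \<le> x" "x < hn G1 + hn G2" for x
    using that by (intro image_eqI[of _ _ "x - hn G1"]) (auto simp: halves_def)
  then show ?thesis by (auto simp: gunion_def halves_def)
qed

lemma halves_lt: "x \<in> halves G \<longleftrightarrow> x < hn G"
  by (simp add: halves_def)

lemma hn_gunion [simp]: "hn (gunion G1 G2) = hn G1 + hn G2"
  by (simp add: gunion_def)

lemma exg_gunion: "exg (gunion G1 G2) = exg G1 \<union> (\<lambda>x. x + hn G1) ` exg G2"
  by (simp add: gunion_def)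

lemma vg_gunion:
  "x < hn G1 \<Longrightarrow> vg (gunion G1 G2) x = 2 * vg G1 x"
  "vg (gunion G1 G2) (x + hn G1) = 2 * vg G2 x + 1"
  by (auto simp: gunion_def)

lemma eg_gunion:
  "x < hn G1 \<Longrightarrow> eg (gunion G1 G2) x = eg G1 x"
  "eg (gunion G1 G2) (x + hn G1) = eg G2 x + hn G1"
  by (auto simp: gunion_def)

text \<open>\<open>gunion\<close> gives even names to the vertices of the first summand and odd
  names to those of the second; parity keeps them apart.\<close>

lemma double_neq_Suc_double [simp]: "2 * a \<noteq> Suc (2 * b)" "Suc (2 * b) \<noteq> 2 * a"
  by presburger+

lemma swf_gunion:
  assumes "swf G1" "swf G2" shows "swf (gunion G1 G2)"
proof -
  have sub: "exg G1 \<subseteq> halves G1" "exg G2 \<subseteq> halves G2" using assms by (auto simp: swf_def)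
  have 1: "y = x" if "x \<in> exg G1" "y \<in> halves (gunion G1 G2)"
    "vg (gunion G1 G2) y = vg (gunion G1 G2) x" for x y
  proof -
    have x: "x \<in> halves G1" using that sub by auto
    show ?thesis using that x assms(1)
      by (auto simp: halves_gunion vg_gunion halves_lt swf_def)
  qed
  have 2: "y = x + hn G1" if "x \<in> exg G2" "y \<in> halves (gunion G1 G2)"
    "vg (gunion G1 G2) y = vg (gunion G1 G2) (x + hn G1)" for x y
  proof -
    have x: "x \<in> halves G2" using that sub by auto
    show ?thesis using that x assms(2)
      by (auto simp: halves_gunion vg_gunion halves_lt swf_def)
  qed
  have "exg (gunion G1 G2) \<subseteq> halves (gunion G1 G2)"
    using sub by (auto simp: exg_gunion halves_gunion)
  then show ?thesis using 1 2 unfolding swf_def by (auto simp: exg_gunion)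
qed

lemma verts_gunion:
  assumes "swf G1" "swf G2"
  shows "verts (gunion G1 G2) = (\<lambda>w. 2 * w) ` verts G1 \<union> (\<lambda>w. 2 * w + 1) ` verts G2"
proof -
  have "halves (gunion G1 G2) - exg (gunion G1 G2) =
      (halves G1 - exg G1) \<union> (\<lambda>x. x + hn G1) ` (halves G2 - exg G2)"
    using exg_halves[OF assms(1)] exg_halves[OF assms(2)]
    by (auto simp: halves_gunion exg_gunion halves_lt dest: exg_halves)
  then have "verts (gunion G1 G2) = vg (gunion G1 G2) ` (halves G1 - exg G1) \<union>
     vg (gunion G1 G2) ` (\<lambda>x. x + hn G1) ` (halves G2 - exg G2)"
    by (simp add: verts_def image_Un)
  moreover have "vg (gunion G1 G2) ` (halves G1 - exg G1) = (\<lambda>x. 2 * vg G1 x) ` (halves G1 - exg G1)"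
    by (intro image_cong) (auto simp: vg_gunion halves_lt)
  ultimately show ?thesis by (simp add: verts_def image_image vg_gunion)
qed

lemma fib_gunion:
  "fib (gunion G1 G2) (2 * w) = fib G1 w"
  "fib (gunion G1 G2) (2 * w + 1) = (\<lambda>x. x + hn G1) ` fib G2 w"
  by (auto simp: fib_def halves_gunion vg_gunion halves_lt)

lemma gkey_gunion:
  assumes "swf G1" "swf G2"
  shows "gkey (gunion G1 G2) l = kadd (gkey G1 l) (gkey G2 (\<lambda>x. l (x + hn G1)))"
proof -
  have "mset_set (verts (gunion G1 G2)) =
    mset_set ((\<lambda>w. 2 * w) ` verts G1) + mset_set ((\<lambda>w. 2 * w + 1) ` verts G2)"
    unfolding verts_gunion[OF assms] by (intro mset_set_Union) auto
  also have "\<dots> = image_mset (\<lambda>w. 2 * w) (mset_set (verts G1)) +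
     image_mset (\<lambda>w. 2 * w + 1) (mset_set (verts G2))"
    by (subst (1 2) image_mset_mset_set) (auto simp: inj_on_def)
  finally have 1: "mset_set (verts (gunion G1 G2)) = \<dots>" .
  have "mset_set (exg (gunion G1 G2)) =
    mset_set (exg G1) + mset_set ((\<lambda>x. x + hn G1) ` exg G2)"
    unfolding exg_gunion using assms exg_halves[OF assms(1)]
    by (intro mset_set_Union) (auto simp: halves_lt)
  also have "mset_set ((\<lambda>x. x + hn G1) ` exg G2) = image_mset (\<lambda>x. x + hn G1) (mset_set (exg G2))"
    by (subst image_mset_mset_set) (auto simp: inj_on_def)
  finally have 2: "mset_set (exg (gunion G1 G2)) =
    mset_set (exg G1) + image_mset (\<lambda>x. x + hn G1) (mset_set (exg G2))" .
  have 3: "mset_set ((\<lambda>x. x + hn G1) ` fib G2 w) = image_mset (\<lambda>x. x + hn G1) (mset_set (fib G2 w))"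
    for w by (subst image_mset_mset_set) (auto simp: inj_on_def)
  show ?thesis
    unfolding gkey_alt kadd_def 1 2
    using fib_gunion(2)[of G1 G2] by (simp add: multiset.map_comp o_def fib_gunion 3)
qed

text \<open>The argument is shifted back on the second part but the value is not, so the same
  operation glues labels and, with a shift added to \<open>t\<close>, maps of half-edges.\<close>

definition glue :: "nat \<Rightarrow> (nat \<Rightarrow> nat) \<Rightarrow> (nat \<Rightarrow> nat) \<Rightarrow> nat \<Rightarrow> nat" where
  "glue h s t x = (if x < h then s x else t (x - h))"

lemma glue_simps [simp]: "x < h \<Longrightarrow> glue h s t x = s x" "glue h s t (x + h) = t x"
  by (auto simp: glue_def)

lemma gkey_gunion_glue:
  assumes "swf G1" "swf G2"
  shows "gkey (gunion G1 G2) (glue (hn G1) s t) = kadd (gkey G1 s) (gkey G2 t)"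
  using gkey_cong[OF assms(1), of "glue (hn G1) s t" s]
  by (simp add: gkey_gunion[OF assms] halves_lt)

lemma swf_empty_graph: "swf empty_graph"
  by (simp add: swf_def empty_graph_def)

lemma gkey_empty_graph: "gkey empty_graph l = ({#}, {#})"
  by (simp add: gkey_def empty_graph_def)

lemma image_mset_nth: "image_mset ((!) xs) (mset_set {0..<length xs}) = mset xs"
  by (metis map_nth mset_map mset_upt)

text \<open>Single internal vertices and single external half-edges generate all these keys under
  \<open>kadd\<close>, and disjoint union realises \<open>kadd\<close>. The factor
  \<open>{#}\<close> is excluded because a vertex has at least one half-edge.\<close>

lemma gkey_realize:
  assumes "{#} \<notin># fst k"
  shows "\<exists>G t. swf G \<and> gkey G t = k"
proof -
  define real where "real k \<longleftrightarrow> (\<exists>G t. swf G \<and> gkey G t = k)" for k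
  have add: "real (kadd k k')" if "real k" "real k'" for k k'
    using that swf_gunion gkey_gunion_glue unfolding real_def by metis
  have vertex: "real ({#m#}, {#})" if "m \<noteq> {#}" for m
  proof -
    obtain xs where xs: "mset xs = m" using ex_mset by blast
    \<comment> \<open>\<open>eg\<close> is a dummy here: a structure carries no edges, and pairings
      are inserted later by record update.\<close>
    define G where "G = \<lparr>hn = length xs, eg = id, vg = (\<lambda>_. 0), exg = {}\<rparr>"
    have "swf G" by (simp add: swf_def G_def)
    moreover have "xs \<noteq> []" using xs that by auto
    then have "verts G = {0}" by (simp add: verts_def halves_def G_def image_constant_conv)
    moreover have "fib G 0 = {0..<length xs}" by (auto simp: fib_def halves_def G_def)
    ultimately have "gkey G ((!) xs) = ({#m#}, {#})"
      by (simp add: gkey_alt xs image_mset_nth) (simp add: G_def)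
    then show ?thesis using \<open>swf G\<close> unfolding real_def by blast
  qed
  have ext: "real ({#}, {#i#})" for i
  proof -
    define G where "G = \<lparr>hn = 1, eg = id, vg = (\<lambda>_. 0), exg = {0}\<rparr>"
    have "swf G" by (simp add: swf_def G_def halves_def)
    moreover have "verts G = {}" by (auto simp: verts_def halves_def G_def)
    then have "gkey G (\<lambda>_. i) = ({#}, {#i#})"
      by (simp add: gkey_alt) (simp add: G_def)
    ultimately show ?thesis unfolding real_def by blast
  qed
  have zero: "real ({#}, {#})"
    using swf_empty_graph gkey_empty_graph unfolding real_def by metis
  have q: "real ({#}, q)" for q
  proof (induction q)
    case (add i q)
    then show ?case using \<open>\<And>k k'. real k \<Longrightarrow> real k' \<Longrightarrow> real (kadd k k')\<close>[OF ext[of i], of "({#}, q)"]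
      by (simp add: kadd_def)
  qed (rule zero)
  have "real (P, {#})" if "{#} \<notin># P" for P
    using that
  proof (induction P)
    case (add m P)
    then show ?case using \<open>\<And>k k'. real k \<Longrightarrow> real k' \<Longrightarrow> real (kadd k k')\<close>[OF vertex[of m], of "(P, {#})"]
      by (auto simp: kadd_def)
  qed (simp add: zero)
  from add[OF this[OF assms] q[of "snd k"]] show ?thesis by (simp add: kadd_def real_def)
qed

subsection \<open>The Wick formula\<close>

lemma iso_by_inv:
  assumes "iso_by G G' s" "wf_graph G" "wf_graph G'"
  shows "iso_by G' G (inv_into (halves G) s)"
proof -
  let ?i = "inv_into (halves G) s"
  have s: "siso G G' s" and e: "\<And>x. x \<in> halves G \<Longrightarrow> s (eg G x) = eg G' (s x)"
    using assms(1) by (auto simp: iso_by_iff)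
  have b: "bij_betw s (halves G) (halves G')" using s by (simp add: siso_def)
  have "?i (eg G' y) = eg G (?i y)" if "y \<in> halves G'" for y
  proof -
    have y: "?i y \<in> halves G" "s (?i y) = y"
      using b that by (auto simp: bij_betw_def f_inv_into_f inv_into_into)
    then have "eg G (?i y) \<in> halves G" using assms(2) by (auto simp: wf_graph_iff pairing_def)
    then have "?i (s (eg G (?i y))) = eg G (?i y)" using b by (simp add: bij_betw_def)
    then show ?thesis using e y by simp
  qed
  then show ?thesis using siso_inv[OF s] assms(2) by (auto simp: iso_by_iff wf_graph_iff)
qed

lemma giso_refl: "giso G G"
  unfolding giso_def iso_by_iff using siso_id by blast

lemma giso_sym: "giso G G' \<Longrightarrow> wf_graph G \<Longrightarrow> wf_graph G' \<Longrightarrow> giso G' G"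
  unfolding giso_def using iso_by_inv by blast

lemma giso_trans: "giso G G' \<Longrightarrow> giso G' G'' \<Longrightarrow> giso G G''"
  unfolding giso_def iso_by_iff using siso_comp siso_mem by metis

lemma giso_hn: "giso G G' \<Longrightarrow> hn G = hn G'"
  unfolding giso_def iso_by_iff using siso_hn by blast

lemma gclass_eq_iff: "wf_graph G \<Longrightarrow> wf_graph G' \<Longrightarrow> gclass G = gclass G' \<longleftrightarrow> giso G G'"
  unfolding gclass_def using giso_refl giso_sym giso_trans by blast

lemma rep_gclass:
  assumes "wf_graph G"
  shows "wf_graph (rep (gclass G))" "giso G (rep (gclass G))" "gclass (rep (gclass G)) = gclass G"
proof -
  have "G \<in> gclass G" using assms giso_refl by (simp add: gclass_def)
  then have "rep (gclass G) \<in> gclass G" unfolding rep_def by (rule someI)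
  then show 1: "wf_graph (rep (gclass G))" "giso G (rep (gclass G))" by (auto simp: gclass_def)
  then show "gclass (rep (gclass G)) = gclass G"
    using gclass_eq_iff[OF assms 1(1)] by simp
qed

lemma gclasses_upto_rep:
  assumes "C \<in> gclasses_upto H"
  shows "wf_graph (rep C)" "gclass (rep C) = C" "hn (rep C) \<le> H"
proof -
  obtain G where "wf_graph G" "hn G \<le> H" "C = gclass G" using assms by (auto simp: gclasses_upto_def)
  then show "wf_graph (rep C)" "gclass (rep C) = C" "hn (rep C) \<le> H"
    using rep_gclass[of G] giso_hn[of G "rep C"] by auto
qed

lemma gclasses_rep:
  assumes "C \<in> gclasses N"
  shows "wf_graph (rep C)" "gclass (rep C) = C" "hn (rep C) = 2 * N"
proof -
  obtain G where "wf_graph G" "hn G = 2 * N" "C = gclass G" using assms by (auto simp: gclasses_def)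
  then show "wf_graph (rep C)" "gclass (rep C) = C" "hn (rep C) = 2 * N"
    using rep_gclass[of G] giso_hn[of G "rep C"] by auto
qed

lemma Hhat_giso: "a \<in> Hhat \<Longrightarrow> wf_graph G \<Longrightarrow> wf_graph G' \<Longrightarrow> giso G G' \<Longrightarrow> a G = a G'"
  by (auto simp: Hhat_def)

lemma finite_image_factor:
  assumes "finite (d ` A)" "\<And>x y. x \<in> A \<Longrightarrow> y \<in> A \<Longrightarrow> d x = d y \<Longrightarrow> c x = c y"
  shows "finite (c ` A)"
proof -
  have "c ` A \<subseteq> (\<lambda>z. c (SOME x. x \<in> A \<and> d x = z)) ` d ` A"
  proof
    fix y assume "y \<in> c ` A"
    then obtain x where x: "x \<in> A" "y = c x" by auto
    let ?x = "SOME x'. x' \<in> A \<and> d x' = d x"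
    have "?x \<in> A \<and> d ?x = d x" by (rule someI[of _ x]) (use x in auto)
    then have "c ?x = y" using assms(2)[of ?x x] x by simp
    then show "y \<in> (\<lambda>z. c (SOME x. x \<in> A \<and> d x = z)) ` d ` A"
      using x by (auto intro!: image_eqI[of _ _ "d x"])
  qed
  then show ?thesis using assms(1) finite_surj by blast
qed

text \<open>Vertex names and the values of \<open>eg\<close> and \<open>vg\<close> off the
  half-edges are arbitrary, so there are infinitely many records of a given size. The class depends
  only on the data \<open>d\<close>: the pairing on the half-edges, the relation of lying at the
  same vertex and the external half-edges. These admit finitely many values.\<close>

lemma finite_gclasses_upto [simp]: "finite (gclasses_upto H)"
proof -
  let ?A = "{G. wf_graph G \<and> hn G \<le> H}"
  define d where "d G = (hn G, restrict (eg G) (halves G),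
    {(x, y) \<in> halves G \<times> halves G. vg G x = vg G y}, exg G)" for G
  have "finite (d ` ?A)"
  proof (rule finite_subset)
    show "d ` ?A \<subseteq> {..H} \<times> (\<Union>h\<in>{..H}. {0..<h} \<rightarrow>\<^sub>E {0..<h}) \<times> Pow ({..H} \<times> {..H}) \<times> Pow {..H}"
      by (auto simp: d_def wf_graph_def halves_def)
    show "finite ({..H} \<times> (\<Union>h\<in>{..H}. {0..<h} \<rightarrow>\<^sub>E {0..<h}) \<times> Pow ({..H} \<times> {..H}) \<times> Pow {..H})"
      by (intro finite_cartesian_product finite_UN_I) (auto intro!: finite_PiE)
  qed
  moreover have "gclass G = gclass G'" if "G \<in> ?A" "G' \<in> ?A" "d G = d G'" for G G'
  proof -
    have h: "halves G = halves G'" and ex: "exg G = exg G'" and r: "restrict (eg G) (halves G) = restrict (eg G') (halves G)"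
      and v: "{(x, y) \<in> halves G \<times> halves G. vg G x = vg G y} = {(x, y) \<in> halves G \<times> halves G. vg G' x = vg G' y}"
      using that(3) by (auto simp: d_def halves_def)
    have e: "eg G x = eg G' x" if "x \<in> halves G" for x
      using fun_cong[OF r, of x] that by simp
    have "vg G x = vg G y \<longleftrightarrow> vg G' x = vg G' y" if "x \<in> halves G" "y \<in> halves G" for x y
      using v that by blast
    then have "iso_by G G' (\<lambda>x. x)"
      using h ex e by (auto simp: iso_by_iff siso_def bij_betw_def)
    then show ?thesis using that gclass_eq_iff giso_def by blast
  qed
  ultimately show ?thesis unfolding gclasses_upto_def by (rule finite_image_factor)
qed

lemma gclasses_subset_upto: "2 * N \<le> H \<Longrightarrow> gclasses N \<subseteq> gclasses_upto H"
  by (auto simp: gclasses_def gclasses_upto_def)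

lemma finite_gclasses [simp]: "finite (gclasses N)"
  using gclasses_subset_upto[of N "2 * N"] finite_subset[OF _ finite_gclasses_upto] by auto

lemma gclass_in_gclasses: "wf_graph G \<Longrightarrow> hn G = 2 * N \<Longrightarrow> gclass G \<in> gclasses N"
  by (auto simp: gclasses_def)

lemma sum_gclasses_giso:
  assumes "wf_graph G" "hn G = 2 * N"
  shows "(\<Sum>C\<in>gclasses N. if giso G (rep C) then f C else 0) = (f (gclass G) :: 'a :: comm_monoid_add)"
proof -
  have "(\<Sum>C\<in>gclasses N. if giso G (rep C) then f C else 0) =
        (\<Sum>C\<in>gclasses N. if C = gclass G then f C else 0)"
  proof (rule sum.cong)
    fix C assume C: "C \<in> gclasses N"
    then have "giso G (rep C) \<longleftrightarrow> C = gclass G"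
      using gclasses_rep[OF C] gclass_eq_iff[OF assms(1), of "rep C"] by auto
    then show "(if giso G (rep C) then f C else 0) = (if C = gclass G then f C else 0)" by simp
  qed simp
  then show ?thesis using gclass_in_gclasses[OF assms] by (simp add: sum.delta)
qed

text \<open>The symmetry group of the labelled structure. Its order is the product of the factorials
  of the multiplicities in the key: of indices inside each factor, of equal factors, and of indices
  in the last monomial.\<close>

definition Stab :: "graph \<Rightarrow> (nat \<Rightarrow> nat) \<Rightarrow> (nat \<Rightarrow> nat) set" where
  "Stab S t = {s \<in> halves S \<rightarrow>\<^sub>E halves S. siso S S s \<and> (\<forall>x\<in>halves S. t (s x) = t x)}"

text \<open>The full contractions of half-edges with equal labels, which index the terms of Wick's
  theorem. Extensional functions make each of them count once.\<close>

definition Pairings :: "graph \<Rightarrow> (nat \<Rightarrow> nat) \<Rightarrow> (nat \<Rightarrow> nat) set" where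
  "Pairings S t = {e \<in> halves S \<rightarrow>\<^sub>E halves S. pairing S e \<and> (\<forall>x\<in>halves S. t (e x) = t x)}"

lemma finite_Pairings [simp]: "finite (Pairings S t)"
  unfolding Pairings_def by (rule finite_subset[OF _ finite_PiE[of "halves S" "\<lambda>_. halves S"]]) auto

lemma finite_Stab [simp]: "finite (Stab S t)"
  unfolding Stab_def by (rule finite_subset[OF _ finite_PiE[of "halves S" "\<lambda>_. halves S"]]) auto

lemma card_Stab_pos: "swf S \<Longrightarrow> card (Stab S t) > 0"
proof -
  assume "swf S"
  then have "(\<lambda>x\<in>halves S. x) \<in> Stab S t"
    using siso_cong[OF siso_id, of S "\<lambda>x\<in>halves S. x"] by (auto simp: Stab_def)
  then show ?thesis by (metis card_gt_0_iff empty_iff finite_Stab)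
qed

lemma Aut_alt: "Aut G = {s \<in> halves G \<rightarrow>\<^sub>E halves G. iso_by G G s}"
  by (simp add: Aut_def halves_def)

lemma finite_Aut [simp]: "finite (Aut G)"
  unfolding Aut_alt by (rule finite_subset[OF _ finite_PiE[of "halves G" "\<lambda>_. halves G"]]) auto

lemma card_Aut_pos: "wf_graph G \<Longrightarrow> card (Aut G) > 0"
proof -
  assume wf: "wf_graph G"
  then have "(\<lambda>x\<in>halves G. x) \<in> Aut G"
    using siso_cong[OF siso_id, of G "\<lambda>x\<in>halves G. x"]
    by (auto simp: Aut_alt iso_by_iff wf_graph_iff pairing_def)
  then show ?thesis using card_gt_0_iff finite_Aut by blast
qed

text \<open>The structure isomorphisms from \<open>S\<close> to \<open>G\<close> form a torsor under the automorphisms of \<open>S\<close>.\<close>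

lemma card_siso_torsor:
  assumes "swf S" "siso S G s0"
    and PQ: "\<And>u. u \<in> halves S \<rightarrow>\<^sub>E halves S \<Longrightarrow> siso S S u \<Longrightarrow> P u \<longleftrightarrow> Q (\<lambda>x\<in>halves S. s0 (u x))"
  shows "card {s \<in> halves S \<rightarrow>\<^sub>E halves G. siso S G s \<and> Q s} =
         card {u \<in> halves S \<rightarrow>\<^sub>E halves S. siso S S u \<and> P u}"
proof -
  let ?i = "inv_into (halves S) s0"
  let ?f = "\<lambda>u. \<lambda>x\<in>halves S. s0 (u x)" and ?g = "\<lambda>s. \<lambda>x\<in>halves S. ?i (s x)"
  have b: "bij_betw s0 (halves S) (halves G)" using assms(2) by (simp add: siso_def)
  have i1: "?i (s0 x) = x" if "x \<in> halves S" for x using b that by (simp add: bij_betw_def)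
  have i2: "s0 (?i y) = y" "?i y \<in> halves S" if "y \<in> halves G" for y
    using b that by (auto simp: bij_betw_def f_inv_into_f inv_into_into)
  have fsiso: "siso S G (?f u)" if "siso S S u" for u
    by (rule siso_cong[OF siso_comp[OF that assms(2)]]) (use assms in auto)
  have gsiso: "siso S S (?g s)" if "siso S G s" for s
    by (rule siso_cong[OF siso_comp[OF that siso_inv[OF assms(2,1)]]]) (use assms in auto)
  have gf: "?g (?f u) = u" if "u \<in> halves S \<rightarrow>\<^sub>E halves S" for u
  proof
    fix x show "?g (?f u) x = u x"
      using that i1[of "u x"] PiE_mem[OF that, of x] PiE_arb[OF that, of x] by (cases "x \<in> halves S") auto
  qed
  have fg: "?f (?g s) = s" if "s \<in> halves S \<rightarrow>\<^sub>E halves G" for s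
  proof
    fix x show "?f (?g s) x = s x"
      using that i2[of "s x"] PiE_mem[OF that, of x] PiE_arb[OF that, of x] by (cases "x \<in> halves S") auto
  qed
  have "bij_betw ?f {u \<in> halves S \<rightarrow>\<^sub>E halves S. siso S S u \<and> P u}
     {s \<in> halves S \<rightarrow>\<^sub>E halves G. siso S G s \<and> Q s}"
  proof (rule bij_betw_byWitness[where f' = ?g])
    show "\<forall>u\<in>{u \<in> halves S \<rightarrow>\<^sub>E halves S. siso S S u \<and> P u}. ?g (?f u) = u" using gf by blast
    show "\<forall>s\<in>{s \<in> halves S \<rightarrow>\<^sub>E halves G. siso S G s \<and> Q s}. ?f (?g s) = s" using fg by blast
    show "?f ` {u \<in> halves S \<rightarrow>\<^sub>E halves S. siso S S u \<and> P u} \<subseteq>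
        {s \<in> halves S \<rightarrow>\<^sub>E halves G. siso S G s \<and> Q s}"
    proof clarify
      fix u assume u: "u \<in> halves S \<rightarrow>\<^sub>E halves S" "siso S S u" "P u"
      have "?f u \<in> halves S \<rightarrow>\<^sub>E halves G" using siso_mem[OF assms(2)] siso_mem[OF u(2)] by auto
      then show "?f u \<in> halves S \<rightarrow>\<^sub>E halves G \<and> siso S G (?f u) \<and> Q (?f u)"
        using fsiso u PQ by blast
    qed
    show "?g ` {s \<in> halves S \<rightarrow>\<^sub>E halves G. siso S G s \<and> Q s} \<subseteq>
        {u \<in> halves S \<rightarrow>\<^sub>E halves S. siso S S u \<and> P u}"
    proof clarify
      fix s assume s: "s \<in> halves S \<rightarrow>\<^sub>E halves G" "siso S G s" "Q s"
      have g: "?g s \<in> halves S \<rightarrow>\<^sub>E halves S" using i2 siso_mem[OF s(2)] by auto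
      then have "P (?g s) \<longleftrightarrow> Q (?f (?g s))" using PQ gsiso[OF s(2)] by blast
      then have "P (?g s)" unfolding fg[OF s(1)] using s(3) by simp
      then show "?g s \<in> halves S \<rightarrow>\<^sub>E halves S \<and> siso S S (?g s) \<and> P (?g s)"
        using g gsiso[OF s(2)] by blast
    qed
  qed
  then show ?thesis by (rule bij_betw_same_card[symmetric])
qed

lemma card_labelled_siso:
  assumes "swf S" "siso S G s0" "\<And>x. x \<in> halves S \<Longrightarrow> l (s0 x) = t x"
  shows "card {s \<in> halves S \<rightarrow>\<^sub>E halves G. siso S G s \<and> (\<forall>x\<in>halves S. l (s x) = t x)} = card (Stab S t)"
  unfolding Stab_def
  by (rule card_siso_torsor[OF assms(1,2)]) (use assms(3) siso_mem in auto)

text \<open>Given one isomorphism \<open>s0\<close>, every structure isomorphism is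
  \<open>s0\<close> composed with a structure automorphism \<open>u\<close>, and the composite
  respects edges exactly when \<open>u\<close> does. So the isomorphisms, if there are any, form a
  torsor under \<open>Aut G\<close>.\<close>

lemma card_isos:
  assumes "wf_graph G" "wf_graph G'"
  shows "card {s \<in> halves G \<rightarrow>\<^sub>E halves G'. iso_by G G' s} = (if giso G G' then card (Aut G) else 0)"
proof (cases "giso G G'")
  case True
  then obtain s0 where s0: "iso_by G G' s0" by (auto simp: giso_def)
  have inj: "inj_on s0 (halves G)" using s0 by (simp add: iso_by_iff siso_def bij_betw_def)
  have "card {s \<in> halves G \<rightarrow>\<^sub>E halves G'. siso G G' s \<and> (\<forall>x\<in>halves G. s (eg G x) = eg G' (s x))} =
     card {u \<in> halves G \<rightarrow>\<^sub>E halves G. siso G G u \<and> (\<forall>x\<in>halves G. u (eg G x) = eg G (u x))}"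
  proof (rule card_siso_torsor)
    fix u assume u: "u \<in> halves G \<rightarrow>\<^sub>E halves G" "siso G G u"
    have e: "eg G x \<in> halves G" if "x \<in> halves G" for x
      using assms(1) that by (simp add: wf_graph_iff pairing_def)
    have m: "u x \<in> halves G" if "x \<in> halves G" for x using u(1) that by auto
    have "s0 (u (eg G x)) = eg G' (s0 (u x)) \<longleftrightarrow> u (eg G x) = eg G (u x)" if "x \<in> halves G" for x
    proof -
      have "eg G' (s0 (u x)) = s0 (eg G (u x))" using s0 m[OF that] by (simp add: iso_by_iff)
      then show ?thesis using inj e m that by (auto simp: inj_on_def)
    qed
    then show "(\<forall>x\<in>halves G. u (eg G x) = eg G (u x)) \<longleftrightarrow>
      (\<forall>x\<in>halves G. (\<lambda>x\<in>halves G. s0 (u x)) (eg G x) = eg G' ((\<lambda>x\<in>halves G. s0 (u x)) x))"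
      using e by auto
  qed (use assms s0 in \<open>auto simp: wf_graph_iff iso_by_iff\<close>)
  then show ?thesis using True by (simp add: Aut_alt iso_by_iff)
next
  case False
  then have "{s \<in> halves G \<rightarrow>\<^sub>E halves G'. iso_by G G' s} = {}" by (auto simp: giso_def)
  then show ?thesis using False by (simp only: card.empty if_False)
qed

lemma Sigma_ballI: "(\<And>x y. x \<in> A \<Longrightarrow> y \<in> B x \<Longrightarrow> P (x, y)) \<Longrightarrow> \<forall>p\<in>Sigma A B. P p"
  by auto

lemma labelings_alt:
  "labelings n G = {l \<in> halves G \<rightarrow>\<^sub>E {1..n}. \<forall>x\<in>halves G. l (eg G x) = l x}"
  by (auto simp: labelings_def halves_def)

lemma finite_labelings [simp]: "finite (labelings n G)"
  unfolding labelings_alt by (rule finite_subset[OF _ finite_PiE[of "halves G" "\<lambda>_. {1..n}"]]) auto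

text \<open>Both sides count the structure isomorphisms \<open>s\<close> from \<open>S\<close> to \<open>G\<close> for which the pairing of \<open>G\<close>,
pulled back along \<open>s\<close>, respects \<open>t\<close>.\<close>

lemma labelings_double_count:
  assumes S: "swf S" and G: "wf_graph G" and t: "\<And>x. x \<in> halves S \<Longrightarrow> t x \<in> {1..n}"
  shows "card {l \<in> labelings n G. gkey G l = gkey S t} * card (Stab S t) =
    (\<Sum>e\<in>Pairings S t. card {s \<in> halves S \<rightarrow>\<^sub>E halves G. iso_by (S\<lparr>eg := e\<rparr>) G s})"
proof -
  let ?L = "{l \<in> labelings n G. gkey G l = gkey S t}"
  let ?F = "\<lambda>l. {s \<in> halves S \<rightarrow>\<^sub>E halves G. siso S G s \<and> (\<forall>x\<in>halves S. l (s x) = t x)}"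
  let ?I = "\<lambda>e. {s \<in> halves S \<rightarrow>\<^sub>E halves G. iso_by (S\<lparr>eg := e\<rparr>) G s}"
  have swfG: "swf G" using G by (simp add: wf_graph_iff)
  have eG: "eg G y \<in> halves G" "eg G (eg G y) = y" "eg G y \<noteq> y" if "y \<in> halves G" for y
    using G that by (auto simp: wf_graph_iff pairing_def)
  have finE: "finite (halves S \<rightarrow>\<^sub>E halves G)" by (intro finite_PiE) auto
  let ?i = "\<lambda>s. inv_into (halves S) s"
  have inv: "?i s (s x) = x" if "siso S G s" "x \<in> halves S" for s x
    using that by (auto simp: siso_def bij_betw_def)
  have inv2: "s (?i s y) = y" "?i s y \<in> halves S" if "siso S G s" "y \<in> halves G" for s y
    using that by (auto simp: siso_def bij_betw_def f_inv_into_f inv_into_into)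
  \<comment> \<open>Once \<open>s\<close> is fixed, neither \<open>l\<close> nor \<open>e\<close> is
    free: \<open>l\<close> is \<open>t\<close> transported along \<open>s\<close>, and
    \<open>e\<close> is the pairing of \<open>G\<close> pulled back along \<open>s\<close>. Each map
    drops one of them and rebuilds the other.\<close>
  let ?f = "\<lambda>(l, s). (\<lambda>x\<in>halves S. ?i s (eg G (s x)), s)"
  let ?g = "\<lambda>(e, s). (\<lambda>y\<in>halves G. t (?i s y), s)"
  have "bij_betw ?f (Sigma ?L ?F) (Sigma (Pairings S t) ?I)"
  proof (rule bij_betw_byWitness[where f' = ?g])
    have "?g (?f (l, s)) = (l, s)" if l: "l \<in> ?L" and s: "s \<in> ?F l" for l s
    proof -
      have "(\<lambda>y\<in>halves G. t (?i s y)) y = l y" for y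
      proof (cases "y \<in> halves G")
        case True
        have si: "siso S G s" using s by blast
        have "l (s (?i s y)) = t (?i s y)" using inv2(2)[OF si True] s by blast
        then show ?thesis using True inv2(1)[OF si True] by simp
      next
        case False
        then show ?thesis using l PiE_arb[of l "halves G" "\<lambda>_. {1..n}" y]
          by (simp add: labelings_alt)
      qed
      then have "(\<lambda>y\<in>halves G. t (?i s y)) = l" by (rule ext)
      then show ?thesis by simp
    qed
    then show "\<forall>a\<in>Sigma ?L ?F. ?g (?f a) = a" by (rule Sigma_ballI)
    have "?f (?g (e, s)) = (e, s)" if e: "e \<in> Pairings S t" and s: "s \<in> ?I e" for e s
    proof -
      have si: "siso S G s" using s by (simp add: iso_by_iff)
      have "(\<lambda>x\<in>halves S. ?i s (eg G (s x))) x = e x" for x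
      proof (cases "x \<in> halves S")
        case True
        then have "e x \<in> halves S" using e by (auto simp: Pairings_def)
        moreover have "eg G (s x) = s (e x)" using s True by (simp add: iso_by_iff)
        ultimately show ?thesis using True inv[OF si] by simp
      next
        case False
        then show ?thesis using e PiE_arb[of e "halves S" "\<lambda>_. halves S" x]
          by (simp add: Pairings_def)
      qed
      then have "(\<lambda>x\<in>halves S. ?i s (eg G (s x))) = e" by (rule ext)
      then show ?thesis by simp
    qed
    then show "\<forall>a\<in>Sigma (Pairings S t) ?I. ?f (?g a) = a" by (rule Sigma_ballI)
    have "?f (l, s) \<in> Sigma (Pairings S t) ?I" if l: "l \<in> ?L" and s: "s \<in> ?F l" for l s
    proof -
      have si: "siso S G s" and ls: "\<And>x. x \<in> halves S \<Longrightarrow> l (s x) = t x" using s by auto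
      define e where "e = (\<lambda>x\<in>halves S. ?i s (eg G (s x)))"
      have ex: "e x \<in> halves S" "s (e x) = eg G (s x)" if "x \<in> halves S" for x
        using that inv2[OF si] eG siso_mem[OF si that] by (auto simp: e_def)
      have "e (e x) = x" if "x \<in> halves S" for x
      proof -
        have "s (e (e x)) = s x" using ex that eG siso_mem[OF si that] by simp
        then have "?i s (s (e (e x))) = x" using inv[OF si that] by simp
        then show ?thesis using inv[OF si ex(1)[OF ex(1)[OF that]]] by simp
      qed
      moreover have "e x \<noteq> x" if "x \<in> halves S" for x
        using ex[OF that] eG(3)[OF siso_mem[OF si that]] by auto
      moreover have "t (e x) = t x" if "x \<in> halves S" for x
      proof -
        have "t (e x) = l (eg G (s x))" using ls[OF ex(1)[OF that]] ex(2)[OF that] by simp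
        also have "\<dots> = l (s x)" using l siso_mem[OF si that] by (simp add: labelings_alt)
        finally show ?thesis using ls that by simp
      qed
      moreover have "e \<in> halves S \<rightarrow>\<^sub>E halves S" using ex(1) by (auto simp: e_def)
      ultimately have "e \<in> Pairings S t" using ex by (auto simp: Pairings_def pairing_def)
      moreover have "s \<in> ?I e" using s ex by (auto simp: iso_by_iff)
      ultimately have "(e, s) \<in> Sigma (Pairings S t) ?I" by blast
      then show ?thesis by (simp only: prod.case e_def)
    qed
    then show "?f ` Sigma ?L ?F \<subseteq> Sigma (Pairings S t) ?I"
      unfolding image_subset_iff by (rule Sigma_ballI)
    have "?g (e, s) \<in> Sigma ?L ?F" if e: "e \<in> Pairings S t" and s: "s \<in> ?I e" for e s
    proof -
      have si: "siso S G s" and se: "\<And>x. x \<in> halves S \<Longrightarrow> s (e x) = eg G (s x)"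
        using s by (auto simp: iso_by_iff)
      have em: "e x \<in> halves S" "t (e x) = t x" if "x \<in> halves S" for x
        using e that by (auto simp: Pairings_def)
      define l where "l = (\<lambda>y\<in>halves G. t (?i s y))"
      have ls: "l (s x) = t x" if "x \<in> halves S" for x
        using that siso_mem[OF si that] inv[OF si that] by (simp add: l_def)
      have "l (eg G y) = l y" if "y \<in> halves G" for y
      proof -
        define x where "x = ?i s y"
        have x: "x \<in> halves S" "y = s x" using inv2[OF si that] by (auto simp: x_def)
        have "l (eg G y) = l (s (e x))" using se x by simp
        also have "\<dots> = l y" using ls em x by simp
        finally show ?thesis .
      qed
      moreover have "l \<in> halves G \<rightarrow>\<^sub>E {1..n}" using inv2[OF si] t by (auto simp: l_def)
      ultimately have "l \<in> labelings n G" by (simp add: labelings_alt)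
      moreover have "gkey G l = gkey S t" using siso_imp_gkey_eq[OF si, of l t] ls S by simp
      ultimately have "(l, s) \<in> Sigma ?L ?F" using s si ls by simp
      then show ?thesis by (simp only: prod.case l_def)
    qed
    then show "?g ` Sigma (Pairings S t) ?I \<subseteq> Sigma ?L ?F"
      unfolding image_subset_iff by (rule Sigma_ballI)
  qed
  then have "card (Sigma ?L ?F) = card (Sigma (Pairings S t) ?I)" by (rule bij_betw_same_card)
  moreover have "card (Sigma ?L ?F) = (\<Sum>l\<in>?L. card (?F l))"
    using finE by (intro card_SigmaI) auto
  moreover have "\<dots> = (\<Sum>l\<in>?L. card (Stab S t))"
  proof (rule sum.cong)
    fix l assume "l \<in> ?L"
    then have "gkey S t = gkey G l" by simp
    then obtain s0 where "siso S G s0" "\<forall>x\<in>halves S. l (s0 x) = t x"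
      using gkey_eq_imp_siso[OF S swfG] by blast
    then show "card (?F l) = card (Stab S t)" using card_labelled_siso[OF S] by blast
  qed simp
  moreover have "card (Sigma (Pairings S t) ?I) = (\<Sum>e\<in>Pairings S t. card (?I e))"
    using finE by (intro card_SigmaI) auto
  ultimately show ?thesis by simp
qed

lemma wf_graph_Pairings: "swf S \<Longrightarrow> e \<in> Pairings S t \<Longrightarrow> wf_graph (S\<lparr>eg := e\<rparr>)"
  by (simp add: wf_graph_iff Pairings_def)

text \<open>Each pair has exactly one smaller member. This makes the division by 2 in
  \<open>Phi\<close> exact whenever a pairing exists.\<close>

lemma pairing_even:
  assumes "pairing S e" shows "even (hn S)"
proof -
  let ?A = "{x \<in> halves S. x < e x}" and ?B = "{x \<in> halves S. e x < x}"
  have "bij_betw e ?A ?B"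
    by (rule bij_betw_byWitness[where f' = e]) (use assms in \<open>auto simp: pairing_def\<close>)
  then have "card ?A = card ?B" by (rule bij_betw_same_card)
  moreover have "halves S = ?A \<union> ?B" using assms unfolding pairing_def by fastforce
  moreover have "card (?A \<union> ?B) = card ?A + card ?B" by (intro card_Un_disjoint) auto
  ultimately have "card (halves S) = 2 * card ?A" by simp
  then show ?thesis by simp
qed

text \<open>The factor |Stab| turns each count of labelings into a count of isomorphisms from
  \<open>S\<close> with an added pairing. After exchanging the sums, a fixed pairing
  \<open>e\<close> meets a single class, that of \<open>S\<close> with \<open>e\<close>, and meets
  it |Aut| times, which is the factor in \<open>Iop\<close>. Without any division the formula holds
  over every commutative ring.\<close>

theorem Phi_wick:
  fixes a :: "graph \<Rightarrow> 'k::comm_ring_1"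
  assumes S: "swf S" and a: "a \<in> Hhat" and t: "\<And>x. x \<in> halves S \<Longrightarrow> t x \<in> {1..n}" and "n \<ge> 1"
  shows "of_nat (card (Stab S t)) * Phi a n (gkey S t) = (\<Sum>e\<in>Pairings S t. Iop a (S\<lparr>eg := e\<rparr>))"
proof -
  let ?N = "hn S div 2"
  have "of_nat (card (Stab S t)) * Phi a n (gkey S t) =
    (\<Sum>C\<in>gclasses ?N. a (rep C) *
       of_nat (card {l \<in> labelings n (rep C). gkey (rep C) l = gkey S t} * card (Stab S t)))"
    using assms(4) by (simp add: Phi_def Phin_def kdeg_gkey[OF S] sum_distrib_left mult_ac)
  also have "\<dots> = (\<Sum>C\<in>gclasses ?N. \<Sum>e\<in>Pairings S t.
      if giso (S\<lparr>eg := e\<rparr>) (rep C) then a (rep C) * of_nat (card (Aut (S\<lparr>eg := e\<rparr>))) else 0)"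
  proof (rule sum.cong)
    fix C assume C: "C \<in> gclasses ?N"
    have "card {l \<in> labelings n (rep C). gkey (rep C) l = gkey S t} * card (Stab S t) =
      (\<Sum>e\<in>Pairings S t. card {s \<in> halves S \<rightarrow>\<^sub>E halves (rep C). iso_by (S\<lparr>eg := e\<rparr>) (rep C) s})"
      by (rule labelings_double_count[OF S gclasses_rep(1)[OF C] t])
    also have "\<dots> = (\<Sum>e\<in>Pairings S t.
        if giso (S\<lparr>eg := e\<rparr>) (rep C) then card (Aut (S\<lparr>eg := e\<rparr>)) else 0)"
    proof (rule sum.cong)
      fix e assume "e \<in> Pairings S t"
      then show "card {s \<in> halves S \<rightarrow>\<^sub>E halves (rep C). iso_by (S\<lparr>eg := e\<rparr>) (rep C) s} =
         (if giso (S\<lparr>eg := e\<rparr>) (rep C) then card (Aut (S\<lparr>eg := e\<rparr>)) else 0)"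
        using card_isos[OF wf_graph_Pairings[OF S] gclasses_rep(1)[OF C], of e t] by simp
    qed simp
    finally show "a (rep C) *
       of_nat (card {l \<in> labelings n (rep C). gkey (rep C) l = gkey S t} * card (Stab S t)) =
       (\<Sum>e\<in>Pairings S t. if giso (S\<lparr>eg := e\<rparr>) (rep C) then a (rep C) * of_nat (card (Aut (S\<lparr>eg := e\<rparr>))) else 0)"
      by (simp add: sum_distrib_left if_distrib cong: if_cong)
  qed simp
  also have "\<dots> = (\<Sum>e\<in>Pairings S t. \<Sum>C\<in>gclasses ?N.
      if giso (S\<lparr>eg := e\<rparr>) (rep C) then a (rep C) * of_nat (card (Aut (S\<lparr>eg := e\<rparr>))) else 0)"
    by (rule sum.swap)
  also have "\<dots> = (\<Sum>e\<in>Pairings S t. Iop a (S\<lparr>eg := e\<rparr>))"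
  proof (rule sum.cong)
    fix e assume e: "e \<in> Pairings S t"
    have wf: "wf_graph (S\<lparr>eg := e\<rparr>)" by (rule wf_graph_Pairings[OF S e])
    \<comment> \<open>For odd \<open>hn S\<close> the rounded half would select classes of the wrong
      size, but then there is no pairing \<open>e\<close> to consider.\<close>
    have "even (hn S)" using e pairing_even by (auto simp: Pairings_def)
    then have h: "hn (S\<lparr>eg := e\<rparr>) = 2 * ?N" by simp
    have "a (rep (gclass (S\<lparr>eg := e\<rparr>))) = a (S\<lparr>eg := e\<rparr>)"
      using Hhat_giso[OF a wf] rep_gclass[OF wf] by metis
    then show "(\<Sum>C\<in>gclasses ?N.
      if giso (S\<lparr>eg := e\<rparr>) (rep C) then a (rep C) * of_nat (card (Aut (S\<lparr>eg := e\<rparr>))) else 0) = Iop a (S\<lparr>eg := e\<rparr>)"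
      by (subst sum_gclasses_giso[OF wf h]) (simp add: Iop_def mult.commute)
  qed simp
  finally show ?thesis .
qed

subsection \<open>The action of matrices on keys\<close>

text \<open>\<open>substc\<close> and \<open>keycoef\<close> sum over functions on list positions.
  This carries such sums over to functions on half-edges or on vertices; the range \<open>Y\<close>
  may vary because vertices have different valences.\<close>

lemma sum_PiE_reindex:
  assumes b: "bij_betw b B A"
  shows "(\<Sum>u\<in>{u \<in> Pi\<^sub>E B (\<lambda>k. Y (b k)). Q u}. f u) =
    (\<Sum>s\<in>{s \<in> Pi\<^sub>E A Y. Q (\<lambda>k\<in>B. s (b k))}. f (\<lambda>k\<in>B. s (b k)))"
proof -
  let ?i = "inv_into B b"
  have i1: "?i (b k) = k" if "k \<in> B" for k using b that by (simp add: bij_betw_def)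
  have i2: "b (?i x) = x" "?i x \<in> B" if "x \<in> A" for x
    using b that by (auto simp: bij_betw_def f_inv_into_f inv_into_into)
  have bA: "b k \<in> A" if "k \<in> B" for k using b that by (auto simp: bij_betw_def)
  let ?f = "\<lambda>s. \<lambda>k\<in>B. s (b k)" and ?g = "\<lambda>u. \<lambda>x\<in>A. u (?i x)"
  have gf: "?g (?f s) = s" if "s \<in> Pi\<^sub>E A Y" for s
    by (rule ext) (use that i2 PiE_arb[OF that] in auto)
  have fg: "?f (?g u) = u" if "u \<in> Pi\<^sub>E B (\<lambda>k. Y (b k))" for u
    by (rule ext) (use that i1 bA PiE_arb[OF that] in auto)
  have fm: "?f s \<in> Pi\<^sub>E B (\<lambda>k. Y (b k))" if "s \<in> Pi\<^sub>E A Y" for s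
    using that bA by auto
  have gm: "?g u \<in> Pi\<^sub>E A Y" if u: "u \<in> Pi\<^sub>E B (\<lambda>k. Y (b k))" for u
  proof (rule PiE_I)
    fix x assume "x \<in> A"
    then show "?g u x \<in> Y x" using PiE_mem[OF u i2(2)] i2(1) by fastforce
  qed simp
  have "bij_betw ?f {s \<in> Pi\<^sub>E A Y. Q (?f s)} {u \<in> Pi\<^sub>E B (\<lambda>k. Y (b k)). Q u}"
  proof (rule bij_betw_byWitness[where f' = ?g])
    show "\<forall>s\<in>{s \<in> Pi\<^sub>E A Y. Q (?f s)}. ?g (?f s) = s" using gf by blast
    show "\<forall>u\<in>{u \<in> Pi\<^sub>E B (\<lambda>k. Y (b k)). Q u}. ?f (?g u) = u" using fg by blast
    show "?f ` {s \<in> Pi\<^sub>E A Y. Q (?f s)} \<subseteq> {u \<in> Pi\<^sub>E B (\<lambda>k. Y (b k)). Q u}" using fm by blast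
    show "?g ` {u \<in> Pi\<^sub>E B (\<lambda>k. Y (b k)). Q u} \<subseteq> {s \<in> Pi\<^sub>E A Y. Q (?f s)}"
    proof clarify
      fix u assume u: "u \<in> Pi\<^sub>E B (\<lambda>k. Y (b k))" "Q u"
      then have "Q (?f (?g u))" unfolding fg[OF u(1)] by simp
      then show "?g u \<in> Pi\<^sub>E A Y \<and> Q (?f (?g u))" using gm[OF u(1)] by blast
    qed
  qed
  then show ?thesis by (rule sum.reindex_bij_betw[symmetric])
qed

lemma bij_betw_mset_set: "finite B \<Longrightarrow> bij_betw b B A \<Longrightarrow> mset_set A = image_mset b (mset_set B)"
  by (auto simp: bij_betw_def image_mset_mset_set)

text \<open>The sorted list in \<open>substc\<close> is just one enumeration of the monomial, so any
  set labelled by the same multiset may take the place of its positions.\<close>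

lemma substc_image_mset:
  assumes "finite A"
  shows "substc n M (image_mset t (mset_set A)) r =
    (\<Sum>s\<in>{s \<in> A \<rightarrow>\<^sub>E {1..n}. image_mset s (mset_set A) = r}. \<Prod>x\<in>A. M (s x) (t x))"
proof -
  define m where "m = image_mset t (mset_set A)"
  define xs where "xs = sorted_list_of_multiset m"
  have mxs: "mset xs = m" by (simp add: xs_def)
  then have len: "length xs = size m" by (metis size_mset)
  have "image_mset ((!) xs) (mset_set {0..<size m}) = image_mset t (mset_set A)"
    using image_mset_nth[of xs] mxs len by (simp add: m_def)
  from image_mset_eq_imp_bij[OF _ assms this] obtain b where
    b: "bij_betw b {0..<size m} A" and bt: "\<And>k. k < size m \<Longrightarrow> t (b k) = xs ! k" by auto
  have "substc n M m r = (\<Sum>u\<in>{u \<in> Pi\<^sub>E {0..<size m} (\<lambda>_. {1..n}). mset (map u [0..<size m]) = r}.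
      \<Prod>k<size m. M (u k) (xs ! k))"
    by (simp add: substc_def xs_def)
  also have "\<dots> = (\<Sum>s\<in>{s \<in> A \<rightarrow>\<^sub>E {1..n}. mset (map (\<lambda>k\<in>{0..<size m}. s (b k)) [0..<size m]) = r}.
      \<Prod>k<size m. M ((\<lambda>k\<in>{0..<size m}. s (b k)) k) (xs ! k))"
    by (rule sum_PiE_reindex[OF b, where Y = "\<lambda>_. {1..n}"])
  also have "\<dots> = (\<Sum>s\<in>{s \<in> A \<rightarrow>\<^sub>E {1..n}. image_mset s (mset_set A) = r}. \<Prod>x\<in>A. M (s x) (t x))"
  proof (rule sum.cong)
    have "mset (map (\<lambda>k\<in>{0..<size m}. s (b k)) [0..<size m]) = image_mset s (mset_set A)" for s
    proof -
      have "mset (map (\<lambda>k\<in>{0..<size m}. s (b k)) [0..<size m]) = mset (map (\<lambda>k. s (b k)) [0..<size m])"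
        by (rule arg_cong[of _ _ mset]) simp
      also have "\<dots> = image_mset s (mset_set A)"
        using bij_betw_mset_set[OF _ b] by (simp add: multiset.map_comp o_def)
      finally show ?thesis .
    qed
    note eq = this
    show "{s \<in> A \<rightarrow>\<^sub>E {1..n}. mset (map (\<lambda>k\<in>{0..<size m}. s (b k)) [0..<size m]) = r} =
       {s \<in> A \<rightarrow>\<^sub>E {1..n}. image_mset s (mset_set A) = r}"
    proof (rule Collect_cong)
      fix s
      show "(s \<in> A \<rightarrow>\<^sub>E {1..n} \<and> mset (map (\<lambda>k\<in>{0..<size m}. s (b k)) [0..<size m]) = r) =
       (s \<in> A \<rightarrow>\<^sub>E {1..n} \<and> image_mset s (mset_set A) = r)"
        unfolding eq[of s] by (rule refl)
    qed
    fix s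
    have "(\<Prod>k<size m. M ((\<lambda>k\<in>{0..<size m}. s (b k)) k) (xs ! k)) =
       (\<Prod>k\<in>{0..<size m}. M (s (b k)) (t (b k)))"
      using bt by (intro prod.cong) auto
    also have "\<dots> = (\<Prod>x\<in>A. M (s x) (t x))" by (rule prod.reindex_bij_betw[OF b])
    finally show "(\<Prod>k<size m. M ((\<lambda>k\<in>{0..<size m}. s (b k)) k) (xs ! k)) = (\<Prod>x\<in>A. M (s x) (t x))" .
  qed
  finally show ?thesis by (simp add: m_def)
qed

text \<open>A function on \<open>X\<close> is a family of functions on the fibres of
  \<open>v\<close>. When condition and summand are both fibrewise, the sum factors by
  distributivity.\<close>

lemma sum_PiE_fibres:
  fixes h :: "'w \<Rightarrow> ('a \<Rightarrow> 'b) \<Rightarrow> 'c::comm_semiring_1"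
  assumes "finite X" "finite W" "finite Y" "\<And>x. x \<in> X \<Longrightarrow> v x \<in> W"
    and F: "\<And>w. F w = {x \<in> X. v x = w}"
  shows "(\<Sum>s\<in>{s \<in> X \<rightarrow>\<^sub>E Y. \<forall>w\<in>W. C w (restrict s (F w))}. \<Prod>w\<in>W. h w (restrict s (F w))) =
    (\<Prod>w\<in>W. \<Sum>s\<in>{s \<in> F w \<rightarrow>\<^sub>E Y. C w s}. h w s)"
proof -
  let ?D = "\<lambda>w. {s \<in> F w \<rightarrow>\<^sub>E Y. C w s}"
  let ?L = "{s \<in> X \<rightarrow>\<^sub>E Y. \<forall>w\<in>W. C w (restrict s (F w))}"
  let ?f = "\<lambda>s. \<lambda>w\<in>W. restrict s (F w)" and ?g = "\<lambda>p. \<lambda>x\<in>X. p (v x) x"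
  have fin: "finite (?D w)" if "w \<in> W" for w
    using assms by (intro finite_subset[OF _ finite_PiE[of "F w" "\<lambda>_. Y"]]) auto
  have rg: "restrict (?g p) (F w) = p w" if "p \<in> Pi\<^sub>E W ?D" "w \<in> W" for p w
  proof
    fix x
    have pw: "p w \<in> F w \<rightarrow>\<^sub>E Y" using that PiE_mem[of p W ?D w] by simp
    show "restrict (?g p) (F w) x = p w x"
      using PiE_arb[OF pw, of x] by (cases "x \<in> F w") (auto simp: F)
  qed
  have "bij_betw ?f ?L (Pi\<^sub>E W ?D)"
  proof (rule bij_betw_byWitness[where f' = ?g])
    show "\<forall>s\<in>?L. ?g (?f s) = s"
    proof
      fix s assume s: "s \<in> ?L"
      show "?g (?f s) = s"
      proof
        fix x show "?g (?f s) x = s x"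
          using assms(4)[of x] PiE_arb[of s X "\<lambda>_. Y" x] s by (cases "x \<in> X") (simp_all add: F)
      qed
    qed
    show "\<forall>p\<in>Pi\<^sub>E W ?D. ?f (?g p) = p"
    proof
      fix p assume p: "p \<in> Pi\<^sub>E W ?D"
      show "?f (?g p) = p"
      proof
        fix w show "?f (?g p) w = p w"
          using rg[OF p, of w] PiE_arb[OF p, of w] by (cases "w \<in> W") simp_all
      qed
    qed
    show "?f ` ?L \<subseteq> Pi\<^sub>E W ?D"
    proof (rule image_subsetI)
      fix s assume s: "s \<in> ?L"
      have "restrict s (F w) \<in> F w \<rightarrow>\<^sub>E Y" for w
        by (rule PiE_I) (use s in \<open>auto simp: F\<close>)
      then show "?f s \<in> Pi\<^sub>E W ?D" using s by simp
    qed
    show "?g ` Pi\<^sub>E W ?D \<subseteq> ?L"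
    proof (rule image_subsetI)
      fix p assume p: "p \<in> Pi\<^sub>E W ?D"
      have m: "p w \<in> F w \<rightarrow>\<^sub>E Y" "C w (p w)" if "w \<in> W" for w
        using PiE_mem[OF p that] by auto
      have "?g p \<in> X \<rightarrow>\<^sub>E Y"
      proof (rule PiE_I)
        fix x assume "x \<in> X"
        then show "?g p x \<in> Y" using PiE_mem[OF m(1)[OF assms(4)], of x x] by (simp add: F)
      qed simp
      moreover have "\<forall>w\<in>W. C w (restrict (?g p) (F w))"
      proof
        fix w assume w: "w \<in> W"
        show "C w (restrict (?g p) (F w))" unfolding rg[OF p w] by (rule m(2)[OF w])
      qed
      ultimately show "?g p \<in> ?L" by simp
    qed
  qed
  then have "(\<Sum>p\<in>Pi\<^sub>E W ?D. \<Prod>w\<in>W. h w (p w)) = (\<Sum>s\<in>?L. \<Prod>w\<in>W. h w (?f s w))"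
    by (rule sum.reindex_bij_betw[symmetric])
  also have "\<dots> = (\<Sum>s\<in>?L. \<Prod>w\<in>W. h w (restrict s (F w)))"
    by (intro sum.cong prod.cong) auto
  finally show ?thesis using prod_sum_PiE[OF assms(2) fin, where f = h] by simp
qed

lemma image_mset_restrict: "finite A \<Longrightarrow> image_mset (restrict s A) (mset_set A) = image_mset s (mset_set A)"
  by (intro image_mset_mset_set_cong) auto

lemma keycoef_fixed_monomials:
  fixes M :: "nat \<Rightarrow> nat \<Rightarrow> 'k::comm_ring_1"
  assumes "swf G"
  shows "(\<Sum>s\<in>{s \<in> halves G \<rightarrow>\<^sub>E {1..n}. (\<forall>w\<in>verts G. image_mset s (mset_set (fib G w)) = p w) \<and>
            image_mset s (mset_set (exg G)) = q}. \<Prod>x\<in>halves G. M (s x) (t x)) =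
    substc n M (image_mset t (mset_set (exg G))) q *
      (\<Prod>w\<in>verts G. substc n M (image_mset t (mset_set (fib G w))) (p w))"
proof -
  \<comment> \<open>\<open>None\<close> collects all external half-edges: they are different
    vertices of the graph, but together form the single monomial in the last tensor factor.\<close>
  define v where "v x = (if x \<in> exg G then None else Some (vg G x))" for x
  define W where "W = insert None (Some ` verts G)"
  define F where "F w = {x \<in> halves G. v x = w}" for w
  have FN: "F None = exg G" using assms by (auto simp: F_def v_def swf_def)
  have FS: "F (Some w) = fib G w" if "w \<in> verts G" for w
    using fib_verts_disj[OF assms that] by (auto simp: F_def v_def fib_def)
  define D where "D w = (case w of None \<Rightarrow> q | Some u \<Rightarrow> p u)" for w
  have finF [simp]: "finite (F w)" for w by (simp add: F_def)
  have vW: "v x \<in> W" if "x \<in> halves G" for x using that by (auto simp: v_def W_def verts_def)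
  have "{s \<in> halves G \<rightarrow>\<^sub>E {1..n}. (\<forall>w\<in>verts G. image_mset s (mset_set (fib G w)) = p w) \<and>
            image_mset s (mset_set (exg G)) = q} =
     {s \<in> halves G \<rightarrow>\<^sub>E {1..n}. \<forall>w\<in>W. image_mset (restrict s (F w)) (mset_set (F w)) = D w}"
    using FN FS by (auto simp: W_def D_def image_mset_restrict)
  moreover have "(\<Prod>x\<in>halves G. M (s x) (t x)) = (\<Prod>w\<in>W. \<Prod>x\<in>F w. M (restrict s (F w) x) (t x))" for s
  proof -
    have "(\<Prod>x\<in>halves G. M (s x) (t x)) = (\<Prod>w\<in>W. \<Prod>x\<in>F w. M (s x) (t x))"
      unfolding F_def using vW by (intro prod.group[symmetric]) (auto simp: W_def)
    also have "\<dots> = (\<Prod>w\<in>W. \<Prod>x\<in>F w. M (restrict s (F w) x) (t x))"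
      by (intro prod.cong) auto
    finally show ?thesis .
  qed
  ultimately have "(\<Sum>s\<in>{s \<in> halves G \<rightarrow>\<^sub>E {1..n}. (\<forall>w\<in>verts G. image_mset s (mset_set (fib G w)) = p w) \<and>
            image_mset s (mset_set (exg G)) = q}. \<Prod>x\<in>halves G. M (s x) (t x)) =
     (\<Sum>s\<in>{s \<in> halves G \<rightarrow>\<^sub>E {1..n}. \<forall>w\<in>W. image_mset (restrict s (F w)) (mset_set (F w)) = D w}.
        \<Prod>w\<in>W. \<Prod>x\<in>F w. M (restrict s (F w) x) (t x))" by simp
  also have "\<dots> = (\<Prod>w\<in>W. \<Sum>s\<in>{s \<in> F w \<rightarrow>\<^sub>E {1..n}. image_mset s (mset_set (F w)) = D w}.
      \<Prod>x\<in>F w. M (s x) (t x))"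
    by (rule sum_PiE_fibres[where v = v]) (use vW in \<open>auto simp: W_def F_def\<close>)
  also have "\<dots> = (\<Prod>w\<in>W. substc n M (image_mset t (mset_set (F w))) (D w))"
    by (simp add: substc_image_mset)
  also have "\<dots> = substc n M (image_mset t (mset_set (exg G))) q *
      (\<Prod>w\<in>verts G. substc n M (image_mset t (mset_set (fib G w))) (p w))"
    using FN FS by (simp add: W_def D_def prod.reindex)
  finally show ?thesis .
qed

lemma finite_monoms: "finite (monoms n d)"
proof -
  have "monoms n d \<subseteq> mset ` {xs. set xs \<subseteq> {1..n} \<and> length xs = d}"
  proof
    fix r assume r: "r \<in> monoms n d"
    obtain xs where "mset xs = r" using ex_mset by blast
    then show "r \<in> mset ` {xs. set xs \<subseteq> {1..n} \<and> length xs = d}"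
      using r by (auto simp: monoms_def intro!: image_eqI[of _ _ xs])
  qed
  then show ?thesis by (rule finite_subset) (simp add: finite_lists_length_eq)
qed

lemma mset_lst: "mset (lst P) = P"
  unfolding lst_def by (rule someI_ex) (rule ex_mset)

text \<open>The matrix turns each half-edge into a linear form, and expanding the product means
  choosing a new label \<open>s x\<close> in each form. The definition of \<open>keycoef\<close>
  first chooses the resulting monomial at each vertex and then the labels; the proof groups the
  relabelings \<open>s\<close> by those monomials \<open>r s\<close>.\<close>

lemma keycoef_gkey:
  fixes M :: "nat \<Rightarrow> nat \<Rightarrow> 'k::comm_ring_1"
  assumes "swf G"
  shows "keycoef n M (gkey G t) k' =
    (\<Sum>s\<in>{s \<in> halves G \<rightarrow>\<^sub>E {1..n}. gkey G s = k'}. \<Prod>x\<in>halves G. M (s x) (t x))"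
proof -
  obtain P' q' where k': "k' = (P', q')" by (cases k')
  define T where "T w = image_mset t (mset_set (fib G w))" for w
  define P where "P = image_mset T (mset_set (verts G))"
  have fstk: "fst (gkey G t) = P" by (simp add: gkey_alt P_def T_def[abs_def])
  have len: "length (lst P) = size P" using mset_lst[of P] by (metis size_mset)
  have "image_mset ((!) (lst P)) (mset_set {0..<size P}) = image_mset T (mset_set (verts G))"
    using image_mset_nth[of "lst P"] mset_lst[of P] len by (simp add: P_def)
  from image_mset_eq_imp_bij[OF _ finite_verts this] obtain b where
    b: "bij_betw b {0..<size P} (verts G)" and bT: "\<And>i. i < size P \<Longrightarrow> T (b i) = lst P ! i" by auto
  let ?Y = "\<lambda>w. monoms n (size (T w))"
  let ?R = "{p \<in> Pi\<^sub>E (verts G) ?Y. image_mset p (mset_set (verts G)) = P'}"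
  let ?A = "{s \<in> halves G \<rightarrow>\<^sub>E {1..n}. gkey G s = k'}"
  define r where "r s = (\<lambda>w\<in>verts G. image_mset s (mset_set (fib G w)))" for s :: "nat \<Rightarrow> nat"
  have PE: "Pi\<^sub>E {0..<size P} (\<lambda>i. monoms n (size (lst P ! i))) = Pi\<^sub>E {0..<size P} (\<lambda>i. ?Y (b i))"
    using bT by (intro PiE_cong) auto
  have "(\<Sum>rho\<in>{rho \<in> Pi\<^sub>E {0..<size P} (\<lambda>i. monoms n (size (lst P ! i))).
              mset (map rho [0..<size P]) = P'}. \<Prod>i<size P. substc n M (lst P ! i) (rho i)) =
     (\<Sum>p\<in>{p \<in> Pi\<^sub>E (verts G) ?Y. mset (map (\<lambda>i\<in>{0..<size P}. p (b i)) [0..<size P]) = P'}.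
       \<Prod>i<size P. substc n M (lst P ! i) ((\<lambda>i\<in>{0..<size P}. p (b i)) i))"
    unfolding PE by (rule sum_PiE_reindex[OF b])
  also have "\<dots> = (\<Sum>p\<in>?R. \<Prod>w\<in>verts G. substc n M (T w) (p w))"
  proof (rule sum.cong)
    have "mset (map (\<lambda>i\<in>{0..<size P}. p (b i)) [0..<size P]) = image_mset p (mset_set (verts G))" for p
    proof -
      have "mset (map (\<lambda>i\<in>{0..<size P}. p (b i)) [0..<size P]) = mset (map (\<lambda>i. p (b i)) [0..<size P])"
        by (rule arg_cong[of _ _ mset]) simp
      also have "\<dots> = image_mset p (mset_set (verts G))"
        using bij_betw_mset_set[OF _ b] by (simp add: multiset.map_comp o_def)
      finally show ?thesis .
    qed
    note eq = this
    show "{p \<in> Pi\<^sub>E (verts G) ?Y. mset (map (\<lambda>i\<in>{0..<size P}. p (b i)) [0..<size P]) = P'} = ?R"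
    proof (rule Collect_cong)
      fix p
      show "(p \<in> Pi\<^sub>E (verts G) ?Y \<and> mset (map (\<lambda>i\<in>{0..<size P}. p (b i)) [0..<size P]) = P') =
        (p \<in> Pi\<^sub>E (verts G) ?Y \<and> image_mset p (mset_set (verts G)) = P')"
        unfolding eq[of p] by (rule refl)
    qed
    fix p
    have "(\<Prod>i<size P. substc n M (lst P ! i) ((\<lambda>i\<in>{0..<size P}. p (b i)) i)) =
       (\<Prod>i\<in>{0..<size P}. substc n M (T (b i)) (p (b i)))"
      using bT by (intro prod.cong) auto
    also have "\<dots> = (\<Prod>w\<in>verts G. substc n M (T w) (p w))" by (rule prod.reindex_bij_betw[OF b])
    finally show "(\<Prod>i<size P. substc n M (lst P ! i) ((\<lambda>i\<in>{0..<size P}. p (b i)) i)) =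
      (\<Prod>w\<in>verts G. substc n M (T w) (p w))" .
  qed
  finally have "keycoef n M (gkey G t) k' =
    (\<Sum>p\<in>?R. substc n M (image_mset t (mset_set (exg G))) q' * (\<Prod>w\<in>verts G. substc n M (T w) (p w)))"
    by (simp add: keycoef_def fstk k' sum_distrib_left) (simp add: gkey_alt)
  also have "\<dots> = (\<Sum>p\<in>?R. \<Sum>s\<in>{s. s \<in> ?A \<and> r s = p}. \<Prod>x\<in>halves G. M (s x) (t x))"
  proof (rule sum.cong)
    fix p assume p: "p \<in> ?R"
    have rs: "r s = p \<longleftrightarrow> (\<forall>w\<in>verts G. image_mset s (mset_set (fib G w)) = p w)" for s
    proof
      assume "r s = p"
      then show "\<forall>w\<in>verts G. image_mset s (mset_set (fib G w)) = p w" unfolding r_def by force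
    next
      assume a: "\<forall>w\<in>verts G. image_mset s (mset_set (fib G w)) = p w"
      show "r s = p"
      proof
        fix w show "r s w = p w"
          using a p PiE_arb[of p "verts G" ?Y w] by (cases "w \<in> verts G") (simp_all add: r_def)
      qed
    qed
    have "gkey G s = k'" if "\<forall>w\<in>verts G. image_mset s (mset_set (fib G w)) = p w"
      "image_mset s (mset_set (exg G)) = q'" for s
    proof -
      have "image_mset (\<lambda>w. image_mset s (mset_set (fib G w))) (mset_set (verts G)) =
         image_mset p (mset_set (verts G))"
        by (rule image_mset_mset_set_cong) (use that in auto)
      then show ?thesis using p that by (simp add: gkey_alt k')
    qed
    moreover have "image_mset s (mset_set (exg G)) = q'" if "gkey G s = k'" for s
      using that by (simp add: gkey_alt k')
    ultimately have "{s. s \<in> ?A \<and> r s = p} =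
      {s \<in> halves G \<rightarrow>\<^sub>E {1..n}. (\<forall>w\<in>verts G. image_mset s (mset_set (fib G w)) = p w) \<and>
            image_mset s (mset_set (exg G)) = q'}"
      unfolding rs by blast
    then show "substc n M (image_mset t (mset_set (exg G))) q' * (\<Prod>w\<in>verts G. substc n M (T w) (p w)) =
      (\<Sum>s\<in>{s. s \<in> ?A \<and> r s = p}. \<Prod>x\<in>halves G. M (s x) (t x))"
      by (simp only: keycoef_fixed_monomials[OF assms] T_def)
  qed simp
  also have "\<dots> = (\<Sum>s\<in>?A. \<Prod>x\<in>halves G. M (s x) (t x))"
  proof (rule sum.group)
    show "finite ?A" by (rule finite_subset[OF _ finite_PiE[of "halves G" "\<lambda>_. {1..n}"]]) auto
    show "finite ?R"
      by (rule finite_subset[OF _ finite_PiE[of "verts G" ?Y]]) (auto simp: finite_monoms)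
    show "r ` ?A \<subseteq> ?R"
    proof (rule image_subsetI)
      fix s assume s: "s \<in> ?A"
      have "image_mset (r s) (mset_set (verts G)) = image_mset (\<lambda>w. image_mset s (mset_set (fib G w))) (mset_set (verts G))"
        by (rule image_mset_mset_set_cong) (auto simp: r_def)
      also have "\<dots> = P'" using s by (simp add: gkey_alt k')
      finally have 1: "image_mset (r s) (mset_set (verts G)) = P'" .
      have "s x \<in> {1..n}" if "x \<in> halves G" for x using s that by auto
      then have "r s \<in> Pi\<^sub>E (verts G) ?Y"
        by (auto simp: r_def monoms_def T_def fib_def)
      then show "r s \<in> ?R" using 1 by simp
    qed
  qed
  finally show ?thesis .
qed

subsection \<open>Invariance of the image\<close>

text \<open>\<open>orth\<close> says that the columns are orthonormal, whereas summing over edge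
  labels pairs rows. For square matrices a left inverse is a right inverse. \<open>Suc\<close>
  translates between indices starting at 1 and matrices starting at 0.\<close>

lemma orth_transpose:
  fixes M :: "nat \<Rightarrow> nat \<Rightarrow> 'k::field"
  assumes "orth n M" "i \<in> {1..n}" "j \<in> {1..n}"
  shows "(\<Sum>l=1..n. M i l * M j l) = (if i = j then 1 else 0)"
proof -
  define A where "A = mat n n (\<lambda>(i, j). M (Suc i) (Suc j))"
  define B where "B = mat n n (\<lambda>(i, j). M (Suc j) (Suc i))"
  have A: "A \<in> carrier_mat n n" and B: "B \<in> carrier_mat n n" by (auto simp: A_def B_def)
  have shift: "(\<Sum>l<n. f (Suc l)) = (\<Sum>l=1..n. f l)" for f :: "nat \<Rightarrow> 'k"
    by (rule sum.reindex_bij_witness[of _ "\<lambda>l. l - 1" Suc]) auto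
  have "B * A = 1\<^sub>m n"
  proof (rule eq_matI)
    fix i j assume "i < dim_row (1\<^sub>m n :: 'k mat)" "j < dim_col (1\<^sub>m n :: 'k mat)"
    then have ij: "i < n" "j < n" by auto
    have "(B * A) $$ (i, j) = (\<Sum>l<n. M (Suc l) (Suc i) * M (Suc l) (Suc j))"
      using ij by (simp add: A_def B_def scalar_prod_def atLeast0LessThan)
    also have "\<dots> = (\<Sum>l=1..n. M l (Suc i) * M l (Suc j))"
      by (rule shift)
    also have "\<dots> = (if i = j then 1 else 0)"
      using assms(1) ij by (simp add: orth_def)
    finally show "(B * A) $$ (i, j) = 1\<^sub>m n $$ (i, j)" using ij by simp
  qed (auto simp: A_def B_def)
  then have AB: "A * B = 1\<^sub>m n" by (rule mat_mult_left_right_inverse[OF B A])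
  have ij: "i - 1 < n" "j - 1 < n" "Suc (i - 1) = i" "Suc (j - 1) = j" using assms by auto
  have "(A * B) $$ (i - 1, j - 1) = (\<Sum>l<n. M i (Suc l) * M j (Suc l))"
    using ij by (simp add: A_def B_def scalar_prod_def atLeast0LessThan)
  also have "\<dots> = (\<Sum>l=1..n. M i l * M j l)" by (rule shift)
  finally show ?thesis using AB ij assms(2,3) by auto
qed

section \<open>Summation over edge labels\<close>

lemma prod_halves_pairing:
  fixes f :: "nat \<Rightarrow> 'a::comm_monoid_mult"
  assumes "pairing G e"
  shows "(\<Prod>x\<in>halves G. f x) = (\<Prod>x\<in>{x \<in> halves G. x < e x}. f x * f (e x))"
proof -
  let ?R = "{x \<in> halves G. x < e x}" and ?B = "{x \<in> halves G. e x < x}"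
  have b: "bij_betw e ?R ?B"
    by (rule bij_betw_byWitness[where f' = e]) (use assms in \<open>auto simp: pairing_def\<close>)
  have "halves G = ?R \<union> ?B" using assms unfolding pairing_def by fastforce
  moreover have "prod f (?R \<union> ?B) = prod f ?R * prod f ?B" by (intro prod.union_disjoint) auto
  moreover have "prod f ?B = (\<Prod>x\<in>?R. f (e x))" by (rule prod.reindex_bij_betw[OF b, symmetric])
  ultimately show ?thesis by (simp add: prod.distrib)
qed

text \<open>A labeling is a free choice of one label per edge; the smaller half-edge represents its
  edge.\<close>

lemma bij_betw_labelings:
  assumes "wf_graph G"
  shows "bij_betw (\<lambda>l. restrict l {x \<in> halves G. x < eg G x}) (labelings n G)
     ({x \<in> halves G. x < eg G x} \<rightarrow>\<^sub>E {1..n})"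
proof -
  let ?R = "{x \<in> halves G. x < eg G x}"
  have e: "eg G x \<in> halves G" "eg G (eg G x) = x" "eg G x \<noteq> x" if "x \<in> halves G" for x
    using assms that by (auto simp: wf_graph_iff pairing_def)
  have m: "min x (eg G x) \<in> ?R" if "x \<in> halves G" for x
    using e[OF that] that by (auto simp: min_def)
  let ?g = "\<lambda>u. \<lambda>x\<in>halves G. u (min x (eg G x))"
  show ?thesis
  proof (rule bij_betw_byWitness[where f' = ?g])
    show "\<forall>l\<in>labelings n G. ?g (restrict l ?R) = l"
    proof
      fix l assume l: "l \<in> labelings n G"
      show "?g (restrict l ?R) = l"
      proof
        fix x
        show "?g (restrict l ?R) x = l x"
        proof (cases "x \<in> halves G")
          case True
          have "l (min x (eg G x)) = l x" using l True by (auto simp: labelings_alt min_def)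
          then show ?thesis using m[OF True] True by simp
        next
          case False
          then show ?thesis using l PiE_arb[of l "halves G" "\<lambda>_. {1..n}" x] by (simp add: labelings_alt)
        qed
      qed
    qed
    show "\<forall>u\<in>?R \<rightarrow>\<^sub>E {1..n}. restrict (?g u) ?R = u"
    proof
      fix u assume u: "u \<in> ?R \<rightarrow>\<^sub>E {1..n}"
      show "restrict (?g u) ?R = u"
      proof
        fix x
        show "restrict (?g u) ?R x = u x"
        proof (cases "x \<in> ?R")
          case True
          then show ?thesis by (simp add: min_def)
        next
          case False
          then show ?thesis using PiE_arb[OF u False] by (simp only: restrict_apply if_False)
        qed
      qed
    qed
    show "(\<lambda>l. restrict l ?R) ` labelings n G \<subseteq> ?R \<rightarrow>\<^sub>E {1..n}"
    proof (rule image_subsetI)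
      fix l assume "l \<in> labelings n G"
      then have "l x \<in> {1..n}" if "x \<in> halves G" for x using that by (auto simp: labelings_alt)
      then show "restrict l ?R \<in> ?R \<rightarrow>\<^sub>E {1..n}" by auto
    qed
    show "?g ` (?R \<rightarrow>\<^sub>E {1..n}) \<subseteq> labelings n G"
    proof (rule image_subsetI)
      fix u assume u: "u \<in> ?R \<rightarrow>\<^sub>E {1..n}"
      have "?g u x \<in> {1..n}" if "x \<in> halves G" for x
        using PiE_mem[OF u m[OF that]] that by simp
      moreover have "?g u (eg G x) = ?g u x" if "x \<in> halves G" for x
        using e[OF that] that by (simp add: min.commute)
      ultimately show "?g u \<in> labelings n G" unfolding labelings_alt by auto
    qed
  qed
qed

text \<open>The sum splits into one factor per edge, the inner product of rows \<open>s x\<close>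
  and \<open>s (eg G x)\<close> of the matrix, hence a Kronecker delta. This is the invariance of
  the tensor placed on an edge.\<close>

lemma sum_labelings_orth:
  fixes M :: "nat \<Rightarrow> nat \<Rightarrow> 'k::field"
  assumes "wf_graph G" "orth n M" and s: "\<And>x. x \<in> halves G \<Longrightarrow> s x \<in> {1..n}"
  shows "(\<Sum>l\<in>labelings n G. \<Prod>x\<in>halves G. M (s x) (l x)) =
    (if \<forall>x\<in>halves G. s (eg G x) = s x then 1 else 0)"
proof -
  let ?R = "{x \<in> halves G. x < eg G x}"
  have pr: "pairing G (eg G)" using assms(1) by (simp add: wf_graph_iff)
  have e: "eg G x \<in> halves G" "eg G (eg G x) = x" "eg G x \<noteq> x" if "x \<in> halves G" for x
    using pr that by (auto simp: pairing_def)
  have "(\<Sum>l\<in>labelings n G. \<Prod>x\<in>halves G. M (s x) (l x)) =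
     (\<Sum>l\<in>labelings n G. \<Prod>x\<in>?R. M (s x) (restrict l ?R x) * M (s (eg G x)) (restrict l ?R x))"
  proof (rule sum.cong)
    fix l assume l: "l \<in> labelings n G"
    have "(\<Prod>x\<in>halves G. M (s x) (l x)) = (\<Prod>x\<in>?R. M (s x) (l x) * M (s (eg G x)) (l (eg G x)))"
      by (rule prod_halves_pairing[OF pr])
    also have "\<dots> = (\<Prod>x\<in>?R. M (s x) (restrict l ?R x) * M (s (eg G x)) (restrict l ?R x))"
      using l by (intro prod.cong) (auto simp: labelings_alt)
    finally show "(\<Prod>x\<in>halves G. M (s x) (l x)) =
      (\<Prod>x\<in>?R. M (s x) (restrict l ?R x) * M (s (eg G x)) (restrict l ?R x))" .
  qed simp
  also have "\<dots> = (\<Sum>u\<in>?R \<rightarrow>\<^sub>E {1..n}. \<Prod>x\<in>?R. M (s x) (u x) * M (s (eg G x)) (u x))"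
    by (rule sum.reindex_bij_betw[OF bij_betw_labelings[OF assms(1)]])
  also have "\<dots> = (\<Prod>x\<in>?R. \<Sum>j=1..n. M (s x) j * M (s (eg G x)) j)"
    by (rule prod_sum_PiE[symmetric]) auto
  also have "\<dots> = (\<Prod>x\<in>?R. if s x = s (eg G x) then 1 else 0)"
    using s e by (intro prod.cong refl orth_transpose[OF assms(2)]) auto
  also have "\<dots> = (if \<forall>x\<in>halves G. s (eg G x) = s x then 1 else 0)"
  proof (cases "\<forall>x\<in>halves G. s (eg G x) = s x")
    case False
    then obtain x where x: "x \<in> halves G" "s (eg G x) \<noteq> s x" by blast
    define y where "y = min x (eg G x)"
    have "y \<in> ?R" "s y \<noteq> s (eg G y)" using x e[OF x(1)] by (auto simp: y_def min_def)
    then have "(\<Prod>x\<in>?R. if s x = s (eg G x) then 1 else (0::'k)) = 0"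
      by (intro prod_zero) auto
    then show ?thesis using False by (simp only: if_False)
  qed (auto intro!: prod.neutral)
  finally show ?thesis .
qed

section \<open>Invariance and compatibility of the images of graphs\<close>

lemma finite_samedeg [simp]: "finite (samedeg n k')"
proof -
  let ?U = "\<Union>d\<in>set_mset (image_mset size (fst k')). monoms n d"
  let ?L = "{xs. set xs \<subseteq> ?U \<and> length xs = size (fst k')}"
  have "samedeg n k' \<subseteq> (mset ` ?L) \<times> monoms n (size (snd k'))"
  proof
    fix k assume k: "k \<in> samedeg n k'"
    obtain xs where xs: "mset xs = fst k" using ex_mset by blast
    have sz: "image_mset size (fst k) = image_mset size (fst k')" using k by (simp add: samedeg_def)
    have "m \<in> ?U" if "m \<in># fst k" for m
    proof -
      have "size m \<in># image_mset size (fst k')" using that sz[symmetric] by simp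
      moreover have "m \<in> monoms n (size m)" using k that by (auto simp: samedeg_def valid_key_def monoms_def)
      ultimately show ?thesis by blast
    qed
    then have "set xs \<subseteq> ?U" using xs by (metis set_mset_mset subsetI)
    moreover have "length xs = size (fst k')" using xs sz by (metis size_image_mset size_mset)
    ultimately have "fst k \<in> mset ` ?L" using xs by (intro image_eqI[of _ _ xs]) auto
    moreover have "snd k \<in> monoms n (size (snd k'))"
      using k by (simp add: samedeg_def valid_key_def monoms_def)
    ultimately show "k \<in> (mset ` ?L) \<times> monoms n (size (snd k'))" by (simp add: mem_Times_iff)
  qed
  moreover have "finite ?U" by (simp add: finite_monoms)
  then have "finite ?L" by (rule finite_lists_length_eq)
  ultimately show ?thesis by (auto intro: finite_subset simp: finite_monoms)
qed

lemma gkey_shape: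
  "image_mset size (fst (gkey G l)) = image_mset size (fst (gkey G l'))"
  "size (snd (gkey G l)) = size (snd (gkey G l'))"
  by (simp_all add: gkey_alt multiset.map_comp o_def)

lemma samedeg_kdeg: "k \<in> samedeg n k' \<Longrightarrow> kdeg k = kdeg k'"
  by (simp add: samedeg_def kdeg_def)

lemma labelings_range: "l \<in> labelings n G \<Longrightarrow> x \<in> halves G \<Longrightarrow> l x \<in> {1..n}"
  by (auto simp: labelings_alt)

text \<open>Acting on the image of \<open>G\<close> gives a double sum over labelings
  \<open>l\<close> and arbitrary relabelings \<open>s\<close> of half-edges with key
  \<open>k'\<close>. Summing over \<open>l\<close> first leaves 1 if \<open>s\<close> is constant on
  edges and 0 otherwise, so the labelings with key \<open>k'\<close> are counted again.\<close>

lemma Phin_invariant: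
  fixes M :: "nat \<Rightarrow> nat \<Rightarrow> 'k::field"
  assumes G: "wf_graph G" and M: "orth n M"
  shows "act n M (Phin n G) k' = Phin n G k'"
proof -
  have sG: "swf G" using G by (simp add: wf_graph_iff)
  let ?A = "{s \<in> halves G \<rightarrow>\<^sub>E {1..n}. gkey G s = k'}"
  let ?L = "labelings n G"
  have finA: "finite ?A" by (rule finite_subset[OF _ finite_PiE[of "halves G" "\<lambda>_. {1..n}"]]) auto
  have "act n M (Phin n G) k' = (\<Sum>k\<in>samedeg n k'. \<Sum>l\<in>{l. l \<in> ?L \<and> gkey G l = k}. keycoef n M (gkey G l) k')"
    unfolding act_def Phin_def by (intro sum.cong) auto
  also have "\<dots> = (\<Sum>k\<in>samedeg n k'. \<Sum>l\<in>{l. l \<in> {l \<in> ?L. gkey G l \<in> samedeg n k'} \<and> gkey G l = k}. keycoef n M (gkey G l) k')"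
    by (intro sum.cong) auto
  also have "\<dots> = (\<Sum>l\<in>{l \<in> ?L. gkey G l \<in> samedeg n k'}. keycoef n M (gkey G l) k')"
    by (rule sum.group) auto
  also have "\<dots> = (\<Sum>l\<in>?L. keycoef n M (gkey G l) k')"
  proof (rule sum.mono_neutral_left)
    show "\<forall>l\<in>?L - {l \<in> ?L. gkey G l \<in> samedeg n k'}. keycoef n M (gkey G l) k' = 0"
    proof
      fix l assume l: "l \<in> ?L - {l \<in> ?L. gkey G l \<in> samedeg n k'}"
      then have "valid_key n (gkey G l)" using labelings_range[of l n G] by (simp add: valid_key_gkey[OF sG])
      then have "gkey G s \<noteq> k'" for s
        using l gkey_shape[of G l s] by (auto simp: samedeg_def)
      then show "keycoef n M (gkey G l) k' = 0" unfolding keycoef_gkey[OF sG] by simp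
    qed
  qed auto
  also have "\<dots> = (\<Sum>l\<in>?L. \<Sum>s\<in>?A. \<Prod>x\<in>halves G. M (s x) (l x))"
    by (simp add: keycoef_gkey[OF sG])
  also have "\<dots> = (\<Sum>s\<in>?A. \<Sum>l\<in>?L. \<Prod>x\<in>halves G. M (s x) (l x))"
    by (rule sum.swap)
  also have "\<dots> = (\<Sum>s\<in>?A. if \<forall>x\<in>halves G. s (eg G x) = s x then 1 else 0)"
  proof (rule sum.cong)
    fix s assume "s \<in> ?A"
    then have "s x \<in> {1..n}" if "x \<in> halves G" for x using that by auto
    then show "(\<Sum>l\<in>?L. \<Prod>x\<in>halves G. M (s x) (l x)) = (if \<forall>x\<in>halves G. s (eg G x) = s x then 1 else 0)"
      by (rule sum_labelings_orth[OF G M])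
  qed simp
  also have "\<dots> = of_nat (card {s \<in> ?A. \<forall>x\<in>halves G. s (eg G x) = s x})"
    using finA by (simp add: sum.If_cases Int_def)
  also have "{s \<in> ?A. \<forall>x\<in>halves G. s (eg G x) = s x} = {l \<in> ?L. gkey G l = k'}"
    by (auto simp: labelings_alt)
  finally show ?thesis unfolding Phin_def[of n G k'] .
qed

lemma Phin_invalid: "wf_graph G \<Longrightarrow> \<not> valid_key n k \<Longrightarrow> Phin n G k = 0"
proof -
  assume G: "wf_graph G" and k: "\<not> valid_key n k"
  then have "gkey G l \<noteq> k" if "l \<in> labelings n G" for l
    using valid_key_gkey[of G n l] labelings_range[OF that] by (auto simp: wf_graph_iff)
  then have "{l \<in> labelings n G. gkey G l = k} = {}" by blast
  then show ?thesis unfolding Phin_def by (simp only: card.empty of_nat_0)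
qed

lemma Phin_valid:
  assumes "wf_graph G" "valid_key n k" "valid_key n' k"
  shows "Phin n G k = Phin n' G k"
proof -
  have sG: "swf G" using assms by (simp add: wf_graph_iff)
  have "l \<in> labelings m' G" if "l \<in> labelings m G" "gkey G l = k" "valid_key m' k" for l m m'
  proof -
    have "\<forall>x\<in>halves G. l x \<in> {1..m'}" using that valid_key_gkey[OF sG, of m' l] by simp
    moreover have "l \<in> extensional (halves G)" using that(1) by (auto simp: labelings_alt PiE_def)
    ultimately show ?thesis using that(1) by (auto simp: labelings_alt PiE_def)
  qed
  then have "{l \<in> labelings n G. gkey G l = k} = {l \<in> labelings n' G. gkey G l = k}"
    using assms by blast
  then show ?thesis unfolding Phin_def by (simp only:)
qed

lemma Phin_kdeg: "wf_graph G \<Longrightarrow> Phin n G k \<noteq> 0 \<Longrightarrow> hn G = kdeg k"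
proof -
  assume G: "wf_graph G" and k: "Phin n G k \<noteq> 0"
  then have "{l \<in> labelings n G. gkey G l = k} \<noteq> {}" unfolding Phin_def by (metis card.empty of_nat_0)
  then obtain l where "gkey G l = k" by blast
  then show ?thesis using kdeg_gkey[of G l] G by (auto simp: wf_graph_iff)
qed

text \<open>Invariance passes from graphs to their combinations because \<open>act\<close> mixes
  only keys of equal degree, so the same finite set of classes enters at every key involved.\<close>

lemma Phi_in_lsp:
  fixes a :: "graph \<Rightarrow> 'k::field"
  assumes "n \<ge> 1" shows "Phi a n \<in> lsp n"
proof -
  have "a (rep C) * Phin n (rep C) k = 0" if "\<not> valid_key n k" "C \<in> gclasses N" for k C N
    by (simp add: Phin_invalid[OF gclasses_rep(1)[OF that(2)] that(1)])
  then have "Phi a n \<in> amb n"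
    unfolding amb_def Phi_def by (auto intro!: sum.neutral simp del: mult_eq_0_iff)
  moreover have "act n M (Phi a n) = Phi a n" if M: "orth n M" for M
  proof
    fix k'
    let ?G = "gclasses (kdeg k' div 2)"
    have "act n M (Phi a n) k' = (\<Sum>k\<in>samedeg n k'. \<Sum>C\<in>?G. a (rep C) * (Phin n (rep C) k * keycoef n M k k'))"
      unfolding act_def using assms samedeg_kdeg[of _ n k']
      by (intro sum.cong) (auto simp: Phi_def sum_distrib_right mult.assoc)
    also have "\<dots> = (\<Sum>C\<in>?G. \<Sum>k\<in>samedeg n k'. a (rep C) * (Phin n (rep C) k * keycoef n M k k'))"
      by (rule sum.swap)
    also have "\<dots> = (\<Sum>C\<in>?G. a (rep C) * act n M (Phin n (rep C)) k')"
      by (simp add: act_def sum_distrib_left)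
    also have "\<dots> = Phi a n k'"
      using assms Phin_invariant[OF gclasses_rep(1) M] by (simp add: Phi_def)
    finally show "act n M (Phi a n) k' = Phi a n k'" .
  qed
  ultimately show ?thesis by (simp add: lsp_def)
qed

lemma valid_key_mono: "valid_key n k \<Longrightarrow> n \<le> n' \<Longrightarrow> valid_key n' k"
  by (fastforce simp: valid_key_iff)

lemma Phi_in_linf:
  fixes a :: "graph \<Rightarrow> 'k::field"
  shows "Phi a \<in> linf"
proof -
  have "restr n (Phi a (Suc n)) = Phi a n" if "n \<ge> 1" for n
  proof
    fix k
    show "restr n (Phi a (Suc n)) k = Phi a n k"
    proof (cases "valid_key n k")
      case True
      then have "valid_key (Suc n) k" by (rule valid_key_mono) simp
      then have "Phin (Suc n) (rep C) k = (Phin n (rep C) k :: 'k)" if "C \<in> gclasses N" for C N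
        using Phin_valid[OF gclasses_rep(1)[OF that]] True by blast
      then show ?thesis using True that by (simp add: restr_def Phi_def)
    next
      case False
      then show ?thesis using Phi_in_lsp[OF that, of a] by (cases k) (simp add: restr_def lsp_def amb_def)
    qed
  qed
  moreover have "Phi a 0 = (\<lambda>k. 0)" by (rule ext) (simp add: Phi_def)
  ultimately show ?thesis using Phi_in_lsp[of _ a] by (simp add: linf_def)
qed

subsection \<open>Invariants are determined by keys with doubled labels\<close>

lemma valid_key_realize:
  assumes "valid_key n k"
  obtains S t where "swf S" "gkey S t = k" "\<forall>x\<in>halves S. t x \<in> {1..n}"
proof -
  have "{#} \<notin># fst k" using assms by (simp add: valid_key_iff)
  then obtain S t where S: "swf S" "gkey S t = k" using gkey_realize by blast
  moreover have "\<forall>x\<in>halves S. t x \<in> {1..n}" using assms S valid_key_gkey[OF S(1), of n t] by simp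
  ultimately show ?thesis using that by blast
qed

lemma kflat_kmap: "kflat (kmap g k) = image_mset g (kflat k)"
proof -
  have "\<Sum>\<^sub># (image_mset (image_mset g) P) = image_mset g (\<Sum>\<^sub># P)" for P
    by (induction P) auto
  then show ?thesis by (simp add: kflat_def kmap_def)
qed

lemma kmap_id:
  assumes "\<And>x. x \<in># kflat k \<Longrightarrow> g x = x" shows "kmap g k = k"
proof -
  have "image_mset g m = m" if "set_mset m \<subseteq> set_mset (kflat k)" for m
    using that assms by (intro trans[OF image_mset_cong[of m g "\<lambda>x. x"]]) auto
  then have 1: "image_mset g m = m" if "m \<in># fst k" for m
    using that by (auto simp: kflat_def set_mset_Union_mset)
  have "image_mset g (snd k) = snd k"
    using assms by (intro trans[OF image_mset_cong[of "snd k" g "\<lambda>x. x"]]) (auto simp: kflat_def)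
  moreover have "image_mset (image_mset g) (fst k) = fst k"
    using 1 by (intro trans[OF image_mset_cong[of "fst k" "image_mset g" "\<lambda>x. x"]]) auto
  ultimately show ?thesis by (simp add: kmap_def)
qed

lemma kmap_comp: "kmap g (kmap h k) = kmap (\<lambda>x. g (h x)) k"
  by (simp add: kmap_def multiset.map_comp o_def)

text \<open>The expansion over relabelings collapses when each half-edge has only one useful label.
  The vanishing is required only for relabelings with key \<open>k\<close>, so nonzero entries
  leading to labels absent from \<open>k\<close> are permitted; rotations rely on this.\<close>

lemma keycoef_single:
  fixes M :: "nat \<Rightarrow> nat \<Rightarrow> 'k::comm_ring_1"
  assumes S: "swf S" and c: "\<And>x. x \<in> halves S \<Longrightarrow> c (t x) \<in> {1..n}"
    and M: "\<And>s x. gkey S s = k \<Longrightarrow> x \<in> halves S \<Longrightarrow> s x \<in> {1..n} \<Longrightarrow> s x \<noteq> c (t x) \<Longrightarrow> M (s x) (t x) = 0"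
  shows "keycoef n M (gkey S t) k =
    (if kmap c (gkey S t) = k then \<Prod>x\<in>halves S. M (c (t x)) (t x) else 0)"
proof -
  let ?A = "{s \<in> halves S \<rightarrow>\<^sub>E {1..n}. gkey S s = k}"
  define s0 where "s0 = (\<lambda>x\<in>halves S. c (t x))"
  have finA: "finite ?A" by (rule finite_subset[OF _ finite_PiE[of "halves S" "\<lambda>_. {1..n}"]]) auto
  have g0: "gkey S s0 = kmap c (gkey S t)"
    unfolding kmap_gkey by (rule gkey_cong[OF S]) (simp add: s0_def)
  have s0E: "s0 \<in> halves S \<rightarrow>\<^sub>E {1..n}" using c by (auto simp: s0_def)
  have z: "(\<Prod>x\<in>halves S. M (s x) (t x)) = 0" if s: "s \<in> ?A" "s \<noteq> s0" for s
  proof -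
    have "\<exists>x\<in>halves S. s x \<noteq> s0 x"
    proof (rule ccontr)
      assume "\<not> (\<exists>x\<in>halves S. s x \<noteq> s0 x)"
      then have "s = s0" using s(1) s0E by (intro PiE_ext[of s "halves S" _ s0]) auto
      then show False using s(2) by simp
    qed
    then obtain x where x: "x \<in> halves S" "s x \<noteq> c (t x)" by (auto simp: s0_def)
    have "s x \<in> {1..n}" "gkey S s = k" using s x by auto
    then have "M (s x) (t x) = 0" using M x by blast
    then show ?thesis using x by (intro prod_zero) auto
  qed
  have p0: "(\<Prod>x\<in>halves S. M (s0 x) (t x)) = (\<Prod>x\<in>halves S. M (c (t x)) (t x))"
    by (intro prod.cong) (auto simp: s0_def)
  show ?thesis
  proof (cases "kmap c (gkey S t) = k")
    case True
    then have "s0 \<in> ?A" using s0E g0 by simp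
    then have "(\<Sum>s\<in>?A. \<Prod>x\<in>halves S. M (s x) (t x)) = (\<Prod>x\<in>halves S. M (s0 x) (t x))"
      using z by (subst sum.remove[OF finA]) (auto intro!: sum.neutral)
    then show ?thesis using True p0 by (simp add: keycoef_gkey[OF S])
  next
    case False
    then have "s0 \<notin> ?A" using g0 by simp
    then have "(\<Sum>s\<in>?A. \<Prod>x\<in>halves S. M (s x) (t x)) = 0"
      using z by (intro sum.neutral) blast
    then show ?thesis using False by (simp add: keycoef_gkey[OF S])
  qed
qed

lemma lsp_act: "f \<in> lsp n \<Longrightarrow> orth n M \<Longrightarrow> f k' = (\<Sum>k\<in>samedeg n k'. f k * keycoef n M k k')"
proof -
  assume "f \<in> lsp n" "orth n M"
  then have "act n M f = f" by (simp add: lsp_def)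
  then have "f k' = act n M f k'" by (simp only:)
  then show ?thesis by (simp only: act_def)
qed

lemma samedeg_kmap: "valid_key n k \<Longrightarrow> k \<in> samedeg n (kmap g k)"
  by (simp add: samedeg_def kmap_def multiset.map_comp o_def)

text \<open>Permutation matrices are orthogonal, and each of their columns has a single nonzero
  entry, so \<open>keycoef_single\<close> leaves exactly one source key.\<close>

lemma lsp_permute:
  fixes f :: "key \<Rightarrow> 'k::comm_ring_1"
  assumes f: "f \<in> lsp n" and p: "bij_betw p {1..n} {1..n}" and k: "valid_key n k"
  shows "f (kmap p k) = f k"
proof -
  define M where "M a b = (if a = p b then 1 else (0 :: 'k))" for a b
  have pin: "p i \<in> {1..n}" if "i \<in> {1..n}" for i using bij_betw_apply[OF p that] .
  have "orth n M"
    unfolding orth_def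
  proof (intro ballI)
    fix i j assume ij: "i \<in> {1..n}" "j \<in> {1..n}"
    have "(\<Sum>l=1..n. M l i * M l j) = (\<Sum>l=1..n. if l = p i then M l j else 0)"
      by (intro sum.cong) (auto simp: M_def)
    also have "\<dots> = M (p i) j" using pin[OF ij(1)] by (simp add: sum.delta)
    also have "\<dots> = (if i = j then 1 else 0)"
      using inj_on_eq_iff[OF bij_betw_imp_inj_on[OF p] ij] by (simp add: M_def)
    finally show "(\<Sum>l=1..n. M l i * M l j) = (if i = j then 1 else 0)" .
  qed
  then have "f (kmap p k) = (\<Sum>k'\<in>samedeg n (kmap p k). f k' * keycoef n M k' (kmap p k))"
    by (rule lsp_act[OF f])
  also have "\<dots> = (\<Sum>k'\<in>samedeg n (kmap p k). if k' = k then f k' else 0)"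
  proof (rule sum.cong)
    fix k' assume "k' \<in> samedeg n (kmap p k)"
    then have v: "valid_key n k'" by (simp add: samedeg_def)
    then obtain S t where S: "swf S" "gkey S t = k'" "\<forall>x\<in>halves S. t x \<in> {1..n}"
      by (rule valid_key_realize)
    have "keycoef n M (gkey S t) (kmap p k) =
      (if kmap p (gkey S t) = kmap p k then \<Prod>x\<in>halves S. M (p (t x)) (t x) else 0)"
    proof (rule keycoef_single[OF S(1)])
      show "p (t x) \<in> {1..n}" if "x \<in> halves S" for x using pin S(3) that by blast
    qed (simp add: M_def)
    moreover have "kmap p k' = kmap p k \<longleftrightarrow> k' = k"
    proof
      assume e: "kmap p k' = kmap p k"
      let ?i = "inv_into {1..n} p"
      have "kmap ?i (kmap p k'') = k''" if "valid_key n k''" for k''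
        unfolding kmap_comp
      proof (rule kmap_id)
        fix x assume "x \<in># kflat k''"
        then have "x \<in> {1..n}" using that by (auto simp: valid_key_iff)
        then show "?i (p x) = x" by (rule inv_into_f_f[OF bij_betw_imp_inj_on[OF p]])
      qed
      note this[OF v] this[OF k]
      then show "k' = k" using e by simp
    qed simp
    ultimately show "f k' * keycoef n M k' (kmap p k) = (if k' = k then f k' else 0)"
      by (simp add: S(2) M_def)
  qed simp
  also have "\<dots> = f k" using samedeg_kmap[OF k] by (simp add: sum.delta)
  finally show ?thesis .
qed

section \<open>Rotations in a coordinate plane\<close>

definition collapse :: "nat \<Rightarrow> nat \<Rightarrow> nat \<Rightarrow> nat" where
  "collapse i j x = (if x = j then i else x)"

text \<open>Column \<open>b\<close> holds the image of the coordinate with index \<open>b\<close>: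
  the i-th goes to c times itself plus s times the j-th, the j-th to c times itself minus s times
  the i-th. Cosine and sine are mere field elements.\<close>

definition rotation :: "nat \<Rightarrow> nat \<Rightarrow> 'k \<Rightarrow> 'k \<Rightarrow> nat \<Rightarrow> nat \<Rightarrow> 'k::comm_ring_1" where
  "rotation i j c s a b =
    (if b = i then (if a = i then c else if a = j then s else 0)
     else if b = j then (if a = j then c else if a = i then - s else 0)
     else if a = b then 1 else 0)"

lemma orth_rotation:
  fixes c s :: "'k::comm_ring_1"
  assumes "i \<in> {1..n}" "j \<in> {1..n}" "i \<noteq> j" "c * c + s * s = 1"
  shows "orth n (rotation i j c s)"
  unfolding orth_def
proof (intro ballI)
  let ?M = "rotation i j c s"
  fix p q assume pq: "p \<in> {1..n}" "q \<in> {1..n}"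
  show "(\<Sum>l=1..n. ?M l p * ?M l q) = (if p = q then 1 else 0)"
  proof (cases "p = i \<or> p = j")
    case True
    have z: "?M l p * ?M l q = 0" if "l \<noteq> i" "l \<noteq> j" for l
      using True that by (elim disjE) (simp_all add: rotation_def)
    have "(\<Sum>l=1..n. ?M l p * ?M l q) = (\<Sum>l\<in>{i, j}. ?M l p * ?M l q)"
      by (intro sum.mono_neutral_right) (use assms z in auto)
    also have "\<dots> = ?M i p * ?M i q + ?M j p * ?M j q" using assms(3) by simp
    also have "\<dots> = (if p = q then 1 else 0)"
    proof -
      consider "q = i" | "q = j" | "q \<noteq> i" "q \<noteq> j" by blast
      then show ?thesis
        using True assms(3,4) by cases (elim disjE; simp add: rotation_def mult.commute add.commute)+
    qed
    finally show ?thesis .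
  next
    case False
    have z: "?M l p * ?M l q = 0" if "l \<noteq> p" for l
      using False that by (simp add: rotation_def)
    have "(\<Sum>l=1..n. ?M l p * ?M l q) = (\<Sum>l\<in>{p}. ?M l p * ?M l q)"
      by (intro sum.mono_neutral_right) (use pq z in auto)
    also have "\<dots> = (if p = q then 1 else 0)"
      using False by (simp add: rotation_def)
    finally show ?thesis .
  qed
qed

lemma prod_if_const:
  "finite A \<Longrightarrow> (\<Prod>x\<in>A. if P x then c else (1::'a::comm_monoid_mult)) = c ^ card {x \<in> A. P x}"
  by (simp add: prod.If_cases Int_def)

lemma count_image_mset_set:
  "finite A \<Longrightarrow> count (image_mset t (mset_set A)) y = card {x \<in> A. t x = y}"
  by (simp add: count_image_mset' eq_commute)

lemma count_collapse:
  assumes "i \<noteq> j" shows "count (image_mset (collapse i j) m) i = count m i + count m j"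
  using assms by (induction m) (auto simp: collapse_def)

text \<open>Since \<open>j\<close> is absent from the target, every half-edge labelled
  \<open>i\<close> or \<open>j\<close> must end with label \<open>i\<close>. The first kind
  contributes \<open>c\<close>, the second \<open>- s\<close>.\<close>

lemma keycoef_rotation:
  fixes c s :: "'k::comm_ring_1"
  assumes S: "swf S" and t: "\<And>x. x \<in> halves S \<Longrightarrow> t x \<in> {1..n}"
    and ij: "i \<in> {1..n}" "i \<noteq> j" and j: "j \<notin># kflat k"
  shows "keycoef n (rotation i j c s) (gkey S t) k =
    (if kmap (collapse i j) (gkey S t) = k
     then (- s) ^ count (kflat (gkey S t)) j * c ^ count (kflat (gkey S t)) i else 0)"
proof -
  let ?M = "rotation i j c s"
  have "keycoef n ?M (gkey S t) k = (if kmap (collapse i j) (gkey S t) = k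
     then \<Prod>x\<in>halves S. ?M (collapse i j (t x)) (t x) else 0)"
  proof (rule keycoef_single[OF S])
    show "collapse i j (t x) \<in> {1..n}" if "x \<in> halves S" for x
      using t[OF that] ij(1) by (simp add: collapse_def)
    fix u x assume u: "gkey S u = k" "x \<in> halves S" "u x \<noteq> collapse i j (t x)"
    have "u x \<in># kflat k" unfolding u(1)[symmetric] kflat_gkey[OF S] using u(2) by simp
    then have "u x \<noteq> j" using j by auto
    then show "?M (u x) (t x) = 0" using u(3) ij(2)
      by (cases "t x = j") (auto simp: rotation_def collapse_def)
  qed
  moreover have "(\<Prod>x\<in>halves S. ?M (collapse i j (t x)) (t x)) =
     (\<Prod>x\<in>halves S. (if t x = j then - s else 1) * (if t x = i then c else 1))"
    using ij(2) by (intro prod.cong) (simp_all add: rotation_def collapse_def)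
  moreover have "\<dots> = (- s) ^ count (kflat (gkey S t)) j * c ^ count (kflat (gkey S t)) i"
    by (simp add: prod.distrib prod_if_const kflat_gkey[OF S] count_image_mset_set)
  ultimately show ?thesis by (simp only:)
qed

lemma lsp_rotation:
  fixes f :: "key \<Rightarrow> 'k::comm_ring_1"
  assumes f: "f \<in> lsp n" and k: "valid_key n k"
    and ij: "i \<in> {1..n}" "j \<in> {1..n}" "i \<noteq> j" and j: "j \<notin># kflat k" and cs: "c * c + s * s = 1"
  shows "f k = (\<Sum>k'\<in>{k' \<in> samedeg n k. kmap (collapse i j) k' = k}.
     f k' * ((- s) ^ count (kflat k') j * c ^ (count (kflat k) i - count (kflat k') j)))"
proof -
  have "f k = (\<Sum>k'\<in>samedeg n k. f k' * keycoef n (rotation i j c s) k' k)"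
    by (rule lsp_act[OF f orth_rotation[OF ij cs]])
  also have "\<dots> = (\<Sum>k'\<in>samedeg n k. if kmap (collapse i j) k' = k then
     f k' * ((- s) ^ count (kflat k') j * c ^ (count (kflat k) i - count (kflat k') j)) else 0)"
  proof (rule sum.cong)
    fix k' assume "k' \<in> samedeg n k"
    then have "valid_key n k'" by (simp add: samedeg_def)
    then obtain S t where S: "swf S" "gkey S t = k'" "\<forall>x\<in>halves S. t x \<in> {1..n}"
      by (rule valid_key_realize)
    have "keycoef n (rotation i j c s) k' k = (if kmap (collapse i j) k' = k
       then (- s) ^ count (kflat k') j * c ^ count (kflat k') i else 0)"
      unfolding S(2)[symmetric] by (rule keycoef_rotation[OF S(1) bspec[OF S(3)] ij(1,3) j])
    \<comment> \<open>Each occurrence of \<open>i\<close> in \<open>k\<close> comes from an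
      \<open>i\<close> or a \<open>j\<close> in \<open>k'\<close>, so the subtraction is not
      truncated.\<close>
    moreover have "count (kflat k') i = count (kflat k) i - count (kflat k') j"
      if "kmap (collapse i j) k' = k"
      using count_collapse[OF ij(3), of "kflat k'"] kflat_kmap[of "collapse i j" k'] that by simp
    ultimately show "f k' * keycoef n (rotation i j c s) k' k = (if kmap (collapse i j) k' = k then
     f k' * ((- s) ^ count (kflat k') j * c ^ (count (kflat k) i - count (kflat k') j)) else 0)"
      by simp
  qed simp
  also have "\<dots> = (\<Sum>k'\<in>{k' \<in> samedeg n k. kmap (collapse i j) k' = k}.
     f k' * ((- s) ^ count (kflat k') j * c ^ (count (kflat k) i - count (kflat k') j)))"
    by (rule sum.inter_filter[symmetric]) simp
  finally show ?thesis .
qed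

lemma coeff_quadratic_power:
  fixes d :: "'k::comm_ring_1"
  shows "coeff ([:1, 0, d:] ^ m) 0 = 1" "coeff ([:1, 0, d:] ^ m) 1 = 0"
    "coeff ([:1, 0, d:] ^ m) 2 = of_nat m * d"
  by (induction m) (simp_all add: numeral_2_eq_2 algebra_simps)

text \<open>In a field containing a square root of -1 the denominator of the rational rotations can
  vanish. At natural numbers it is a positive integer, hence nonzero in characteristic zero.\<close>

lemma of_nat_square_plus_one_neq_0: "1 + of_nat u * of_nat u \<noteq> (0::'k::field_char_0)"
proof -
  have "(of_nat (1 + u * u) :: 'k) \<noteq> 0" by (subst of_nat_eq_0_iff) simp
  then show ?thesis by simp
qed

lemma poly_eq_0_of_nat:
  fixes p :: "'k::field_char_0 poly"
  assumes "\<And>u::nat. poly p (of_nat u) = 0" shows "p = 0"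
proof (rule ccontr)
  assume "p \<noteq> 0"
  then have "finite {x. poly p x = 0}" by (rule poly_roots_finite)
  moreover have "range (of_nat :: nat \<Rightarrow> 'k) \<subseteq> {x. poly p x = 0}" using assms by blast
  ultimately have "finite (range (of_nat :: nat \<Rightarrow> 'k))" by (rule finite_subset[rotated])
  then have "finite (UNIV :: nat set)" by (rule finite_imageD) (simp add: inj_on_def)
  then show False by simp
qed

text \<open>Comparing the coefficients of \<open>u\<^sup>2\<close> after applying the rational rotations with
\<open>cos = (1 - u\<^sup>2) / (1 + u\<^sup>2)\<close> and \<open>sin = 2 u / (1 + u\<^sup>2)\<close>.\<close>

lemma lsp_split_label:
  fixes f :: "key \<Rightarrow> 'k::field_char_0"
  assumes f: "f \<in> lsp n" and k: "valid_key n k"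
    and ij: "i \<in> {1..n}" "j \<in> {1..n}" "i \<noteq> j" and j: "j \<notin># kflat k"
  shows "of_nat (count (kflat k) i) * f k = 2 *
    (\<Sum>k'\<in>{k' \<in> samedeg n k. kmap (collapse i j) k' = k \<and> count (kflat k') j = 2}. f k')"
proof -
  define q where "q = count (kflat k) i"
  define K where "K = {k' \<in> samedeg n k. kmap (collapse i j) k' = k}"
  define r where "r k' = count (kflat k') j" for k'
  have finK: "finite K" by (simp add: K_def)
  have rq: "r k' \<le> q" if "k' \<in> K" for k'
    using count_collapse[OF ij(3), of "kflat k'"] kflat_kmap[of "collapse i j" k'] that
    by (simp add: K_def q_def r_def)
  \<comment> \<open>The invariance identity with denominators cleared by
    \<open>(1 + u\<^sup>2) ^ q\<close>; here \<open>r k'\<close> occurrences of \<open>i\<close>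
    have been moved to \<open>j\<close>, each giving a factor \<open>-2 u\<close>. It is checked at
    natural numbers \<open>u\<close>, which suffices for a polynomial identity.\<close>
  define p where "p = [:f k:] * [:1, 0, 1:] ^ q -
     (\<Sum>k'\<in>K. [:f k':] * (monom ((-2) ^ r k') (r k') * [:1, 0, -1:] ^ (q - r k')))"
  have "poly p (of_nat u) = 0" for u :: nat
  proof -
    define w where "w = (of_nat u :: 'k)"
    define D where "D = 1 + w * w"
    define c where "c = (1 - w * w) / D"
    define s where "s = 2 * w / D"
    have D: "D \<noteq> 0" using of_nat_square_plus_one_neq_0[of u] by (simp add: D_def w_def)
    have "c * c + s * s = ((1 - w * w) * (1 - w * w) + 2 * w * (2 * w)) / (D * D)"
      by (simp add: c_def s_def add_divide_distrib)
    also have "(1 - w * w) * (1 - w * w) + 2 * w * (2 * w) = D * D"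
      by (simp add: D_def algebra_simps)
    finally have cs: "c * c + s * s = 1" using D by simp
    have "f k = (\<Sum>k'\<in>K. f k' * ((- s) ^ r k' * c ^ (q - r k')))"
      unfolding K_def q_def r_def by (rule lsp_rotation[OF f k ij j cs])
    then have "D ^ q * f k = (\<Sum>k'\<in>K. D ^ q * (f k' * ((- s) ^ r k' * c ^ (q - r k'))))"
      by (simp only: sum_distrib_left)
    also have "\<dots> = (\<Sum>k'\<in>K. f k' * ((-2) ^ r k' * w ^ r k' * (1 - w * w) ^ (q - r k')))"
    proof (rule sum.cong)
      fix k' assume "k' \<in> K"
      then have "D ^ q = D ^ r k' * D ^ (q - r k')" using rq by (simp add: power_add[symmetric])
      then have "D ^ q * (f k' * ((- s) ^ r k' * c ^ (q - r k'))) =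
         f k' * ((D * (- s)) ^ r k' * (D * c) ^ (q - r k'))"
        by (simp only: power_mult_distrib mult_ac)
      also have "D * (- s) = (-2) * w" using D by (simp add: s_def)
      also have "D * c = 1 - w * w" using D by (simp add: c_def)
      finally show "D ^ q * (f k' * ((- s) ^ r k' * c ^ (q - r k'))) =
         f k' * ((-2) ^ r k' * w ^ r k' * (1 - w * w) ^ (q - r k'))"
        by (simp only: power_mult_distrib)
    qed simp
    finally show ?thesis
      by (simp add: p_def poly_sum poly_monom D_def w_def[symmetric] mult.commute)
  qed
  then have "p = 0" by (rule poly_eq_0_of_nat)
  define e where "e k' = coeff (monom ((-2 :: 'k) ^ r k') (r k') * [:1, 0, -1:] ^ (q - r k')) 2" for k' :: key
  have "coeff p 2 = f k * of_nat q - (\<Sum>k'\<in>K. f k' * e k')"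
    by (simp add: p_def coeff_sum coeff_quadratic_power e_def)
  then have main: "of_nat q * f k = (\<Sum>k'\<in>K. f k' * e k')" using \<open>p = 0\<close> by (simp add: mult.commute)
  \<comment> \<open>With no label moved, the quadratic term of \<open>(1 - u\<^sup>2) ^ q\<close>
    gives \<open>- q\<close>. One moved label gives an odd polynomial, two give
    \<open>(-2)\<^sup>2 = 4\<close>, and more start in degree above 2.\<close>
  have e: "e k' = (if r k' = 0 then - of_nat q else if r k' = 2 then 4 else (0::'k))" for k'
  proof -
    consider "r k' = 0" | "r k' = 1" | "r k' = 2" | "r k' > 2" by linarith
    then show ?thesis
      by cases (simp_all add: e_def coeff_monom_mult coeff_quadratic_power[simplified])
  qed
  have kK: "k \<in> K" and rk: "r k = 0"
  proof -
    show "r k = 0" using j by (simp add: r_def count_eq_zero_iff)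
    have "kmap (collapse i j) k = k" by (rule kmap_id) (use j in \<open>auto simp: collapse_def\<close>)
    then show "k \<in> K" using k by (simp add: K_def samedeg_def)
  qed
  have r0: "r k' = 0 \<longleftrightarrow> k' = k" if "k' \<in> K" for k'
  proof
    assume "r k' = 0"
    then have "j \<notin># kflat k'" by (simp add: r_def count_eq_zero_iff)
    then have "kmap (collapse i j) k' = k'" by (intro kmap_id) (auto simp: collapse_def)
    then show "k' = k" using that by (simp add: K_def)
  qed (use rk in simp)
  have "(\<Sum>k'\<in>K. f k' * e k') =
    (\<Sum>k'\<in>K. (if k' = k then - of_nat q * f k' else 0) + (if r k' = 2 then 4 * f k' else 0))"
  proof (rule sum.cong)
    fix k' assume "k' \<in> K"
    then show "f k' * e k' =
      (if k' = k then - of_nat q * f k' else 0) + (if r k' = 2 then 4 * f k' else 0)"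
      using r0[of k'] by (cases "k' = k") (simp_all add: e)
  qed simp
  also have "\<dots> = - of_nat q * f k + 4 * (\<Sum>k'\<in>{k' \<in> K. r k' = 2}. f k')"
    using finK kK by (simp add: sum.distrib sum.delta sum.inter_filter[symmetric] sum_distrib_left)
  \<comment> \<open>The summand of \<open>k\<close> itself, \<open>- q\<close> times
    \<open>f k\<close>, joins the left side, where \<open>(1 + u\<^sup>2) ^ q\<close> already
    contributes \<open>q\<close>; hence the 2 on the left against 4 on the right.\<close>
  finally have "2 * (of_nat q * f k) = 2 * (2 * (\<Sum>k'\<in>{k' \<in> K. r k' = 2}. f k'))"
    using main by (simp add: algebra_simps)
  then have "of_nat q * f k = 2 * (\<Sum>k'\<in>{k' \<in> K. r k' = 2}. f k')"
    by (subst (asm) mult_cancel_left) simp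
  moreover have "{k' \<in> K. r k' = 2} = {k' \<in> samedeg n k. kmap (collapse i j) k' = k \<and> count (kflat k') j = 2}"
    by (auto simp: K_def r_def)
  ultimately show ?thesis by (simp only: q_def)
qed

definition exact2 :: "key \<Rightarrow> bool" where
  "exact2 k \<longleftrightarrow> (\<forall>i. i \<in># kflat k \<longrightarrow> count (kflat k) i = 2)"

lemma linf_restr:
  assumes "F \<in> linf" "n \<ge> 1" "valid_key n k" shows "F (Suc n) k = F n k"
proof -
  have "restr n (F (Suc n)) = F n" using assms by (simp add: linf_def)
  then have "restr n (F (Suc n)) k = F n k" by (simp only:)
  then show ?thesis using assms(3) by (simp add: restr_def)
qed

text \<open>A label whose multiplicity is not 2 is split: two of its occurrences move to the fresh
  label \<open>Suc n\<close>, one level up. This raises the number of distinct labels, which is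
  bounded by the degree, so the induction ends. For multiplicity 1 the sum in
  \<open>lsp_split_label\<close> is empty and both values vanish. For multiplicity 2 all occurrences
  would move and no label would be gained, which is why such keys are the base case.\<close>

lemma linf_eq:
  fixes F F' :: "nat \<Rightarrow> key \<Rightarrow> 'k::field_char_0"
  assumes F: "F \<in> linf" and F': "F' \<in> linf"
    and eq: "\<And>n k. n \<ge> 1 \<Longrightarrow> valid_key n k \<Longrightarrow> exact2 k \<Longrightarrow> F n k = F' n k"
  shows "F = F'"
proof -
  have main: "F n k = F' n k" if "n \<ge> 1" "valid_key n k" for n k
    using that
  proof (induction "kdeg k - card (set_mset (kflat k))" arbitrary: n k rule: less_induct)
    case less
    show ?case
    proof (cases "exact2 k")
      case True
      then show ?thesis using eq less.prems by blast
    next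
      case False
      then obtain i where i: "i \<in># kflat k" "count (kflat k) i \<noteq> 2" by (auto simp: exact2_def)
      define j where "j = Suc n"
      have in1: "i \<in> {1..n}" using less.prems(2) i by (auto simp: valid_key_iff)
      have j: "j \<notin># kflat k" using less.prems(2) by (fastforce simp: valid_key_iff j_def)
      have ij: "i \<in> {1..Suc n}" "j \<in> {1..Suc n}" "i \<noteq> j" using in1 by (auto simp: j_def)
      have vk: "valid_key (Suc n) k" using less.prems(2) by (rule valid_key_mono) simp
      have lsp: "F (Suc n) \<in> lsp (Suc n)" "F' (Suc n) \<in> lsp (Suc n)"
        using F F' by (auto simp: linf_def)
      let ?K = "{k' \<in> samedeg (Suc n) k. kmap (collapse i j) k' = k \<and> count (kflat k') j = 2}"
      have "F (Suc n) k' = F' (Suc n) k'" if k': "k' \<in> ?K" for k'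
      proof -
        have fl: "kflat k = image_mset (collapse i j) (kflat k')"
          using k' kflat_kmap[of "collapse i j" k'] by simp
        have c: "count (kflat k) i = count (kflat k') i + 2"
          unfolding fl using count_collapse[OF ij(3), of "kflat k'"] k' by simp
        \<comment> \<open>Multiplicity different from 2 is used here: after two occurrences have
          moved to \<open>j\<close>, some \<open>i\<close> remains, so \<open>j\<close> is a genuine
          addition to the set of labels.\<close>
        then have ik': "i \<in># kflat k'" using i(2) by (intro count_inI) auto
        have jk': "j \<in># kflat k'" using k' by (intro count_inI) auto
        have sub: "insert j (set_mset (kflat k)) \<subseteq> set_mset (kflat k')"
          using ik' jk' by (auto simp: fl collapse_def)
        have "card (set_mset (kflat k)) < card (insert j (set_mset (kflat k)))" using j by simp
        also have "\<dots> \<le> card (set_mset (kflat k'))" by (rule card_mono[OF _ sub]) simp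
        finally have lt: "card (set_mset (kflat k)) < card (set_mset (kflat k'))" .
        have deg: "kdeg k' = kdeg k" using k' samedeg_kdeg[of k' "Suc n" k] by blast
        have "card (set_mset (kflat k')) \<le> kdeg k'"
          unfolding kdeg_kflat size_multiset_overloaded_eq
          using sum_mono[of "set_mset (kflat k')" "\<lambda>_. 1" "count (kflat k')"] by simp
        then have "kdeg k' - card (set_mset (kflat k')) < kdeg k - card (set_mset (kflat k))"
          using lt deg by linarith
        moreover have "valid_key (Suc n) k'" using k' by (simp add: samedeg_def)
        ultimately show ?thesis using less.hyps[of k' "Suc n"] by simp
      qed
      then have "sum (F (Suc n)) ?K = sum (F' (Suc n)) ?K" by (rule sum.cong[OF refl])
      then have "of_nat (count (kflat k) i) * F (Suc n) k = of_nat (count (kflat k) i) * F' (Suc n) k"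
        using lsp_split_label[OF lsp(1) vk ij j] lsp_split_label[OF lsp(2) vk ij j] by simp
      moreover have "(of_nat (count (kflat k) i) :: 'k) \<noteq> 0" using i(1) by simp
      ultimately have "F (Suc n) k = F' (Suc n) k" by (subst (asm) mult_cancel_left) blast
      then show ?thesis using linf_restr[OF F less.prems] linf_restr[OF F' less.prems] by simp
    qed
  qed
  have inv: "F'' n k = 0" if "F'' \<in> linf" "n \<ge> 1" "\<not> valid_key n k" for F'' :: "nat \<Rightarrow> key \<Rightarrow> 'k" and n k
    using that by (cases k) (simp add: linf_def lsp_def amb_def)
  show ?thesis
  proof (intro ext)
    fix n k
    show "F n k = F' n k"
    proof (cases "n \<ge> 1")
      case True
      then show ?thesis using main inv[OF F] inv[OF F'] by (cases "valid_key n k") auto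
    next
      case False
      then have "n = 0" by simp
      then show ?thesis using F F' by (simp add: linf_def)
    qed
  qed
qed

subsection \<open>Bijectivity\<close>

text \<open>\<open>l\<close> is constant on edges and separates different edges. Unlike in
  \<open>exact2\<close>, the pairing is part of the data.\<close>

definition exact :: "graph \<Rightarrow> (nat \<Rightarrow> nat) \<Rightarrow> bool" where
  "exact G l \<longleftrightarrow> (\<forall>x\<in>halves G. \<forall>y\<in>halves G. l x = l y \<longleftrightarrow> y = x \<or> y = eg G x)"

definition edge_label :: "graph \<Rightarrow> nat \<Rightarrow> nat" where
  "edge_label G x = Suc (min x (eg G x))"

lemma exact_edge_label:
  assumes "wf_graph G" shows "exact G (edge_label G)"
proof -
  have e: "eg G x \<in> halves G" "eg G (eg G x) = x" if "x \<in> halves G" for x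
    using assms that by (auto simp: wf_graph_iff pairing_def)
  have "y = x \<or> y = eg G x" if "x \<in> halves G" "y \<in> halves G" "min x (eg G x) = min y (eg G y)" for x y
  proof -
    have "x = y \<or> x = eg G y \<or> eg G x = y \<or> eg G x = eg G y" using that(3) by (metis min_def)
    then show ?thesis using e(2)[OF that(1)] e(2)[OF that(2)] by metis
  qed
  moreover have "min (eg G x) (eg G (eg G x)) = min x (eg G x)" if "x \<in> halves G" for x
    using e[OF that] by (simp add: min.commute)
  ultimately have "min x (eg G x) = min y (eg G y) \<longleftrightarrow> y = x \<or> y = eg G x"
    if "x \<in> halves G" "y \<in> halves G" for x y
    using that by metis
  then show ?thesis unfolding exact_def edge_label_def by simp
qed

text \<open>The labels are at most \<open>hn G\<close>; one more makes the level positive for the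
  empty graph too, since index 0 of a family in \<open>linf\<close> carries no information.\<close>

lemma edge_label_range: "wf_graph G \<Longrightarrow> x \<in> halves G \<Longrightarrow> edge_label G x \<in> {1..hn G + 1}"
  by (auto simp: edge_label_def halves_def)

lemma Pairings_exact:
  assumes G: "wf_graph G" and l: "exact G l"
  shows "Pairings G l = {restrict (eg G) (halves G)}"
proof -
  have e: "eg G x \<in> halves G" "eg G (eg G x) = x" "eg G x \<noteq> x" if "x \<in> halves G" for x
    using G that by (auto simp: wf_graph_iff pairing_def)
  have "restrict (eg G) (halves G) \<in> Pairings G l"
    using e l by (auto simp: Pairings_def pairing_def exact_def)
  moreover have "f = restrict (eg G) (halves G)" if f: "f \<in> Pairings G l" for f
  proof
    fix x show "f x = restrict (eg G) (halves G) x"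
    proof (cases "x \<in> halves G")
      case True
      then have "f x \<in> halves G" "f x \<noteq> x" "l x = l (f x)"
        using f by (auto simp: Pairings_def pairing_def)
      then have "f x = eg G x" using l True unfolding exact_def by blast
      then show ?thesis using True by simp
    next
      case False
      then show ?thesis using f PiE_arb[of f "halves G" "\<lambda>_. halves G" x] by (simp add: Pairings_def)
    qed
  qed
  ultimately show ?thesis by blast
qed

text \<open>Elements of \<open>Pairings\<close> are extensional, so the pairing recovered from
  labels is \<open>eg\<close> cut down to the half-edges. The identity map shows that this changes
  no isomorphism class.\<close>

lemma restrict_eg_giso:
  "wf_graph G \<Longrightarrow> iso_by G (G\<lparr>eg := restrict (eg G) (halves G)\<rparr>) (\<lambda>x. x)"
  unfolding iso_by_iff using siso_id[of G] by simp

lemma restrict_eg_wf: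
  "wf_graph G \<Longrightarrow> wf_graph (G\<lparr>eg := restrict (eg G) (halves G)\<rparr>)"
  by (auto simp: wf_graph_iff pairing_def)

lemma restrict_eg_Aut:
  assumes "wf_graph G" shows "Aut (G\<lparr>eg := restrict (eg G) (halves G)\<rparr>) = Aut G"
proof -
  have "iso_by (G\<lparr>eg := restrict (eg G) (halves G)\<rparr>) (G\<lparr>eg := restrict (eg G) (halves G)\<rparr>) s \<longleftrightarrow>
     iso_by G G s" for s
    using siso_mem[of G G s] by (auto simp: iso_by_iff)
  then show ?thesis by (simp add: Aut_alt)
qed

lemma Iop_restrict_eg:
  assumes "a \<in> Hhat" "wf_graph G"
  shows "Iop a (G\<lparr>eg := restrict (eg G) (halves G)\<rparr>) = Iop a G"
proof -
  have "giso G (G\<lparr>eg := restrict (eg G) (halves G)\<rparr>)"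
    using restrict_eg_giso[OF assms(2)] giso_def by blast
  then have "a (G\<lparr>eg := restrict (eg G) (halves G)\<rparr>) = a G"
    using Hhat_giso[OF assms(1) assms(2) restrict_eg_wf[OF assms(2)]] by simp
  then show ?thesis using restrict_eg_Aut[OF assms(2)] by (simp add: Iop_def)
qed

text \<open>Half-edges with equal labels already form the edges of \<open>G\<close>, so the Wick sum
  has one term and its value at \<open>a\<close> can be read off.\<close>

lemma Phi_wick_exact:
  fixes a :: "graph \<Rightarrow> 'k::comm_ring_1"
  assumes "wf_graph G" "a \<in> Hhat" "exact G l" "\<And>x. x \<in> halves G \<Longrightarrow> l x \<in> {1..n}" "n \<ge> 1"
  shows "of_nat (card (Stab G l)) * Phi a n (gkey G l) = of_nat (card (Aut G)) * a G"
proof -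
  have "swf G" using assms(1) by (simp add: wf_graph_iff)
  then have "of_nat (card (Stab G l)) * Phi a n (gkey G l) = (\<Sum>e\<in>Pairings G l. Iop a (G\<lparr>eg := e\<rparr>))"
    using assms by (intro Phi_wick) auto
  then show ?thesis using Iop_restrict_eg[OF assms(2,1)]
    by (simp add: Pairings_exact[OF assms(1,3)]) (simp add: Iop_def)
qed

lemma linf_valid:
  assumes "F \<in> linf" "1 \<le> n" "n \<le> n'" "valid_key n k" shows "F n' k = F n k"
  using assms(3)
proof (induction n' rule: dec_induct)
  case (step m)
  then show ?case using linf_restr[OF assms(1), of m k] valid_key_mono[OF assms(4), of m] assms(2) by simp
qed simp

lemma bij_betw_extend:
  assumes "finite X" "A \<subseteq> X" "B \<subseteq> X" "bij_betw p A B"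
  shows "\<exists>p'. bij_betw p' X X \<and> (\<forall>x\<in>A. p' x = p x)"
proof -
  have fin: "finite A" "finite B"
    using finite_subset[OF assms(2,1)] finite_subset[OF assms(3,1)] by auto
  have "card (X - A) = card (X - B)"
    using assms fin bij_betw_same_card[OF assms(4)] by (simp add: card_Diff_subset)
  then obtain q where q: "bij_betw q (X - A) (X - B)"
    using finite_same_card_bij[of "X - A" "X - B"] assms(1) by auto
  define p' where "p' x = (if x \<in> A then p x else q x)" for x
  have "bij_betw p' A B" using assms(4) by (subst bij_betw_cong[of A p' p]) (auto simp: p'_def)
  moreover have "bij_betw p' (X - A) (X - B)" using q by (subst bij_betw_cong[of "X - A" p' q]) (auto simp: p'_def)
  ultimately have "bij_betw p' (A \<union> (X - A)) (B \<union> (X - B))" by (rule bij_betw_combine) auto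
  moreover have "A \<union> (X - A) = X" "B \<union> (X - B) = X" using assms by auto
  ultimately have "bij_betw p' X X" by simp
  then show ?thesis by (intro exI[of _ p']) (simp add: p'_def)
qed

text \<open>Two edge-separating labelings of isomorphic graphs differ by a bijection between the
  labels in use. It extends to a permutation of all labels at a common level \<open>N\<close>, under
  which invariants do not change. So a family in \<open>linf\<close> assigns one value to each
  isomorphism class of graphs.\<close>

lemma linf_exact:
  fixes F :: "nat \<Rightarrow> key \<Rightarrow> 'k::comm_ring_1"
  assumes F: "F \<in> linf" and G: "wf_graph G" "wf_graph G'" and s: "iso_by G G' s"
    and l: "exact G l" "\<And>x. x \<in> halves G \<Longrightarrow> l x \<in> {1..n}" "n \<ge> 1"
    and l': "exact G' l'" "\<And>x. x \<in> halves G' \<Longrightarrow> l' x \<in> {1..n'}" "n' \<ge> 1"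
  shows "F n (gkey G l) = F n' (gkey G' l')"
proof -
  define N where "N = max n n'"
  define m where "m x = l' (s x)" for x
  have sG: "swf G" and sG': "swf G'" using G by (auto simp: wf_graph_iff)
  have si: "siso G G' s" and se: "\<And>x. x \<in> halves G \<Longrightarrow> s (eg G x) = eg G' (s x)"
    using s by (auto simp: iso_by_iff)
  have inj: "inj_on s (halves G)" using si by (simp add: siso_def bij_betw_def)
  have e: "eg G x \<in> halves G" if "x \<in> halves G" for x
    using G(1) that by (auto simp: wf_graph_iff pairing_def)
  have keym: "gkey G m = gkey G' l'" by (rule siso_imp_gkey_eq[OF si _ sG]) (simp add: m_def)
  have lm: "l x = l y \<longleftrightarrow> m x = m y" if xy: "x \<in> halves G" "y \<in> halves G" for x y
  proof -
    have "m x = m y \<longleftrightarrow> s y = s x \<or> s y = s (eg G x)"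
      using l'(1) siso_mem[OF si xy(1)] siso_mem[OF si xy(2)] se[OF xy(1)] by (simp add: exact_def m_def)
    also have "\<dots> \<longleftrightarrow> y = x \<or> y = eg G x"
      using inj_on_eq_iff[OF inj xy(2) xy(1)] inj_on_eq_iff[OF inj xy(2) e[OF xy(1)]] by simp
    finally show ?thesis using l(1) xy by (simp add: exact_def)
  qed
  \<comment> \<open>Well defined on the labels in use by \<open>lm\<close>: \<open>l\<close> and
    \<open>m\<close> identify the same half-edges, so any preimage under \<open>l\<close> will
    do.\<close>
  define p where "p z = m (inv_into (halves G) l z)" for z
  have pl: "p (l x) = m x" if "x \<in> halves G" for x
  proof -
    have "l x \<in> l ` halves G" using that by simp
    then have "inv_into (halves G) l (l x) \<in> halves G" "l (inv_into (halves G) l (l x)) = l x"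
      by (rule inv_into_into, rule f_inv_into_f)
    then show ?thesis using lm that by (simp add: p_def)
  qed
  have "inj_on p (l ` halves G)"
  proof (rule inj_onI)
    fix z w assume zw: "z \<in> l ` halves G" "w \<in> l ` halves G" "p z = p w"
    obtain x y where "x \<in> halves G" "z = l x" "y \<in> halves G" "w = l y" using zw(1,2) by blast
    then show "z = w" using zw(3) pl lm[of x y] by simp
  qed
  moreover have "p ` l ` halves G = m ` halves G"
    unfolding image_image by (rule image_cong) (simp_all add: pl)
  ultimately have b: "bij_betw p (l ` halves G) (m ` halves G)" by (simp add: bij_betw_def)
  have lN: "l x \<in> {1..N}" "m x \<in> {1..N}" if "x \<in> halves G" for x
    using l(2)[OF that] l'(2)[OF siso_mem[OF si that]] by (auto simp: N_def m_def)
  obtain p' where p': "bij_betw p' {1..N} {1..N}" "\<forall>z\<in>l ` halves G. p' z = p z"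
    using bij_betw_extend[OF _ _ _ b, of "{1..N}"] lN by blast
  have vl: "valid_key N (gkey G l)" "valid_key n (gkey G l)" "valid_key n' (gkey G' l')"
    using lN l l' by (simp_all only: valid_key_gkey[OF sG] valid_key_gkey[OF sG'] ball_simps) auto
  have "kmap p' (gkey G l) = gkey G m"
    unfolding kmap_gkey by (rule gkey_cong[OF sG]) (use p'(2) pl in auto)
  moreover have "F N \<in> lsp N" using F l(3) by (auto simp: linf_def N_def)
  ultimately have "F N (gkey G m) = F N (gkey G l)"
    using lsp_permute[OF _ p'(1) vl(1), of "F N"] by simp
  then show ?thesis
    using linf_valid[OF F l(3) _ vl(2), of N] linf_valid[OF F l'(3) _ vl(3), of N] keym
    by (simp add: N_def)
qed

text \<open>Any structure realising the key has exactly two half-edges per label; pairing them turns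
  it into a graph.\<close>

lemma exact2_realize:
  assumes "valid_key n k" "exact2 k"
  obtains G l where "wf_graph G" "exact G l" "gkey G l = k" "\<forall>x\<in>halves G. l x \<in> {1..n}"
proof -
  obtain S t where S: "swf S" "gkey S t = k" "\<forall>x\<in>halves S. t x \<in> {1..n}"
    using assms(1) by (rule valid_key_realize)
  have "\<exists>y. y \<noteq> x \<and> {z \<in> halves S. t z = t x} = {x, y}" if x: "x \<in> halves S" for x
  proof -
    have fl: "kflat k = image_mset t (mset_set (halves S))" using kflat_gkey[OF S(1), of t] S(2) by simp
    then have "t x \<in># kflat k" using x by simp
    then have "count (kflat k) (t x) = 2" using assms(2) by (simp add: exact2_def)
    then have "card {z \<in> halves S. t z = t x} = 2" by (simp add: fl count_image_mset_set)
    then obtain u v where uv: "{z \<in> halves S. t z = t x} = {u, v}" "u \<noteq> v" by (auto simp: card_2_iff)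
    have "x \<in> {z \<in> halves S. t z = t x}" using x by simp
    then have "x = u \<or> x = v" unfolding uv(1) by simp
    then show ?thesis using uv by (metis insert_commute)
  qed
  then obtain e where e: "\<And>x. x \<in> halves S \<Longrightarrow> e x \<noteq> x"
    "\<And>x. x \<in> halves S \<Longrightarrow> {z \<in> halves S. t z = t x} = {x, e x}" by metis
  have ex: "e x \<in> halves S" "t (e x) = t x" if "x \<in> halves S" for x
    using e(2)[OF that] by blast+
  have tt: "t z = t x \<longleftrightarrow> z = x \<or> z = e x" if "x \<in> halves S" "z \<in> halves S" for x z
    using e(2)[OF that(1)] that(2) by blast
  have "e (e x) = x" if x: "x \<in> halves S" for x
    using tt[OF ex(1)[OF x] x] ex(2)[OF x] e(1)[OF x] by auto
  then have "wf_graph (S\<lparr>eg := e\<rparr>)" using S(1) ex e(1) by (simp add: wf_graph_iff pairing_def)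
  moreover have "exact (S\<lparr>eg := e\<rparr>) t"
    unfolding exact_def
  proof (intro ballI)
    fix x y assume "x \<in> halves (S\<lparr>eg := e\<rparr>)" "y \<in> halves (S\<lparr>eg := e\<rparr>)"
    then show "t x = t y \<longleftrightarrow> y = x \<or> y = eg (S\<lparr>eg := e\<rparr>) x" using tt[of x y] by auto
  qed
  ultimately show ?thesis using S that[of "S\<lparr>eg := e\<rparr>" t] by simp
qed

text \<open>The basis vector of \<open>Hhat\<close> belonging to the class of \<open>G\<close>. Its
  image serves as normalisation in the construction of preimages.\<close>

definition gindicator :: "graph \<Rightarrow> graph \<Rightarrow> 'k::comm_ring_1" where
  "gindicator G H = (if wf_graph H \<and> giso G H then 1 else 0)"

lemma gindicator_Hhat: "gindicator G \<in> Hhat"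
proof -
  have "giso G H = giso G H'" if "wf_graph H" "wf_graph H'" "giso H H'" for H H'
    using that giso_trans giso_sym by blast
  then show ?thesis by (simp add: Hhat_def gindicator_def)
qed

text \<open>The key of a graph with its edges labelled apart yields |Aut| times the coefficient, and
  |Aut| is invertible in characteristic zero.\<close>

lemma inj_on_Phi: "inj_on (Phi :: (graph \<Rightarrow> 'k::field_char_0) \<Rightarrow> _) Hhat"
proof (rule inj_onI, rule ext)
  fix a b :: "graph \<Rightarrow> 'k" and G assume ab: "a \<in> Hhat" "b \<in> Hhat" "Phi a = Phi b"
  show "a G = b G"
  proof (cases "wf_graph G")
    case True
    note w = Phi_wick_exact[OF True _ exact_edge_label[OF True] edge_label_range[OF True]]
    have "(of_nat (card (Aut G)) :: 'k) * a G = of_nat (card (Aut G)) * b G"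
      using w[OF ab(1)] w[OF ab(2)] ab(3) by simp
    moreover have "(of_nat (card (Aut G)) :: 'k) \<noteq> 0" 
      using card_Aut_pos[OF True] by (metis less_irrefl of_nat_eq_0_iff)
    ultimately show ?thesis by (subst (asm) mult_cancel_left) blast
  next
    case False
    then show ?thesis using ab by (simp add: Hhat_def)
  qed
qed

text \<open>By \<open>Phi_wick_exact\<close> the denominator is |Aut| / |Stab|, the factor by which
  \<open>Phi\<close> scales the coefficient at this key. Written as a value of an element of
  \<open>linf\<close>, it is transported to other labelings by \<open>linf_exact\<close> just like
  the numerator. Hence \<open>Phi a\<close> and \<open>F\<close> agree at all keys with doubled
  labels, and \<open>linf_eq\<close> applies.\<close>

lemma surj_Phi:
  fixes F :: "nat \<Rightarrow> key \<Rightarrow> 'k::field_char_0"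
  assumes F: "F \<in> linf"
  shows "\<exists>a\<in>Hhat. Phi a = F"
proof -
  define v where "v G = F (hn G + 1) (gkey G (edge_label G)) /
    Phi (gindicator G) (hn G + 1) (gkey G (edge_label G))" for G
  \<comment> \<open>Evaluating at the chosen representative makes \<open>a\<close> constant on
    classes by construction.\<close>
  define a where "a G = (if wf_graph G then v (rep (gclass G)) else 0)" for G
  have a: "a \<in> Hhat"
  proof -
    have "gclass G = gclass G'" if "wf_graph G" "wf_graph G'" "giso G G'" for G G'
      using gclass_eq_iff that by blast
    then show ?thesis by (simp add: Hhat_def a_def)
  qed
  have "Phi a = F"
  proof (rule linf_eq[OF Phi_in_linf F])
    fix n k assume n: "1 \<le> n" and k: "valid_key n k" "exact2 k"
    obtain G l where G: "wf_graph G" "exact G l" "gkey G l = k" "\<forall>x\<in>halves G. l x \<in> {1..n}"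
      using k by (rule exact2_realize)
    define G0 where "G0 = rep (gclass G)"
    define I where "I = (gindicator G0 :: graph \<Rightarrow> 'k)"
    have I: "I \<in> Hhat" unfolding I_def by (rule gindicator_Hhat)
    have G0: "wf_graph G0" "giso G G0" using rep_gclass[OF G(1)] by (auto simp: G0_def)
    have IG: "I G = 1" using G(1) giso_sym[OF G0(2) G(1) G0(1)] by (simp add: I_def gindicator_def)
    have st: "(of_nat (card (Stab G l)) :: 'k) \<noteq> 0"
      using card_Stab_pos[of G l] G(1) unfolding wf_graph_iff by (metis less_irrefl of_nat_eq_0_iff)
    have au: "(of_nat (card (Aut G)) :: 'k) \<noteq> 0" 
      using card_Aut_pos[OF G(1)] by (metis less_irrefl of_nat_eq_0_iff)
    note w = Phi_wick_exact[OF G(1) _ G(2) bspec[OF G(4)] n, unfolded G(3)]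
    have wI: "of_nat (card (Stab G l)) * Phi I n k = of_nat (card (Aut G))" using w[OF I] IG by simp
    then have Inz: "Phi I n k \<noteq> 0" using au by auto
    have "of_nat (card (Stab G l)) * Phi a n k = of_nat (card (Stab G l)) * (Phi I n k * a G)"
      using w[OF a] wI by (simp add: mult.assoc[symmetric])
    then have "Phi a n k = Phi I n k * a G" using st by (subst (asm) mult_cancel_left) blast
    moreover have "a G = F n k / Phi I n k"
    proof -
      obtain s where s: "iso_by G G0 s" using G0(2) by (auto simp: giso_def)
      have tr: "F' n k = F' (hn G0 + 1) (gkey G0 (edge_label G0))" if "F' \<in> linf" for F' :: "nat \<Rightarrow> key \<Rightarrow> 'k"
        using linf_exact[OF that G(1) G0(1) s G(2) bspec[OF G(4)] n exact_edge_label[OF G0(1)]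
            edge_label_range[OF G0(1)]] G(3) by simp
      have "a G = v G0" using G(1) by (simp add: a_def G0_def)
      also have "\<dots> = F n k / Phi I n k"
        unfolding v_def tr[OF F] tr[OF Phi_in_linf] I_def ..
      finally show ?thesis .
    qed
    ultimately show "Phi a n k = F n k" using Inz by simp
  qed
  then show ?thesis using a by blast
qed

lemma bij_betw_Phi: "bij_betw (Phi :: (graph \<Rightarrow> 'k::field_char_0) \<Rightarrow> _) Hhat linf"
proof (rule bij_betw_imageI[OF inj_on_Phi])
  show "Phi ` Hhat = (linf :: (nat \<Rightarrow> key \<Rightarrow> 'k) set)"
  proof
    show "(linf :: (nat \<Rightarrow> key \<Rightarrow> 'k) set) \<subseteq> Phi ` Hhat"
    proof
      fix F :: "nat \<Rightarrow> key \<Rightarrow> 'k" assume "F \<in> linf"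
      then show "F \<in> Phi ` Hhat" using surj_Phi[of F] by auto
    qed
  qed (auto simp: Phi_in_linf)
qed

subsection \<open>Product, unit and counit\<close>

lemma Phi_add: "Phi (\<lambda>G. a G + b G) = (\<lambda>n k. Phi a n k + Phi b n k)"
  by (intro ext) (simp add: Phi_def sum.distrib distrib_right)

lemma Phi_scale: "Phi (\<lambda>G. c * a G) = (\<lambda>n k. c * Phi a n k)"
  by (intro ext) (simp add: Phi_def sum_distrib_left mult.assoc)

section \<open>Unit and counit\<close>

lemma wf_empty_graph: "wf_graph empty_graph"
  by (simp add: wf_graph_def empty_graph_def)

lemma gkey_hn_0:
  assumes "swf G" "hn G = 0" shows "gkey G l = ({#}, {#})"
proof -
  have "halves G = {}" using assms by (simp add: halves_def)
  then have "verts G = {}" "exg G = {}" using assms by (auto simp: verts_def swf_def)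
  then show ?thesis by (simp add: gkey_alt)
qed

lemma gclasses_0: "gclasses 0 = {gclass empty_graph}"
proof -
  have "giso empty_graph G" if "wf_graph G" "hn G = 0" for G
  proof -
    have "halves G = {}" "halves empty_graph = {}" using that by (auto simp: halves_def empty_graph_def)
    moreover have "exg G = {}" "exg empty_graph = {}"
      using that by (auto simp: wf_graph_def empty_graph_def)
    ultimately have "iso_by empty_graph G id" by (auto simp: iso_by_iff siso_def bij_betw_def)
    then show ?thesis by (auto simp: giso_def)
  qed
  then have "gclass G = gclass empty_graph" if "wf_graph G" "hn G = 0" for G
    using gclass_eq_iff[OF wf_empty_graph that(1)] that by simp
  then have "gclasses 0 \<subseteq> {gclass empty_graph}" by (auto simp: gclasses_def)
  moreover have "gclass empty_graph \<in> gclasses 0"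
    by (rule gclass_in_gclasses[OF wf_empty_graph]) (simp add: empty_graph_def)
  ultimately show ?thesis by blast
qed

lemma Phin_hn_0:
  assumes "wf_graph G" "hn G = 0" shows "Phin n G k = (if k = ({#}, {#}) then 1 else 0)"
proof -
  have "halves G = {}" using assms by (simp add: halves_def)
  then have "labelings n G = {\<lambda>x. undefined}" by (simp add: labelings_alt)
  moreover have "gkey G l = ({#}, {#})" for l using assms gkey_hn_0 by (simp add: wf_graph_iff)
  ultimately show ?thesis by (auto simp: Phin_def)
qed

lemma rep_empty_class:
  "wf_graph (rep (gclass empty_graph))" "hn (rep (gclass empty_graph)) = 0"
  using gclasses_rep[of "gclass empty_graph" 0] by (simp_all add: gclasses_0)

lemma Phi_H_unit: "Phi (H_unit :: graph \<Rightarrow> 'k::comm_ring_1) = l_unit"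
proof (intro ext)
  fix n k
  show "Phi H_unit n k = (l_unit n k :: 'k)"
  proof (cases "k = ({#}, {#})")
    case True
    then show ?thesis
      by (simp add: Phi_def l_unit_def kdeg_def gclasses_0 H_unit_def rep_empty_class Phin_hn_0)
  next
    case False
    have "H_unit (rep C) * Phin n (rep C) k = (0::'k)" if "C \<in> gclasses N" for C N
      by (cases "hn (rep C) = 0") (simp_all add: H_unit_def Phin_hn_0 gclasses_rep(1)[OF that] False)
    then have "(\<Sum>C\<in>gclasses (kdeg k div 2). H_unit (rep C) * Phin n (rep C) k) = (0::'k)"
      by (intro sum.neutral) blast
    then show ?thesis using False by (simp add: Phi_def l_unit_def)
  qed
qed

lemma l_counit_Phi: "a \<in> Hhat \<Longrightarrow> l_counit (Phi a) = H_counit a"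
  using Hhat_giso[of a empty_graph "rep (gclass empty_graph)"] wf_empty_graph
    rep_gclass[OF wf_empty_graph]
  by (simp add: l_counit_def Phi_def kdeg_def gclasses_0 rep_empty_class Phin_hn_0 H_counit_def)

text \<open>Instead of transporting labelings, both counts are multiplied by |Stab| and become
  counts of isomorphisms from the same graphs \<open>S\<close> with a pairing, which by
  \<open>card_isos\<close> do not distinguish \<open>G\<close> from \<open>G'\<close>.\<close>

lemma Phin_giso:
  assumes "wf_graph G" "wf_graph G'" "giso G G'"
  shows "Phin n G k = Phin n G' k"
proof (cases "valid_key n k")
  case True
  then obtain S t where S: "swf S" "gkey S t = k" "\<forall>x\<in>halves S. t x \<in> {1..n}"
    by (rule valid_key_realize)
  let ?c = "\<lambda>G. card {l \<in> labelings n G. gkey G l = gkey S t}"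
  have dc: "?c H * card (Stab S t) =
    (\<Sum>e\<in>Pairings S t. card {s \<in> halves S \<rightarrow>\<^sub>E halves H. iso_by (S\<lparr>eg := e\<rparr>) H s})"
    if "wf_graph H" for H
    by (rule labelings_double_count[OF S(1) that]) (use S(3) in blast)
  have "?c G * card (Stab S t) = ?c G' * card (Stab S t)"
    unfolding dc[OF assms(1)] dc[OF assms(2)]
  proof (rule sum.cong[OF refl])
    fix e assume e: "e \<in> Pairings S t"
    note wf = wf_graph_Pairings[OF S(1) e]
    have "giso (S\<lparr>eg := e\<rparr>) G \<longleftrightarrow> giso (S\<lparr>eg := e\<rparr>) G'"
      using giso_trans[OF _ assms(3)] giso_trans[OF _ giso_sym[OF assms(3,1,2)]] by blast
    then show "card {s \<in> halves S \<rightarrow>\<^sub>E halves G. iso_by (S\<lparr>eg := e\<rparr>) G s} =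
       card {s \<in> halves S \<rightarrow>\<^sub>E halves G'. iso_by (S\<lparr>eg := e\<rparr>) G' s}"
      using card_isos[OF wf assms(1)] card_isos[OF wf assms(2)] by simp
  qed
  then have "?c G = ?c G'" using card_Stab_pos[OF S(1), of t] unfolding mult_cancel2 by linarith
  then show ?thesis unfolding Phin_def S(2) by (simp only:)
next
  case False
  then show ?thesis by (simp add: Phin_invalid[OF assms(1)] Phin_invalid[OF assms(2)])
qed

section \<open>Labelings of disjoint unions and the product\<close>

lemma pairing_gunion:
  assumes "pairing G1 (eg G1)" "pairing G2 (eg G2)"
  shows "pairing (gunion G1 G2) (eg (gunion G1 G2))"
  unfolding pairing_def
proof
  fix x assume "x \<in> halves (gunion G1 G2)"
  then consider "x \<in> halves G1" | y where "y \<in> halves G2" "x = y + hn G1"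
    by (auto simp: halves_gunion)
  then show "eg (gunion G1 G2) x \<in> halves (gunion G1 G2) \<and>
    eg (gunion G1 G2) (eg (gunion G1 G2) x) = x \<and> eg (gunion G1 G2) x \<noteq> x"
  proof cases
    case 1
    then have "eg G1 x \<in> halves G1" "eg G1 (eg G1 x) = x" "eg G1 x \<noteq> x"
      using assms(1) by (auto simp: pairing_def)
    then show ?thesis using 1 by (simp add: eg_gunion halves_lt)
  next
    case 2
    then have "eg G2 y \<in> halves G2" "eg G2 (eg G2 y) = y" "eg G2 y \<noteq> y"
      using assms(2) by (auto simp: pairing_def)
    then show ?thesis using 2 by (simp add: eg_gunion halves_lt)
  qed
qed

lemma wf_gunion: "wf_graph G1 \<Longrightarrow> wf_graph G2 \<Longrightarrow> wf_graph (gunion G1 G2)"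
  by (simp add: wf_graph_iff swf_gunion pairing_gunion)

lemma PiE_gunion_eqI:
  assumes "f \<in> extensional (halves (gunion G1 G2))" "g \<in> extensional (halves (gunion G1 G2))"
    "\<And>x. x \<in> halves G1 \<Longrightarrow> f x = g x" "\<And>x. x \<in> halves G2 \<Longrightarrow> f (x + hn G1) = g (x + hn G1)"
  shows "f = g"
  by (rule extensionalityI[OF assms(1,2)]) (use assms(3,4) in \<open>auto simp: halves_gunion\<close>)

lemma bij_betw_labelings_gunion:
  assumes "wf_graph G1" "wf_graph G2"
  shows "bij_betw (\<lambda>(l1, l2). \<lambda>x\<in>halves (gunion G1 G2). glue (hn G1) l1 l2 x)
    (labelings n G1 \<times> labelings n G2) (labelings n (gunion G1 G2))"
proof (rule bij_betw_byWitness[where f' = "\<lambda>l. (restrict l (halves G1), \<lambda>x\<in>halves G2. l (x + hn G1))"])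
  let ?h = "hn G1" and ?U = "gunion G1 G2"
  let ?f = "\<lambda>(l1, l2). \<lambda>x\<in>halves ?U. glue ?h l1 l2 x"
  let ?g = "\<lambda>l. (restrict l (halves G1), \<lambda>x\<in>halves G2. l (x + ?h))"
  have in1: "x \<in> halves ?U" if "x \<in> halves G1" for x using that by (simp add: halves_gunion)
  have in2: "x + ?h \<in> halves ?U" if "x \<in> halves G2" for x using that by (simp add: halves_gunion)
  have e1: "eg G1 x \<in> halves G1" if "x \<in> halves G1" for x
    using assms(1) that by (simp add: wf_graph_iff pairing_def)
  have e2: "eg G2 x \<in> halves G2" if "x \<in> halves G2" for x
    using assms(2) that by (simp add: wf_graph_iff pairing_def)
  have f1: "?f (l1, l2) x = l1 x" if "x \<in> halves G1" for l1 l2 x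
    using in1[OF that] that by (simp add: halves_lt)
  have f2: "?f (l1, l2) (x + ?h) = l2 x" if "x \<in> halves G2" for l1 l2 x
    using in2[OF that] by simp
  have U: "x \<in> halves G1 \<or> (\<exists>y\<in>halves G2. x = y + ?h)" if "x \<in> halves ?U" for x
    using that by (auto simp: halves_gunion)
  have "?g (?f (l1, l2)) = (l1, l2)" if l: "l1 \<in> labelings n G1" "l2 \<in> labelings n G2" for l1 l2
  proof -
    have ext: "l1 \<in> extensional (halves G1)" "l2 \<in> extensional (halves G2)"
      using l by (auto simp: labelings_alt PiE_def)
    have "restrict (?f (l1, l2)) (halves G1) = l1"
      by (rule extensionalityI[OF restrict_extensional ext(1)]) (simp only: restrict_apply' f1)
    moreover have "(\<lambda>x\<in>halves G2. ?f (l1, l2) (x + ?h)) = l2"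
      by (rule extensionalityI[OF restrict_extensional ext(2)]) (simp only: restrict_apply' f2)
    ultimately show ?thesis by (simp only:)
  qed
  then show "\<forall>p\<in>labelings n G1 \<times> labelings n G2. ?g (?f p) = p" by (intro Sigma_ballI)
  show "\<forall>l\<in>labelings n ?U. ?f (?g l) = l"
  proof
    fix l assume l: "l \<in> labelings n ?U"
    then have ext: "l \<in> extensional (halves ?U)" by (auto simp: labelings_alt PiE_def)
    show "?f (?g l) = l"
    proof (rule PiE_gunion_eqI[OF _ ext])
      show "?f (?g l) \<in> extensional (halves ?U)" by simp
      show "?f (?g l) x = l x" if "x \<in> halves G1" for x
        unfolding f1[OF that] using that by simp
      show "?f (?g l) (x + ?h) = l (x + ?h)" if "x \<in> halves G2" for x
        unfolding f2[OF that] using that by simp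
    qed
  qed
  have "?f (l1, l2) \<in> labelings n ?U" if l: "l1 \<in> labelings n G1" "l2 \<in> labelings n G2" for l1 l2
  proof -
    define f where "f = ?f (l1, l2)"
    have f1': "f x = l1 x" if "x \<in> halves G1" for x unfolding f_def by (rule f1[OF that])
    have f2': "f (x + ?h) = l2 x" if "x \<in> halves G2" for x unfolding f_def by (rule f2[OF that])
    have "f x \<in> {1..n} \<and> f (eg ?U x) = f x" if "x \<in> halves ?U" for x
      using U[OF that]
    proof
      assume x: "x \<in> halves G1"
      then have "eg ?U x = eg G1 x" by (simp add: eg_gunion halves_lt)
      then show ?thesis using f1'[OF x] f1'[OF e1[OF x]] l(1) x labelings_range[OF l(1) x]
        by (simp add: labelings_alt)
    next
      assume "\<exists>y\<in>halves G2. x = y + ?h"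
      then obtain y where y: "y \<in> halves G2" "x = y + ?h" by blast
      then have "eg ?U x = eg G2 y + ?h" by (simp add: eg_gunion)
      then show ?thesis using f2'[OF y(1)] f2'[OF e2[OF y(1)]] l(2) y labelings_range[OF l(2) y(1)]
        by (simp add: labelings_alt)
    qed
    moreover have "f \<in> extensional (halves ?U)" by (simp add: f_def)
    ultimately have "f \<in> labelings n ?U" by (simp add: labelings_alt PiE_def Pi_def)
    then show ?thesis by (simp only: f_def)
  qed
  then show "?f ` (labelings n G1 \<times> labelings n G2) \<subseteq> labelings n ?U"
    unfolding image_subset_iff by (intro Sigma_ballI)
  show "?g ` labelings n ?U \<subseteq> labelings n G1 \<times> labelings n G2"
  proof (rule image_subsetI)
    fix l assume l: "l \<in> labelings n ?U"
    have le: "l (eg ?U x) = l x" "l x \<in> {1..n}" if "x \<in> halves ?U" for x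
      using l that labelings_range[OF l that] by (auto simp: labelings_alt)
    have "l (eg G1 x) = l x" if "x \<in> halves G1" for x
      using le(1)[OF in1[OF that]] that by (simp add: eg_gunion halves_lt)
    then have 1: "restrict l (halves G1) \<in> labelings n G1"
      using le(2)[OF in1] e1 by (auto simp: labelings_alt)
    have "l (eg G2 x + ?h) = l (x + ?h)" if "x \<in> halves G2" for x
      using le(1)[OF in2[OF that]] by (simp add: eg_gunion)
    then have 2: "(\<lambda>x\<in>halves G2. l (x + ?h)) \<in> labelings n G2"
      using le(2)[OF in2] e2 by (auto simp: labelings_alt)
    show "?g l \<in> labelings n G1 \<times> labelings n G2" using 1 2 by blast
  qed
qed

lemma finite_submultisets: "finite {P1. P1 \<subseteq># P}"
proof (induction P)
  case (add x P)
  have "{P1. P1 \<subseteq># add_mset x P} \<subseteq> {P1. P1 \<subseteq># P} \<union> add_mset x ` {P1. P1 \<subseteq># P}"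
  proof
    fix Q assume "Q \<in> {P1. P1 \<subseteq># add_mset x P}"
    then have Q: "Q \<subseteq># add_mset x P" by simp
    show "Q \<in> {P1. P1 \<subseteq># P} \<union> add_mset x ` {P1. P1 \<subseteq># P}"
    proof (cases "x \<in># Q")
      case True
      then obtain Q' where Q': "Q = add_mset x Q'" by (metis insert_DiffM)
      then show ?thesis using Q by simp
    next
      case False
      then have "Q \<subseteq># P" using Q
        by (metis add_mset_remove_trivial diff_single_trivial subset_eq_diff_conv add_mset_add_single)
      then show ?thesis by simp
    qed
  qed
  then show ?case by (rule finite_subset) (use add in simp)
qed simp

definition subkeys :: "key \<Rightarrow> key set" where
  "subkeys k = {P1. P1 \<subseteq># fst k} \<times> {q1. q1 \<subseteq># snd k}"

definition kdiff :: "key \<Rightarrow> key \<Rightarrow> key" where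
  "kdiff k k1 = (fst k - fst k1, snd k - snd k1)"

lemma finite_subkeys [simp]: "finite (subkeys k)"
  by (simp add: subkeys_def finite_submultisets)

lemma kadd_eq_iff: "kadd k1 k2 = k \<longleftrightarrow> k1 \<in> subkeys k \<and> k2 = kdiff k k1"
  by (cases k; cases k1; cases k2) (auto simp: kadd_def subkeys_def kdiff_def)

lemma mult_amb_alt: "mult_amb f g k = (\<Sum>k1\<in>subkeys k. f k1 * g (kdiff k k1))"
  unfolding mult_amb_def subkeys_def kdiff_def sum.cartesian_product
  by (intro sum.cong) auto

lemma bij_betw_filter:
  assumes f: "bij_betw f A B" and PQ: "\<And>x. x \<in> A \<Longrightarrow> P x \<longleftrightarrow> Q (f x)"
  shows "bij_betw f {x \<in> A. P x} {y \<in> B. Q y}"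
proof (rule bij_betw_imageI)
  show "inj_on f {x \<in> A. P x}" by (rule inj_on_subset[OF bij_betw_imp_inj_on[OF f]]) blast
  show "f ` {x \<in> A. P x} = {y \<in> B. Q y}"
    unfolding bij_betw_imp_surj_on[OF f, symmetric] using PQ by blast
qed

text \<open>A labeling of the union is a pair of labelings, and its key is the product of the two
  basis elements. Sorting the pairs by the first key gives the convolution in
  \<open>mult_amb\<close>.\<close>

lemma Phin_gunion:
  assumes "wf_graph G1" "wf_graph G2"
  shows "(Phin n (gunion G1 G2) k :: 'k::comm_ring_1) =
    (\<Sum>k1\<in>subkeys k. Phin n G1 k1 * Phin n G2 (kdiff k k1))"
proof -
  let ?U = "gunion G1 G2"
  let ?f = "\<lambda>(l1, l2). \<lambda>x\<in>halves ?U. glue (hn G1) l1 l2 x"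
  let ?L = "\<lambda>G k. {l \<in> labelings n G. gkey G l = k}"
  let ?Z = "{p \<in> labelings n G1 \<times> labelings n G2. kadd (gkey G1 (fst p)) (gkey G2 (snd p)) = k}"
  have s: "swf G1" "swf G2" using assms by (auto simp: wf_graph_iff)
  have key: "gkey ?U (?f p) = kadd (gkey G1 (fst p)) (gkey G2 (snd p))" for p
  proof -
    have "gkey ?U (?f p) = gkey ?U (glue (hn G1) (fst p) (snd p))"
      by (rule gkey_cong[OF swf_gunion[OF s]]) (simp add: case_prod_unfold)
    then show ?thesis using gkey_gunion_glue[OF s] by simp
  qed
  have b: "bij_betw ?f (labelings n G1 \<times> labelings n G2) (labelings n ?U)"
    by (rule bij_betw_labelings_gunion[OF assms])
  have "bij_betw ?f ?Z (?L ?U k)"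
    by (rule bij_betw_filter[OF b]) (simp only: key)
  then have "card (?L ?U k) = card ?Z" by (rule bij_betw_same_card[symmetric])
  also have "?Z = (\<Union>k1\<in>subkeys k. ?L G1 k1 \<times> ?L G2 (kdiff k k1))"
    unfolding kadd_eq_iff by auto
  also have "card \<dots> = (\<Sum>k1\<in>subkeys k. card (?L G1 k1 \<times> ?L G2 (kdiff k k1)))"
    by (rule card_UN_disjoint) auto
  finally have "card (?L ?U k) = (\<Sum>k1\<in>subkeys k. card (?L G1 k1) * card (?L G2 (kdiff k k1)))"
    by (simp only: card_cartesian_product)
  then show ?thesis by (simp add: Phin_def)
qed

lemma Phin_hn:
  assumes "wf_graph G" "Phin n G k \<noteq> 0" shows "hn G = 2 * (kdeg k div 2)" "hn G = kdeg k"
proof -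
  show "hn G = kdeg k" using Phin_kdeg[OF assms] .
  then show "hn G = 2 * (kdeg k div 2)"
    using pairing_even[of G "eg G"] assms(1) by (simp add: wf_graph_iff)
qed

text \<open>A graph has nonzero coefficient only at keys of its own degree, so the sum may run over
  any larger set of classes. This gives sums for different keys a common range.\<close>

lemma Phi_upto:
  assumes "n \<ge> 1" "2 * (kdeg k div 2) \<le> H"
  shows "Phi a n k = (\<Sum>C\<in>gclasses_upto H. a (rep C) * (Phin n (rep C) k :: 'k::comm_ring_1))"
proof -
  have "a (rep C) * (Phin n (rep C) k :: 'k) = 0"
    if C: "C \<in> gclasses_upto H - gclasses (kdeg k div 2)" for C
  proof (rule ccontr)
    assume "a (rep C) * (Phin n (rep C) k :: 'k) \<noteq> 0"
    then have "(Phin n (rep C) k :: 'k) \<noteq> 0" by auto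
    then have "hn (rep C) = 2 * (kdeg k div 2)" using Phin_hn(1) gclasses_upto_rep(1) C by blast
    then have "gclass (rep C) \<in> gclasses (kdeg k div 2)"
      using gclass_in_gclasses gclasses_upto_rep(1) C by blast
    then show False using C gclasses_upto_rep(2)[of C H] by auto
  qed
  then have "(\<Sum>C\<in>gclasses (kdeg k div 2). a (rep C) * (Phin n (rep C) k :: 'k)) =
     (\<Sum>C\<in>gclasses_upto H. a (rep C) * Phin n (rep C) k)"
    by (intro sum.mono_neutral_left) (use gclasses_subset_upto[OF assms(2)] in auto)
  then show ?thesis using assms(1) by (simp add: Phi_def)
qed

lemma sum_gclasses_Phin:
  assumes "wf_graph G"
  shows "(\<Sum>C\<in>gclasses (kdeg k div 2). if giso G (rep C) then Phin n (rep C) k else 0) =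
    (Phin n G k :: 'k::comm_ring_1)"
proof (cases "hn G = 2 * (kdeg k div 2)")
  case True
  show ?thesis
    unfolding sum_gclasses_giso[OF assms True]
    using Phin_giso[OF assms rep_gclass(1,2)[OF assms]] by metis
next
  case False
  then have "(Phin n G k :: 'k) = 0" using Phin_hn(1)[OF assms] by blast
  moreover have "\<not> giso G (rep C)" if "C \<in> gclasses (kdeg k div 2)" for C
    using False gclasses_rep(3)[OF that] giso_hn[of G "rep C"] by auto
  ultimately show ?thesis by simp
qed

lemma subkeys_kdeg:
  assumes "k1 \<in> subkeys k" shows "kdeg k1 \<le> kdeg k" "kdeg (kdiff k k1) \<le> kdeg k"
proof -
  have "kadd k1 (kdiff k k1) = k" using assms kadd_eq_iff by blast
  moreover have "kdeg (kadd k1 k2) = kdeg k1 + kdeg k2" for k2 by (simp add: kadd_def kdeg_def)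
  ultimately have "kdeg k = kdeg k1 + kdeg (kdiff k k1)" by metis
  then show "kdeg k1 \<le> kdeg k" "kdeg (kdiff k k1) \<le> kdeg k" by auto
qed

lemma Phi_hunion:
  fixes a b :: "graph \<Rightarrow> 'k::comm_ring_1"
  shows "Phi (hunion a b) = mu (Phi a) (Phi b)"
proof (intro ext)
  fix n k
  show "Phi (hunion a b) n k = mu (Phi a) (Phi b) n k"
  proof (cases "n \<ge> 1")
    case False
    then show ?thesis by (simp add: Phi_def mu_def mult_amb_def)
  next
    case True
    let ?D = "kdeg k div 2"
    \<comment> \<open>All graphs in \<open>gclasses ?D\<close> have \<open>2 * ?D\<close>
      half-edges, so this is the range used by \<open>hunion\<close> at each of them. An odd degree
      is rounded down.\<close>
    let ?U = "gclasses_upto (2 * ?D)"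
    let ?g = "\<lambda>C1 C2. gunion (rep C1) (rep C2)"
    have "Phi (hunion a b) n k = (\<Sum>C\<in>gclasses ?D. (\<Sum>C1\<in>?U. \<Sum>C2\<in>?U.
        if giso (?g C1 C2) (rep C) then a (rep C1) * b (rep C2) else 0) * Phin n (rep C) k)"
      using True gclasses_rep by (simp add: Phi_def hunion_def)
    also have "\<dots> = (\<Sum>C\<in>gclasses ?D. \<Sum>C1\<in>?U. \<Sum>C2\<in>?U.
        a (rep C1) * b (rep C2) * (if giso (?g C1 C2) (rep C) then Phin n (rep C) k else 0))"
      unfolding sum_distrib_right by (intro sum.cong refl) simp
    also have "\<dots> = (\<Sum>C1\<in>?U. \<Sum>C\<in>gclasses ?D. \<Sum>C2\<in>?U.
        a (rep C1) * b (rep C2) * (if giso (?g C1 C2) (rep C) then Phin n (rep C) k else 0))"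
      by (rule sum.swap)
    also have "\<dots> = (\<Sum>C1\<in>?U. \<Sum>C2\<in>?U. \<Sum>C\<in>gclasses ?D.
        a (rep C1) * b (rep C2) * (if giso (?g C1 C2) (rep C) then Phin n (rep C) k else 0))"
      by (intro sum.cong refl sum.swap)
    also have "\<dots> = (\<Sum>C1\<in>?U. \<Sum>C2\<in>?U. a (rep C1) * b (rep C2) * Phin n (?g C1 C2) k)"
    proof (intro sum.cong refl)
      fix C1 C2 assume C: "C1 \<in> ?U" "C2 \<in> ?U"
      have "wf_graph (?g C1 C2)" using wf_gunion gclasses_upto_rep(1) C by blast
      then show "(\<Sum>C\<in>gclasses ?D.
        a (rep C1) * b (rep C2) * (if giso (?g C1 C2) (rep C) then Phin n (rep C) k else 0)) =
        a (rep C1) * b (rep C2) * Phin n (?g C1 C2) k"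
        unfolding sum_distrib_left[symmetric] by (subst sum_gclasses_Phin) simp_all
    qed
    also have "\<dots> = (\<Sum>C1\<in>?U. \<Sum>C2\<in>?U. \<Sum>k1\<in>subkeys k.
       (a (rep C1) * Phin n (rep C1) k1) * (b (rep C2) * Phin n (rep C2) (kdiff k k1)))"
    proof (intro sum.cong refl)
      fix C1 C2 assume C: "C1 \<in> ?U" "C2 \<in> ?U"
      show "a (rep C1) * b (rep C2) * Phin n (?g C1 C2) k = (\<Sum>k1\<in>subkeys k.
       (a (rep C1) * Phin n (rep C1) k1) * (b (rep C2) * Phin n (rep C2) (kdiff k k1)))"
        unfolding Phin_gunion[OF gclasses_upto_rep(1)[OF C(1)] gclasses_upto_rep(1)[OF C(2)]]
          sum_distrib_left by (intro sum.cong refl) (simp only: mult_ac)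
    qed
    also have "\<dots> = (\<Sum>C1\<in>?U. \<Sum>k1\<in>subkeys k. \<Sum>C2\<in>?U.
       (a (rep C1) * Phin n (rep C1) k1) * (b (rep C2) * Phin n (rep C2) (kdiff k k1)))"
      by (intro sum.cong refl sum.swap)
    also have "\<dots> = (\<Sum>k1\<in>subkeys k. \<Sum>C1\<in>?U. \<Sum>C2\<in>?U.
       (a (rep C1) * Phin n (rep C1) k1) * (b (rep C2) * Phin n (rep C2) (kdiff k k1)))"
      by (rule sum.swap)
    also have "\<dots> = (\<Sum>k1\<in>subkeys k. Phi a n k1 * Phi b n (kdiff k k1))"
    proof (intro sum.cong refl)
      fix k1 assume k1: "k1 \<in> subkeys k"
      \<comment> \<open>Both parts of a splitting of \<open>k\<close> have at most its degree, so
        the common range reduces to the range in each \<open>Phi\<close>.\<close>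
      have "2 * (kdeg k1 div 2) \<le> 2 * ?D" "2 * (kdeg (kdiff k k1) div 2) \<le> 2 * ?D"
        using subkeys_kdeg[OF k1] by (auto intro: div_le_mono)
      then show "(\<Sum>C1\<in>?U. \<Sum>C2\<in>?U.
       (a (rep C1) * Phin n (rep C1) k1) * (b (rep C2) * Phin n (rep C2) (kdiff k k1))) =
       Phi a n k1 * Phi b n (kdiff k k1)"
        by (simp only: Phi_upto[OF True] sum_product)
    qed
    finally show ?thesis by (simp add: mu_def mult_amb_alt)
  qed
qed

subsection \<open>Coproduct\<close>

lemma shift_union_eq_iff:
  fixes A A' B B' :: "nat set"
  assumes "A \<subseteq> {..<h}" "A' \<subseteq> {..<h}"
  shows "A \<union> (\<lambda>x. x + h) ` B = A' \<union> (\<lambda>x. x + h) ` B' \<longleftrightarrow> A = A' \<and> B = B'"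
proof
  assume e: "A \<union> (\<lambda>x. x + h) ` B = A' \<union> (\<lambda>x. x + h) ` B'"
  have l: "{x \<in> A \<union> (\<lambda>x. x + h) ` B. x < h} = A" "{x \<in> A' \<union> (\<lambda>x. x + h) ` B'. x < h} = A'"
    using assms by auto
  have r: "{x. x + h \<in> A \<union> (\<lambda>x. x + h) ` B} = B" "{x. x + h \<in> A' \<union> (\<lambda>x. x + h) ` B'} = B'"
    using assms by auto
  show "A = A' \<and> B = B'" using l r unfolding e by simp
qed simp

text \<open>Maps between disjoint unions that respect the summands. The first summands have equal
  size, so the second parts are shifted alike. The resulting equivalence both builds isomorphisms of
  unions and splits stabilizers.\<close>

locale glued_map =
  fixes G1 G2 G1' G2' :: graph and f f1 f2 :: "nat \<Rightarrow> nat"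
  assumes swf: "swf G1" "swf G2" "swf G1'" "swf G2'"
    and h: "hn G1' = hn G1"
    and f1: "\<And>x. x \<in> halves G1 \<Longrightarrow> f1 x \<in> halves G1'" "\<And>x. x \<in> halves G1 \<Longrightarrow> f x = f1 x"
    and f2: "\<And>x. x \<in> halves G2 \<Longrightarrow> f2 x \<in> halves G2'" "\<And>x. x \<in> halves G2 \<Longrightarrow> f (x + hn G1) = f2 x + hn G1"
begin

lemma f_image:
  assumes "A \<subseteq> halves G1" "B \<subseteq> halves G2"
  shows "f ` (A \<union> (\<lambda>x. x + hn G1) ` B) = f1 ` A \<union> (\<lambda>x. x + hn G1) ` f2 ` B"
proof -
  have "f ` A = f1 ` A" by (rule image_cong) (use assms f1(2) in auto)
  moreover have "f ` (\<lambda>x. x + hn G1) ` B = (\<lambda>x. x + hn G1) ` f2 ` B"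
    unfolding image_image by (rule image_cong) (use assms f2(2) in auto)
  ultimately show ?thesis by (simp add: image_Un)
qed

lemma f_inj: "inj_on f (halves (gunion G1 G2)) \<longleftrightarrow> inj_on f1 (halves G1) \<and> inj_on f2 (halves G2)"
proof
  assume i: "inj_on f (halves (gunion G1 G2))"
  have "x = y" if "x \<in> halves G1" "y \<in> halves G1" "f1 x = f1 y" for x y
    using inj_onD[OF i, of x y] that f1(2) by (simp add: halves_gunion)
  moreover have "x = y" if "x \<in> halves G2" "y \<in> halves G2" "f2 x = f2 y" for x y
    using inj_onD[OF i, of "x + hn G1" "y + hn G1"] that f2(2) by (simp add: halves_gunion)
  ultimately show "inj_on f1 (halves G1) \<and> inj_on f2 (halves G2)" by (simp add: inj_on_def)
next
  assume i: "inj_on f1 (halves G1) \<and> inj_on f2 (halves G2)"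
  have lt: "f1 x < hn G1" if "x \<in> halves G1" for x using f1(1)[OF that] h by (simp add: halves_lt)
  show "inj_on f (halves (gunion G1 G2))"
    unfolding halves_gunion
  proof (rule inj_onI)
    fix x y
    assume "x \<in> halves G1 \<union> (\<lambda>x. x + hn G1) ` halves G2" "y \<in> halves G1 \<union> (\<lambda>x. x + hn G1) ` halves G2"
      and e: "f x = f y"
    then consider "x \<in> halves G1" "y \<in> halves G1"
      | x' y' where "x' \<in> halves G2" "y' \<in> halves G2" "x = x' + hn G1" "y = y' + hn G1"
      | y' where "x \<in> halves G1" "y' \<in> halves G2" "y = y' + hn G1"
      | x' where "y \<in> halves G1" "x' \<in> halves G2" "x = x' + hn G1"
      by blast
    then show "x = y"
    proof cases
      case 1
      then show ?thesis using i e f1(2) by (simp add: inj_on_def)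
    next
      case 2
      then have "f2 x' = f2 y'" using e f2(2) by simp
      then show ?thesis using 2 i by (simp add: inj_on_def)
    next
      case 3
      then show ?thesis using e f1(2) f2(2) lt[OF 3(1)] by simp
    next
      case 4
      then show ?thesis using e f1(2) f2(2) lt[OF 4(1)] by simp
    qed
  qed
qed

text \<open>Vertex names from different summands differ in parity before and after the map, so mixed
  pairs impose no condition.\<close>

lemma f_vg:
  "(\<forall>x\<in>halves (gunion G1 G2). \<forall>y\<in>halves (gunion G1 G2).
      vg (gunion G1 G2) x = vg (gunion G1 G2) y \<longleftrightarrow> vg (gunion G1' G2') (f x) = vg (gunion G1' G2') (f y)) \<longleftrightarrow>
   (\<forall>x\<in>halves G1. \<forall>y\<in>halves G1. vg G1 x = vg G1 y \<longleftrightarrow> vg G1' (f1 x) = vg G1' (f1 y)) \<and>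
   (\<forall>x\<in>halves G2. \<forall>y\<in>halves G2. vg G2 x = vg G2 y \<longleftrightarrow> vg G2' (f2 x) = vg G2' (f2 y))"
proof -
  have v1: "vg (gunion G1 G2) x = 2 * vg G1 x" "vg (gunion G1' G2') (f x) = 2 * vg G1' (f1 x)"
    if "x \<in> halves G1" for x
    using f1[OF that] that vg_gunion(1)[of "f1 x" G1' G2'] vg_gunion(1)[of x G1 G2] by (simp_all add: halves_lt)
  have v2: "vg (gunion G1 G2) (x + hn G1) = 2 * vg G2 x + 1"
    "vg (gunion G1' G2') (f (x + hn G1)) = 2 * vg G2' (f2 x) + 1"
    if "x \<in> halves G2" for x
    using f2[OF that] that vg_gunion(2)[of G1' G2' "f2 x"] vg_gunion(2)[of G1 G2 x] by (simp_all add: h)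
  show ?thesis
    by (simp add: halves_gunion ball_Un v1 v2 cong: ball_cong)
qed

lemma siso_gunion_iff: "siso (gunion G1 G2) (gunion G1' G2') f \<longleftrightarrow> siso G1 G1' f1 \<and> siso G2 G2' f2"
proof -
  have sub: "exg G1 \<subseteq> halves G1" "exg G2 \<subseteq> halves G2" "exg G1' \<subseteq> halves G1'" using swf by (auto simp: swf_def)
  have lt: "A \<subseteq> halves G1 \<Longrightarrow> f1 ` A \<subseteq> {..<hn G1}" for A using f1(1) h by (auto simp: halves_lt)
  have lt': "A \<subseteq> halves G1' \<Longrightarrow> A \<subseteq> {..<hn G1}" for A using h by (auto simp: halves_lt)
  have im: "f ` halves (gunion G1 G2) = halves (gunion G1' G2') \<longleftrightarrow>
      f1 ` halves G1 = halves G1' \<and> f2 ` halves G2 = halves G2'"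
    unfolding halves_gunion f_image[OF subset_refl subset_refl] h
    by (rule shift_union_eq_iff[OF lt lt']) simp_all
  have ex: "f ` exg (gunion G1 G2) = exg (gunion G1' G2') \<longleftrightarrow>
      f1 ` exg G1 = exg G1' \<and> f2 ` exg G2 = exg G2'"
    unfolding exg_gunion f_image[OF sub(1,2)] h
    by (rule shift_union_eq_iff[OF lt[OF sub(1)] lt'[OF sub(3)]])
  show ?thesis by (simp only: siso_def bij_betw_def f_inj f_vg im ex conj_ac)
qed

end

section \<open>Isomorphism invariance of automorphism counts; existence of the coproduct\<close>

lemma iso_by_gunion:
  assumes wf: "wf_graph G1" "wf_graph G2" "wf_graph G1'" "wf_graph G2'"
    and s: "iso_by G1 G1' s1" "iso_by G2 G2' s2"
  shows "iso_by (gunion G1 G2) (gunion G1' G2') (glue (hn G1) s1 (\<lambda>x. s2 x + hn G1))"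
proof -
  have si: "siso G1 G1' s1" "siso G2 G2' s2" using s by (auto simp: iso_by_iff)
  have h: "hn G1' = hn G1" using siso_hn[OF si(1)] by simp
  let ?f = "glue (hn G1) s1 (\<lambda>x. s2 x + hn G1)"
  interpret glued_map G1 G2 G1' G2' ?f s1 s2
    using wf h siso_mem[OF si(1)] siso_mem[OF si(2)] by unfold_locales (auto simp: wf_graph_iff halves_lt)
  have e1: "eg G1 x \<in> halves G1" "s1 (eg G1 x) = eg G1' (s1 x)" if "x \<in> halves G1" for x
    using wf(1) s(1) that by (auto simp: wf_graph_iff pairing_def iso_by_iff)
  have e2: "eg G2 x \<in> halves G2" "s2 (eg G2 x) = eg G2' (s2 x)" if "x \<in> halves G2" for x
    using wf(2) s(2) that by (auto simp: wf_graph_iff pairing_def iso_by_iff)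
  have "?f (eg (gunion G1 G2) x) = eg (gunion G1' G2') (?f x)" if "x \<in> halves G1" for x
    using that e1[OF that] f1[OF that] eg_gunion(1)[of "s1 x" G1' G2'] eg_gunion(1)[of x G1 G2] h by (simp add: halves_lt)
  moreover have "?f (eg (gunion G1 G2) (x + hn G1)) = eg (gunion G1' G2') (?f (x + hn G1))"
    if "x \<in> halves G2" for x
    using that e2[OF that] eg_gunion(2)[of G1' G2' "s2 x"] eg_gunion(2)[of G1 G2 x] h by simp
  ultimately show ?thesis using si siso_gunion_iff by (auto simp: iso_by_iff halves_gunion)
qed

lemma giso_gunion:
  "wf_graph G1 \<Longrightarrow> wf_graph G2 \<Longrightarrow> wf_graph G1' \<Longrightarrow> wf_graph G2' \<Longrightarrow> giso G1 G1' \<Longrightarrow> giso G2 G2' \<Longrightarrow>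
    giso (gunion G1 G2) (gunion G1' G2')"
  unfolding giso_def using iso_by_gunion by blast

lemma card_isos_le:
  assumes wf: "wf_graph G" "wf_graph G'"
  shows "card {s \<in> halves G \<rightarrow>\<^sub>E halves G'. iso_by G G' s} \<le> card {s \<in> halves G' \<rightarrow>\<^sub>E halves G. iso_by G' G s}"
proof (rule card_inj_on_le)
  let ?i = "\<lambda>s. \<lambda>y\<in>halves G'. inv_into (halves G) s y"
  let ?A = "{s \<in> halves G \<rightarrow>\<^sub>E halves G'. iso_by G G' s}"
  have b: "bij_betw s (halves G) (halves G')" if "s \<in> ?A" for s
    using that by (simp add: iso_by_iff siso_def)
  show "inj_on ?i ?A"
  proof (rule inj_onI)
    fix s s' assume s: "s \<in> ?A" "s' \<in> ?A" and e: "?i s = ?i s'"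
    have "s x = s' x" if x: "x \<in> halves G" for x
    proof -
      have y: "s x \<in> halves G'" using bij_betw_apply[OF b[OF s(1)] x] .
      have "inv_into (halves G) s' (s x) = inv_into (halves G) s (s x)"
        using fun_cong[OF e, of "s x"] y by simp
      also have "\<dots> = x" by (rule inv_into_f_f[OF bij_betw_imp_inj_on[OF b[OF s(1)]] x])
      finally show ?thesis using bij_betw_inv_into_right[OF b[OF s(2)] y] by simp
    qed
    moreover have "s \<in> extensional (halves G)" "s' \<in> extensional (halves G)" using s by (auto simp: PiE_def)
    ultimately show "s = s'" by (intro extensionalityI) auto
  qed
  show "?i ` ?A \<subseteq> {s \<in> halves G' \<rightarrow>\<^sub>E halves G. iso_by G' G s}"
  proof (rule image_subsetI)
    fix s assume s: "s \<in> ?A"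
    have i: "iso_by G' G (inv_into (halves G) s)" using iso_by_inv[OF _ wf] s by blast
    then have m: "inv_into (halves G) s y \<in> halves G" if "y \<in> halves G'" for y
      using that siso_mem by (auto simp: iso_by_iff)
    have e: "eg G' y \<in> halves G'" if "y \<in> halves G'" for y using wf(2) that by (auto simp: wf_graph_iff pairing_def)
    have "siso G' G (?i s)"
      by (rule siso_cong[of _ _ "inv_into (halves G) s"]) (use i wf in \<open>auto simp: iso_by_iff wf_graph_iff\<close>)
    then have "iso_by G' G (?i s)" using i e by (simp add: iso_by_iff)
    moreover have "?i s \<in> halves G' \<rightarrow>\<^sub>E halves G" using m by auto
    ultimately show "?i s \<in> {s \<in> halves G' \<rightarrow>\<^sub>E halves G. iso_by G' G s}" by blast
  qed
  show "finite {s \<in> halves G' \<rightarrow>\<^sub>E halves G. iso_by G' G s}"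
    by (rule finite_subset[OF _ finite_PiE[of "halves G'" "\<lambda>_. halves G"]]) auto
qed

text \<open>By \<open>card_isos\<close> the isomorphisms from \<open>G\<close> to \<open>G'\<close>
  number |Aut G| and those in the other direction |Aut G'|; inversion matches them.\<close>

lemma card_Aut_giso:
  assumes "wf_graph G" "wf_graph G'" "giso G G'" shows "card (Aut G) = card (Aut G')"
  using card_isos_le[OF assms(1,2)] card_isos_le[OF assms(2,1)] assms giso_sym[OF assms(3,1,2)]
  by (simp add: card_isos)

lemma Iop_giso:
  "a \<in> Hhat \<Longrightarrow> wf_graph G \<Longrightarrow> wf_graph G' \<Longrightarrow> giso G G' \<Longrightarrow> Iop a G = Iop a G'"
  using card_Aut_giso[of G G'] Hhat_giso[of a G G'] by (simp add: Iop_def)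

text \<open>\<open>Delta\<close> is a definite description, so existence and uniqueness are due.
  \<open>IIop\<close> multiplies by |Aut G1| |Aut G2|, which is invertible in characteristic zero,
  so the solution is an explicit quotient, invariant under isomorphism.\<close>

lemma Delta_props:
  fixes a :: "graph \<Rightarrow> 'k::field_char_0"
  assumes a: "a \<in> Hhat"
  shows "Delta a \<in> HH"
    "\<And>G1 G2. wf_graph G1 \<Longrightarrow> wf_graph G2 \<Longrightarrow> IIop (Delta a) (G1, G2) = Iop a (gunion G1 G2)"
proof -
  define F where "F = (\<lambda>(G1, G2). if wf_graph G1 \<and> wf_graph G2
     then Iop a (gunion G1 G2) / (of_nat (card (Aut G1)) * of_nat (card (Aut G2))) else (0::'k))"
  define P where "P F \<longleftrightarrow> F \<in> HH \<and> (\<forall>G1 G2. wf_graph G1 \<longrightarrow> wf_graph G2 \<longrightarrow>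
     IIop F (G1, G2) = union_dual (Iop a) (G1, G2))" for F :: "graph \<times> graph \<Rightarrow> 'k"
  have nz: "(of_nat (card (Aut G)) :: 'k) \<noteq> 0" if "wf_graph G" for G
    using card_Aut_pos[OF that] by (metis less_irrefl of_nat_eq_0_iff)
  have inv: "F (G1, G2) = F (G1', G2')" if wf: "wf_graph G1" "wf_graph G2" "wf_graph G1'" "wf_graph G2'"
    and iso: "giso G1 G1'" "giso G2 G2'" for G1 G2 G1' G2'
  proof -
    have "Iop a (gunion G1 G2) = Iop a (gunion G1' G2')"
      by (rule Iop_giso[OF a wf_gunion[OF wf(1,2)] wf_gunion[OF wf(3,4)] giso_gunion[OF wf iso]])
    then show ?thesis
      using wf card_Aut_giso[OF wf(1,3) iso(1)] card_Aut_giso[OF wf(2,4) iso(2)] by (simp add: F_def)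
  qed
  have "F (G1, G2) = 0" if "\<not> (wf_graph G1 \<and> wf_graph G2)" for G1 G2
    unfolding F_def by (simp only: prod.case that if_False)
  then have "F \<in> HH" unfolding HH_def
    by (intro CollectI conjI allI impI) (assumption | rule inv | blast)+
  then have PF: "P F" using nz by (simp add: P_def IIop_def union_dual_def F_def)
  have uniq: "F' = F" if "P F'" for F'
  proof
    fix p :: "graph \<times> graph"
    obtain G1 G2 where p: "p = (G1, G2)" by (cases p)
    show "F' p = F p"
    proof (cases "wf_graph G1 \<and> wf_graph G2")
      case True
      then have "IIop F' (G1, G2) = IIop F (G1, G2)" using PF that by (simp add: P_def)
      then show ?thesis using nz True by (simp add: IIop_def p)
    next
      case False
      have "F'' (G1, G2) = 0" if "P F''" for F''
      proof -
        have "F'' \<in> HH" using that by (simp add: P_def)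
        then show ?thesis using False unfolding HH_def by blast
      qed
      from this[OF that] this[OF PF] show ?thesis by (simp only: p)
    qed
  qed
  have "Delta a = (THE F. P F)" by (simp only: Delta_def P_def)
  also have "\<dots> = F" using PF uniq by (rule the_equality)
  finally have "P (Delta a)" using PF by simp
  then show "Delta a \<in> HH"
    "\<And>G1 G2. wf_graph G1 \<Longrightarrow> wf_graph G2 \<Longrightarrow> IIop (Delta a) (G1, G2) = Iop a (gunion G1 G2)"
    by (auto simp: P_def union_dual_def)
qed

section \<open>Factorisation of stabilizers and pairings\<close>

definition label_maps :: "graph \<Rightarrow> (nat \<Rightarrow> nat) \<Rightarrow> (nat \<Rightarrow> nat) set" where
  "label_maps S t = {f \<in> halves S \<rightarrow>\<^sub>E halves S. \<forall>x\<in>halves S. t (f x) = t x}"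

definition glue_maps :: "graph \<Rightarrow> graph \<Rightarrow> (nat \<Rightarrow> nat) \<times> (nat \<Rightarrow> nat) \<Rightarrow> nat \<Rightarrow> nat" where
  "glue_maps S1 S2 p = (\<lambda>x\<in>halves (gunion S1 S2). glue (hn S1) (fst p) (\<lambda>x. snd p x + hn S1) x)"

lemma glue_maps_simps:
  "x \<in> halves S1 \<Longrightarrow> glue_maps S1 S2 p x = fst p x"
  "x \<in> halves S2 \<Longrightarrow> glue_maps S1 S2 p (x + hn S1) = snd p x + hn S1"
proof -
  assume "x \<in> halves S1"
  then show "glue_maps S1 S2 p x = fst p x" by (simp add: glue_maps_def halves_gunion halves_lt)
next
  assume "x \<in> halves S2"
  then have "x + hn S1 \<in> halves (gunion S1 S2)" by (simp add: halves_gunion)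
  then show "glue_maps S1 S2 p (x + hn S1) = snd p x + hn S1" by (simp add: glue_maps_def)
qed

lemma glue_maps_extensional: "glue_maps S1 S2 p \<in> extensional (halves (gunion S1 S2))"
  by (simp add: glue_maps_def)

lemma label_maps_mem: "f \<in> label_maps S t \<Longrightarrow> x \<in> halves S \<Longrightarrow> f x \<in> halves S"
  by (auto simp: label_maps_def)

text \<open>A label-preserving map cannot lead from one summand to the other, as they have no label
  in common. \<open>Stab\<close> and \<open>Pairings\<close> are both cut out of
  \<open>label_maps\<close>, so this one bijection yields both factorisations.\<close>

lemma bij_betw_glue_maps:
  assumes disj: "\<And>x y. x \<in> halves S1 \<Longrightarrow> y \<in> halves S2 \<Longrightarrow> t1 x \<noteq> t2 y"
  shows "bij_betw (glue_maps S1 S2) (label_maps S1 t1 \<times> label_maps S2 t2)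
    (label_maps (gunion S1 S2) (glue (hn S1) t1 t2))"
proof -
  let ?h = "hn S1" and ?U = "gunion S1 S2"
  let ?t = "glue ?h t1 t2" and ?f = "glue_maps S1 S2"
  \<comment> \<open>The truncated subtraction is harmless: by \<open>right\<close> below, values on
    the second summand stay there and are at least \<open>?h\<close>.\<close>
  let ?g = "\<lambda>f. (restrict f (halves S1), \<lambda>x\<in>halves S2. f (x + ?h) - ?h)"
  have in1: "x \<in> halves ?U" if "x \<in> halves S1" for x using that by (simp add: halves_gunion)
  have in2: "x + ?h \<in> halves ?U" if "x \<in> halves S2" for x using that by (simp add: halves_gunion)
  have tl: "?t x = t1 x" if "x \<in> halves S1" for x using that by (simp add: halves_lt)
  have U: "x \<in> halves S1 \<or> (\<exists>y\<in>halves S2. x = y + ?h)" if "x \<in> halves ?U" for x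
    using that by (auto simp: halves_gunion)
  have left: "f x \<in> halves S1" if f: "f \<in> label_maps ?U ?t" and x: "x \<in> halves S1" for f x
  proof (rule ccontr)
    assume "f x \<notin> halves S1"
    then obtain y where y: "y \<in> halves S2" "f x = y + ?h"
      using U label_maps_mem[OF f in1[OF x]] by blast
    have "?t (f x) = ?t x" using f in1[OF x] by (simp add: label_maps_def)
    then show False using disj[OF x y(1)] tl[OF x] y(2) by simp
  qed
  have right: "\<exists>y\<in>halves S2. f (x + ?h) = y + ?h" if f: "f \<in> label_maps ?U ?t" and x: "x \<in> halves S2" for f x
  proof (rule ccontr)
    assume "\<not> (\<exists>y\<in>halves S2. f (x + ?h) = y + ?h)"
    then have y: "f (x + ?h) \<in> halves S1" using U label_maps_mem[OF f in2[OF x]] by blast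
    have "?t (f (x + ?h)) = ?t (x + ?h)" using f in2[OF x] by (simp add: label_maps_def)
    then show False using disj[OF y x] tl[OF y] by simp
  qed
  show ?thesis
  proof (rule bij_betw_byWitness[where f' = ?g])
    have "?g (?f (f1, f2)) = (f1, f2)" if l: "f1 \<in> label_maps S1 t1" "f2 \<in> label_maps S2 t2" for f1 f2
    proof -
      have ext: "f1 \<in> extensional (halves S1)" "f2 \<in> extensional (halves S2)"
        using l by (auto simp: label_maps_def PiE_def)
      have "restrict (?f (f1, f2)) (halves S1) = f1"
        by (rule extensionalityI[OF restrict_extensional ext(1)])
          (simp only: restrict_apply' glue_maps_simps fst_conv)
      moreover have "(\<lambda>x\<in>halves S2. ?f (f1, f2) (x + ?h) - ?h) = f2"
        by (rule extensionalityI[OF restrict_extensional ext(2)])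
          (simp only: restrict_apply' glue_maps_simps snd_conv diff_add_inverse2)
      ultimately show ?thesis by (simp only:)
    qed
    then show "\<forall>p\<in>label_maps S1 t1 \<times> label_maps S2 t2. ?g (?f p) = p" by (intro Sigma_ballI)
    show "\<forall>f\<in>label_maps ?U ?t. ?f (?g f) = f"
    proof
      fix f assume f: "f \<in> label_maps ?U ?t"
      then have ext: "f \<in> extensional (halves ?U)" by (auto simp: label_maps_def PiE_def)
      show "?f (?g f) = f"
      proof (rule PiE_gunion_eqI[OF glue_maps_extensional ext])
        show "?f (?g f) x = f x" if "x \<in> halves S1" for x
          unfolding glue_maps_simps(1)[OF that] using that by simp
        show "?f (?g f) (x + ?h) = f (x + ?h)" if "x \<in> halves S2" for x
          unfolding glue_maps_simps(2)[OF that] using right[OF f that] that by auto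
      qed
    qed
    have "?f (f1, f2) \<in> label_maps ?U ?t" if l: "f1 \<in> label_maps S1 t1" "f2 \<in> label_maps S2 t2" for f1 f2
    proof -
      define f where "f = ?f (f1, f2)"
      have f1': "f x = f1 x" if "x \<in> halves S1" for x using glue_maps_simps(1)[OF that] by (simp add: f_def)
      have f2': "f (x + ?h) = f2 x + ?h" if "x \<in> halves S2" for x using glue_maps_simps(2)[OF that] by (simp add: f_def)
      have "f x \<in> halves ?U \<and> ?t (f x) = ?t x" if "x \<in> halves ?U" for x
        using U[OF that]
      proof
        assume x: "x \<in> halves S1"
        then have "f1 x \<in> halves S1" "t1 (f1 x) = t1 x" using l(1) by (auto simp: label_maps_def)
        then show ?thesis using f1'[OF x] in1 tl x by simp
      next
        assume "\<exists>y\<in>halves S2. x = y + ?h"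
        then obtain y where y: "y \<in> halves S2" "x = y + ?h" by blast
        then have "f2 y \<in> halves S2" "t2 (f2 y) = t2 y" using l(2) by (auto simp: label_maps_def)
        then show ?thesis using f2'[OF y(1)] in2 y by simp
      qed
      moreover have "f \<in> extensional (halves ?U)" unfolding f_def by (rule glue_maps_extensional)
      ultimately have "f \<in> label_maps ?U ?t" by (simp add: label_maps_def PiE_def Pi_def)
      then show ?thesis by (simp only: f_def)
    qed
    then show "?f ` (label_maps S1 t1 \<times> label_maps S2 t2) \<subseteq> label_maps ?U ?t"
      unfolding image_subset_iff by (intro Sigma_ballI)
    show "?g ` label_maps ?U ?t \<subseteq> label_maps S1 t1 \<times> label_maps S2 t2"
    proof (rule image_subsetI)
      fix f assume f: "f \<in> label_maps ?U ?t"
      have ft: "?t (f x) = ?t x" if "x \<in> halves ?U" for x using f that by (simp add: label_maps_def)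
      have "t1 (f x) = t1 x" if "x \<in> halves S1" for x
        using ft[OF in1[OF that]] tl[OF that] tl[OF left[OF f that]] by simp
      then have 1: "restrict f (halves S1) \<in> label_maps S1 t1"
        using left[OF f] by (auto simp: label_maps_def)
      have "f (x + ?h) - ?h \<in> halves S2 \<and> t2 (f (x + ?h) - ?h) = t2 x" if x: "x \<in> halves S2" for x
      proof -
        obtain y where y: "y \<in> halves S2" "f (x + ?h) = y + ?h" using right[OF f x] by blast
        then show ?thesis using ft[OF in2[OF x]] by simp
      qed
      then have 2: "(\<lambda>x\<in>halves S2. f (x + ?h) - ?h) \<in> label_maps S2 t2"
        by (auto simp: label_maps_def)
      show "?g f \<in> label_maps S1 t1 \<times> label_maps S2 t2" using 1 2 by blast
    qed
  qed
qed

lemma Stab_alt: "Stab S t = {f \<in> label_maps S t. siso S S f}"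
  by (auto simp: Stab_def label_maps_def)

lemma Pairings_alt: "Pairings S t = {f \<in> label_maps S t. pairing S f}"
  by (auto simp: Pairings_def label_maps_def)

lemma card_Stab_gunion:
  assumes S: "swf S1" "swf S2" and disj: "\<And>x y. x \<in> halves S1 \<Longrightarrow> y \<in> halves S2 \<Longrightarrow> t1 x \<noteq> t2 y"
  shows "card (Stab (gunion S1 S2) (glue (hn S1) t1 t2)) = card (Stab S1 t1) * card (Stab S2 t2)"
proof -
  have "bij_betw (glue_maps S1 S2)
     {p \<in> label_maps S1 t1 \<times> label_maps S2 t2. siso S1 S1 (fst p) \<and> siso S2 S2 (snd p)}
     {f \<in> label_maps (gunion S1 S2) (glue (hn S1) t1 t2). siso (gunion S1 S2) (gunion S1 S2) f}"
  proof (rule bij_betw_filter[OF bij_betw_glue_maps[OF disj]])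
    fix p assume p: "p \<in> label_maps S1 t1 \<times> label_maps S2 t2"
    interpret glued_map S1 S2 S1 S2 "glue_maps S1 S2 p" "fst p" "snd p"
      by unfold_locales
        (use S p label_maps_mem[of "fst p" S1 t1] label_maps_mem[of "snd p" S2 t2] in
          \<open>auto simp: glue_maps_simps mem_Times_iff\<close>)
    show "siso S1 S1 (fst p) \<and> siso S2 S2 (snd p) \<longleftrightarrow> siso (gunion S1 S2) (gunion S1 S2) (glue_maps S1 S2 p)"
      using siso_gunion_iff by simp
  qed
  then have "card (Stab (gunion S1 S2) (glue (hn S1) t1 t2)) =
    card {p \<in> label_maps S1 t1 \<times> label_maps S2 t2. siso S1 S1 (fst p) \<and> siso S2 S2 (snd p)}"
    unfolding Stab_alt by (rule bij_betw_same_card[symmetric])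
  also have "{p \<in> label_maps S1 t1 \<times> label_maps S2 t2. siso S1 S1 (fst p) \<and> siso S2 S2 (snd p)} =
    Stab S1 t1 \<times> Stab S2 t2"
    by (auto simp: Stab_alt)
  finally show ?thesis by (simp only: card_cartesian_product)
qed

lemma pairing_glue_maps:
  assumes "\<And>x. x \<in> halves S1 \<Longrightarrow> fst p x \<in> halves S1" "\<And>x. x \<in> halves S2 \<Longrightarrow> snd p x \<in> halves S2"
  shows "pairing (gunion S1 S2) (glue_maps S1 S2 p) \<longleftrightarrow> pairing S1 (fst p) \<and> pairing S2 (snd p)"
  unfolding pairing_def halves_gunion ball_Un
  using assms by (simp add: glue_maps_simps)

lemma sum_Pairings_gunion:
  assumes disj: "\<And>x y. x \<in> halves S1 \<Longrightarrow> y \<in> halves S2 \<Longrightarrow> t1 x \<noteq> t2 y"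
  shows "(\<Sum>e\<in>Pairings (gunion S1 S2) (glue (hn S1) t1 t2). g e) =
    (\<Sum>e1\<in>Pairings S1 t1. \<Sum>e2\<in>Pairings S2 t2. g (glue_maps S1 S2 (e1, e2)))"
proof -
  have "bij_betw (glue_maps S1 S2)
     {p \<in> label_maps S1 t1 \<times> label_maps S2 t2. pairing S1 (fst p) \<and> pairing S2 (snd p)}
     {f \<in> label_maps (gunion S1 S2) (glue (hn S1) t1 t2). pairing (gunion S1 S2) f}"
    by (rule bij_betw_filter[OF bij_betw_glue_maps[OF disj]])
      (auto simp: pairing_glue_maps label_maps_mem)
  moreover have "{p \<in> label_maps S1 t1 \<times> label_maps S2 t2. pairing S1 (fst p) \<and> pairing S2 (snd p)} =
    Pairings S1 t1 \<times> Pairings S2 t2"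
    by (auto simp: Pairings_alt)
  ultimately have "bij_betw (glue_maps S1 S2) (Pairings S1 t1 \<times> Pairings S2 t2)
     (Pairings (gunion S1 S2) (glue (hn S1) t1 t2))"
    by (simp only: Pairings_alt[symmetric])
  then have "(\<Sum>e\<in>Pairings (gunion S1 S2) (glue (hn S1) t1 t2). g e) =
    (\<Sum>p\<in>Pairings S1 t1 \<times> Pairings S2 t2. g (glue_maps S1 S2 p))"
    by (rule sum.reindex_bij_betw[symmetric])
  then show ?thesis by (simp add: sum.cartesian_product case_prod_unfold)
qed

text \<open>The two graphs differ only in \<open>eg\<close> off the half-edges, where
  \<open>glue_maps\<close> is undefined, and \<open>Iop\<close> does not see this.\<close>

lemma Iop_glue_maps:
  assumes a: "a \<in> Hhat" and S: "swf S1" "swf S2" and e: "e1 \<in> Pairings S1 t1" "e2 \<in> Pairings S2 t2"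
  shows "Iop a ((gunion S1 S2)\<lparr>eg := glue_maps S1 S2 (e1, e2)\<rparr>) =
    Iop a (gunion (S1\<lparr>eg := e1\<rparr>) (S2\<lparr>eg := e2\<rparr>))"
proof -
  define G where "G = gunion (S1\<lparr>eg := e1\<rparr>) (S2\<lparr>eg := e2\<rparr>)"
  have wf: "wf_graph G"
    unfolding G_def by (rule wf_gunion[OF wf_graph_Pairings[OF S(1) e(1)] wf_graph_Pairings[OF S(2) e(2)]])
  have "halves G = halves (gunion S1 S2)" by (simp add: G_def halves_gunion)
  moreover have "eg G x = glue (hn S1) e1 (\<lambda>x. e2 x + hn S1) x" for x
    by (simp add: G_def gunion_def glue_def)
  ultimately have "glue_maps S1 S2 (e1, e2) = restrict (eg G) (halves G)"
    by (intro ext) (simp add: glue_maps_def)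
  moreover have "(gunion S1 S2)\<lparr>eg := z\<rparr> = G\<lparr>eg := z\<rparr>" for z
    by (auto simp: G_def gunion_def fun_eq_iff)
  ultimately show ?thesis using Iop_restrict_eg[OF a wf] by (simp add: G_def[symmetric])
qed

lemma HH_slices:
  assumes "F \<in> HH" "wf_graph G"
  shows "(\<lambda>G'. F (G, G')) \<in> Hhat" "(\<lambda>G'. F (G', G)) \<in> Hhat"
  using assms giso_refl[of G] unfolding HH_def Hhat_def by blast+

text \<open>\<open>Phi_wick\<close> is applied in each argument with the other held fixed: in the
  second one at a class representative in the first, then in the first one at a pairing already
  chosen for the second.\<close>

lemma PhiPhi_wick:
  fixes F :: "graph \<times> graph \<Rightarrow> 'k::comm_ring_1"
  assumes F: "F \<in> HH" and S: "swf S1" "swf S2" and mn: "m \<ge> 1" "n \<ge> 1"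
    and t1: "\<And>x. x \<in> halves S1 \<Longrightarrow> t1 x \<in> {1..m}" and t2: "\<And>x. x \<in> halves S2 \<Longrightarrow> t2 x \<in> {1..n}"
  shows "of_nat (card (Stab S1 t1)) * (of_nat (card (Stab S2 t2)) *
      PhiPhi F (m, n) (gkey S1 t1, gkey S2 t2)) =
    (\<Sum>e1\<in>Pairings S1 t1. \<Sum>e2\<in>Pairings S2 t2. IIop F (S1\<lparr>eg := e1\<rparr>, S2\<lparr>eg := e2\<rparr>))"
proof -
  let ?k1 = "gkey S1 t1" and ?k2 = "gkey S2 t2"
  let ?D = "gclasses (kdeg ?k1 div 2)"
  let ?P = "Pairings S2 t2"
  let ?G = "\<lambda>e2. S2\<lparr>eg := e2\<rparr>"
  let ?A = "\<lambda>G. of_nat (card (Aut G)) :: 'k"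
  have "PhiPhi F (m, n) (?k1, ?k2) = (\<Sum>C\<in>?D. Phin m (rep C) ?k1 * Phi (\<lambda>G. F (rep C, G)) n ?k2)"
    using mn by (simp add: PhiPhi_def Phi_def sum_distrib_left mult_ac)
  then have "of_nat (card (Stab S2 t2)) * PhiPhi F (m, n) (?k1, ?k2) =
     (\<Sum>C\<in>?D. Phin m (rep C) ?k1 * (of_nat (card (Stab S2 t2)) * Phi (\<lambda>G. F (rep C, G)) n ?k2))"
    by (simp add: sum_distrib_left mult_ac)
  also have "\<dots> = (\<Sum>C\<in>?D. Phin m (rep C) ?k1 * (\<Sum>e2\<in>?P. ?A (?G e2) * F (rep C, ?G e2)))"
  proof (rule sum.cong[OF refl])
    fix C assume C: "C \<in> ?D"
    have "of_nat (card (Stab S2 t2)) * Phi (\<lambda>G. F (rep C, G)) n ?k2 =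
      (\<Sum>e2\<in>?P. Iop (\<lambda>G. F (rep C, G)) (?G e2))"
      by (rule Phi_wick[OF S(2) HH_slices(1)[OF F gclasses_rep(1)[OF C]] t2 mn(2)])
    then show "Phin m (rep C) ?k1 * (of_nat (card (Stab S2 t2)) * Phi (\<lambda>G. F (rep C, G)) n ?k2) =
      Phin m (rep C) ?k1 * (\<Sum>e2\<in>?P. ?A (?G e2) * F (rep C, ?G e2))"
      by (simp only: Iop_def)
  qed
  also have "\<dots> = (\<Sum>C\<in>?D. \<Sum>e2\<in>?P. ?A (?G e2) * (F (rep C, ?G e2) * Phin m (rep C) ?k1))"
    by (simp add: sum_distrib_left mult_ac)
  also have "\<dots> = (\<Sum>e2\<in>?P. \<Sum>C\<in>?D. ?A (?G e2) * (F (rep C, ?G e2) * Phin m (rep C) ?k1))"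
    by (rule sum.swap)
  also have "\<dots> = (\<Sum>e2\<in>?P. ?A (?G e2) * Phi (\<lambda>G. F (G, ?G e2)) m ?k1)"
    using mn by (simp add: Phi_def sum_distrib_left)
  finally have "of_nat (card (Stab S1 t1)) * (of_nat (card (Stab S2 t2)) * PhiPhi F (m, n) (?k1, ?k2)) =
    (\<Sum>e2\<in>?P. ?A (?G e2) * (of_nat (card (Stab S1 t1)) * Phi (\<lambda>G. F (G, ?G e2)) m ?k1))"
    by (simp add: sum_distrib_left mult_ac)
  also have "\<dots> = (\<Sum>e2\<in>?P. \<Sum>e1\<in>Pairings S1 t1. IIop F (S1\<lparr>eg := e1\<rparr>, ?G e2))"
  proof (rule sum.cong[OF refl])
    fix e2 assume e2: "e2 \<in> ?P"
    have "of_nat (card (Stab S1 t1)) * Phi (\<lambda>G. F (G, ?G e2)) m ?k1 =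
      (\<Sum>e1\<in>Pairings S1 t1. Iop (\<lambda>G. F (G, ?G e2)) (S1\<lparr>eg := e1\<rparr>))"
      by (rule Phi_wick[OF S(1) HH_slices(2)[OF F wf_graph_Pairings[OF S(2) e2]] t1 mn(1)])
    then show "?A (?G e2) * (of_nat (card (Stab S1 t1)) * Phi (\<lambda>G. F (G, ?G e2)) m ?k1) =
      (\<Sum>e1\<in>Pairings S1 t1. IIop F (S1\<lparr>eg := e1\<rparr>, ?G e2))"
      by (simp add: Iop_def IIop_def sum_distrib_left mult_ac)
  qed
  also have "\<dots> = (\<Sum>e1\<in>Pairings S1 t1. \<Sum>e2\<in>?P. IIop F (S1\<lparr>eg := e1\<rparr>, ?G e2))"
    by (rule sum.swap)
  finally show ?thesis .
qed

lemma mbinom_disjoint: "set_mset A \<inter> set_mset B = {} \<Longrightarrow> mbinom A B = 1"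
  unfolding mbinom_def
proof (rule prod.neutral, rule ballI)
  fix x assume d: "set_mset A \<inter> set_mset B = {}"
  then have "count A x = 0 \<or> count B x = 0" by (auto simp: count_eq_zero_iff)
  then show "(count (A + B) x choose count A x) = 1" by auto
qed

lemma shiftk_kmap: "shiftk m k = kmap (\<lambda>i. i + m) k"
  by (simp add: shiftk_def kmap_def)

text \<open>The first key uses indices up to \<open>m\<close>, the shifted one larger indices. The
  factors are nonempty, so no factor and no index is common to both, and the binomials of the
  coproduct are all 1.\<close>

lemma delta_amb_disjoint:
  assumes "valid_key m k1" "valid_key n k2"
  shows "delta_amb f (k1, shiftk m k2) = f (kadd k1 (shiftk m k2))"
proof -
  have gt: "i > m" if "i \<in># image_mset (\<lambda>i. i + m) r" "set_mset r \<subseteq> {1..n}" for i r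
    using that by auto
  have "set_mset (fst k1) \<inter> set_mset (fst (shiftk m k2)) = {}"
  proof (rule ccontr)
    assume "set_mset (fst k1) \<inter> set_mset (fst (shiftk m k2)) \<noteq> {}"
    then obtain r where r: "r \<in># fst k1" "r \<in># fst (shiftk m k2)" by blast
    then obtain r' where r': "r' \<in># fst k2" "r = image_mset (\<lambda>i. i + m) r'" by (auto simp: shiftk_def)
    have "r \<noteq> {#}" "set_mset r \<subseteq> {1..m}" using assms(1) r(1) by (auto simp: valid_key_def)
    then obtain i where "i \<in># r" "i \<le> m" by (meson atLeastAtMost_iff multiset_nonemptyE subsetD)
    then show False using gt[of i r'] r' assms(2) by (auto simp: valid_key_def)
  qed
  moreover have "set_mset (snd k1) \<inter> set_mset (snd (shiftk m k2)) = {}"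
    using assms gt[of _ "snd k2"] by (fastforce simp: valid_key_def shiftk_def)
  ultimately show ?thesis by (simp add: delta_amb_def mbinom_disjoint kadd_def)
qed

text \<open>Multiplied by the two stabilizer orders, both sides become the same sum over pairs of
  pairings: one by \<open>PhiPhi_wick\<close> and the defining property of \<open>Delta\<close>, the
  other by \<open>Phi_wick\<close> for the union of the structures. The automorphism factors in the
  definition of the coproduct are those of the Wick formula.\<close>

lemma PhiPhi_Delta:
  fixes a :: "graph \<Rightarrow> 'k::field_char_0"
  assumes a: "a \<in> Hhat"
  shows "PhiPhi (Delta a) = delta (Phi a)"
proof (intro ext)
  fix mn :: "nat \<times> nat" and kk :: "key \<times> key"
  obtain m n where mn: "mn = (m, n)" by (cases mn)
  obtain k1 k2 where kk: "kk = (k1, k2)" by (cases kk)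
  show "PhiPhi (Delta a) mn kk = delta (Phi a) mn kk"
  proof (cases "m \<ge> 1 \<and> n \<ge> 1 \<and> valid_key m k1 \<and> valid_key n k2")
    case False
    have "Phin m (rep C1) k1 * Phin n (rep C2) k2 = (0::'k)"
      if "\<not> (valid_key m k1 \<and> valid_key n k2)" "C1 \<in> gclasses N1" "C2 \<in> gclasses N2" for C1 C2 N1 N2
      using that(1) Phin_invalid[OF gclasses_rep(1)[OF that(2)], of m k1, where ?'a = 'k]
        Phin_invalid[OF gclasses_rep(1)[OF that(3)], of n k2, where ?'a = 'k] by auto
    then have "PhiPhi (Delta a) (m, n) (k1, k2) = 0"
      using False by (auto simp: PhiPhi_def mult.assoc intro!: sum.neutral)
    moreover have "delta (Phi a) (m, n) (k1, k2) = 0"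
      by (simp only: delta_def prod.case False if_False)
    ultimately show ?thesis by (simp add: mn kk)
  next
    case True
    then have m: "m \<ge> 1" and n: "n \<ge> 1" and v1: "valid_key m k1" and v2: "valid_key n k2" by auto
    obtain S1 t1 where S1: "swf S1" "gkey S1 t1 = k1" "\<forall>x\<in>halves S1. t1 x \<in> {1..m}"
      using v1 by (rule valid_key_realize)
    obtain S2 t2 where S2: "swf S2" "gkey S2 t2 = k2" "\<forall>x\<in>halves S2. t2 x \<in> {1..n}"
      using v2 by (rule valid_key_realize)
    \<comment> \<open>The shift realises the embedding of the second space behind the first
      \<open>m\<close> coordinates. Stabilizers and pairings depend only on which labels agree, so
      they stay the same.\<close>
    define t2' where "t2' x = t2 x + m" for x
    define U where "U = gunion S1 S2"
    define t where "t = glue (hn S1) t1 t2'"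
    have disj: "t1 x \<noteq> t2' y" if "x \<in> halves S1" "y \<in> halves S2" for x y
      using S1(3) S2(3) that by (fastforce simp: t2'_def)
    have st2: "Stab S2 t2' = Stab S2 t2" "Pairings S2 t2' = Pairings S2 t2"
      by (simp_all add: Stab_def Pairings_def t2'_def)
    have key: "gkey U t = kadd k1 (shiftk m k2)"
      unfolding U_def t_def gkey_gunion_glue[OF S1(1) S2(1)] shiftk_kmap S1(2)
      unfolding S2(2)[symmetric] kmap_gkey t2'_def[symmetric] by (rule refl)
    have swU: "swf U" unfolding U_def by (rule swf_gunion[OF S1(1) S2(1)])
    have tr: "t x \<in> {1..m + n}" if x: "x \<in> halves U" for x
    proof -
      consider "x \<in> halves S1" | y where "y \<in> halves S2" "x = y + hn S1"
        using x unfolding U_def halves_gunion by blast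
      then show ?thesis
      proof cases
        case 1
        then have "t x = t1 x" "t1 x \<in> {1..m}" using S1(3) by (auto simp: t_def halves_lt)
        then show ?thesis by simp
      next
        case 2
        then have "t x = t2 y + m" "t2 y \<in> {1..n}" using S2(3) by (auto simp: t_def t2'_def)
        then show ?thesis by simp
      qed
    qed
    let ?c1 = "of_nat (card (Stab S1 t1)) :: 'k" and ?c2 = "of_nat (card (Stab S2 t2)) :: 'k"
    have "?c1 * (?c2 * PhiPhi (Delta a) (m, n) (k1, k2)) =
      (\<Sum>e1\<in>Pairings S1 t1. \<Sum>e2\<in>Pairings S2 t2. IIop (Delta a) (S1\<lparr>eg := e1\<rparr>, S2\<lparr>eg := e2\<rparr>))"
      unfolding S1(2)[symmetric] S2(2)[symmetric]
      by (rule PhiPhi_wick[OF Delta_props(1)[OF a] S1(1) S2(1) m n]) (use S1(3) S2(3) in blast)+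
    also have "\<dots> = (\<Sum>e1\<in>Pairings S1 t1. \<Sum>e2\<in>Pairings S2 t2.
        Iop a (U\<lparr>eg := glue_maps S1 S2 (e1, e2)\<rparr>))"
    proof (intro sum.cong refl)
      fix e1 e2 assume e: "e1 \<in> Pairings S1 t1" "e2 \<in> Pairings S2 t2"
      show "IIop (Delta a) (S1\<lparr>eg := e1\<rparr>, S2\<lparr>eg := e2\<rparr>) = Iop a (U\<lparr>eg := glue_maps S1 S2 (e1, e2)\<rparr>)"
        unfolding U_def Iop_glue_maps[OF a S1(1) S2(1) e]
        by (rule Delta_props(2)[OF a wf_graph_Pairings[OF S1(1) e(1)] wf_graph_Pairings[OF S2(1) e(2)]])
    qed
    also have "\<dots> = (\<Sum>e\<in>Pairings U t. Iop a (U\<lparr>eg := e\<rparr>))"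
    proof -
      have "(\<Sum>e\<in>Pairings U t. Iop a (U\<lparr>eg := e\<rparr>)) = (\<Sum>e1\<in>Pairings S1 t1. \<Sum>e2\<in>Pairings S2 t2'.
        Iop a (U\<lparr>eg := glue_maps S1 S2 (e1, e2)\<rparr>))"
        unfolding U_def t_def by (rule sum_Pairings_gunion) (rule disj)
      then show ?thesis by (simp only: st2)
    qed
    also have "\<dots> = of_nat (card (Stab U t)) * Phi a (m + n) (gkey U t)"
      by (rule Phi_wick[OF swU a tr, symmetric]) (use m in auto)
    also have "\<dots> = ?c1 * (?c2 * Phi a (m + n) (kadd k1 (shiftk m k2)))"
    proof -
      have "card (Stab U t) = card (Stab S1 t1) * card (Stab S2 t2')"
        unfolding U_def t_def by (rule card_Stab_gunion[OF S1(1) S2(1)]) (rule disj)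
      then show ?thesis by (simp add: st2 key)
    qed
    finally have "?c1 * (?c2 * PhiPhi (Delta a) (m, n) (k1, k2)) =
      ?c1 * (?c2 * Phi a (m + n) (kadd k1 (shiftk m k2)))" .
    moreover have "?c1 \<noteq> 0" "?c2 \<noteq> 0"
      using card_Stab_pos[OF S1(1), of t1] card_Stab_pos[OF S2(1), of t2]
      by (metis less_irrefl of_nat_eq_0_iff)+
    ultimately have "PhiPhi (Delta a) (m, n) (k1, k2) = Phi a (m + n) (kadd k1 (shiftk m k2))"
      unfolding mult_cancel_left by blast
    then show ?thesis using True delta_amb_disjoint[OF v1 v2, of "Phi a (m + n)"]
      by (simp add: mn kk delta_def)
  qed
qed

theorem theorem3p10:
  shows "bij_betw (Phi :: (graph \<Rightarrow> 'k::field_char_0) \<Rightarrow> _) Hhat linf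
    \<and> (\<forall>a\<in>(Hhat :: (graph \<Rightarrow> 'k) set). \<forall>b\<in>Hhat.
          Phi (\<lambda>G. a G + b G) = (\<lambda>n k. Phi a n k + Phi b n k))
    \<and> (\<forall>(c :: 'k). \<forall>a\<in>(Hhat :: (graph \<Rightarrow> 'k) set). Phi (\<lambda>G. c * a G) = (\<lambda>n k. c * Phi a n k))
    \<and> (\<forall>a\<in>(Hhat :: (graph \<Rightarrow> 'k) set). \<forall>b\<in>Hhat. Phi (hunion a b) = mu (Phi a) (Phi b))
    \<and> Phi (H_unit :: graph \<Rightarrow> 'k) = l_unit
    \<and> (\<forall>a\<in>(Hhat :: (graph \<Rightarrow> 'k) set). PhiPhi (Delta a) = delta (Phi a))
    \<and> (\<forall>a\<in>(Hhat :: (graph \<Rightarrow> 'k) set). l_counit (Phi a) = H_counit a)"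
  by (intro conjI ballI allI bij_betw_Phi Phi_add Phi_scale Phi_hunion Phi_H_unit PhiPhi_Delta l_counit_Phi)

end
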